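(* 1. For $i\in\{1,2\}$, let $(G_i, \mathcal{H}_i\cup\{K_i\})$ be a pair in $\mathcal D$ and $\partial_i\colon C\to K_i$ a group monomorphism. Let $G_1\ast_C G_2$ be the amalgamated product determined by $G_1\xleftarrow{\partial_1}C\xrightarrow{\partial_2}G_2$, and let $\mathcal{H}=\mathcal{H}_1\cup\mathcal{H}_2$. If $\Delta$ is a relative Dehn function of $(G_1\ast_C G_2, \mathcal{H} \cup\{\langle K_1,K_2 \rangle\})$ and $\Delta_i$ is a relative Dehn function of $(G_i, \mathcal{H}_i \cup\{K_i\})$ for $i=1,2$, then \[ \max\{\Delta_1,\Delta_2\} \preceq \Delta \preceq \max\left\{\overline{\Delta_1} , \overline{\Delta_2} \right\}.\] 2. Let $(G, \mathcal{H} \cup\{K,L\})$ be a pair in $\mathcal D$ with $K\neq L$, $C$ a subgroup of $K$, $\varphi\colon C\to L$ a group monomorphism, and $G\ast_{\varphi}=\langle G, t\mid t c t^{-1} =\varphi(c)\ \text{for all } c\in C \rangle$. If $\Delta$ is a relative Dehn function of $(G\ast_\varphi, \mathcal{H} \cup\{\langle K^t,L \rangle\})$ and $\Delta_0$ is a relative Dehn function of $(G , \mathcal{H} \cup\{K, L\})$, then \[ \Delta_0 \preceq \Delta \preceq \overline{\Delta_0 }.\] 3. Let $(G, \mathcal{H} \cup\{K\})$ be a pair in $\mathcal D$, $C$ a subgroup of $K$, $s\in G$, $\varphi\colon C\to K^s$ a group monomorphism, and $G\ast_{\varphi}=\langle G, t\mid t c t^{-1} =\varphi(c)\ \text{for all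 } c\in C \rangle$. If $\Delta$ is a relative Dehn function of $(G\ast_{\varphi},\mathcal H \cup\{\langle K, s^{-1}t\rangle\})$ and $\Delta_0$ is a relative Dehn function of $(G, \mathcal{H}\cup\{K\})$, then \[ \Delta_0 \preceq \Delta \preceq \overline{\Delta_0}.\] Here $\overline{g}$ denotes the super-additive closure of a function $g$.
   Context: A pair $(G,\mathcal H)$ consists of a group $G$ and a finite collection $\mathcal H$ of subgroups of $G$. In collections written $\mathcal H\cup\{K\}$, $\mathcal H_i\cup\{K_i\}$ or $\mathcal H\cup\{K,L\}$ with $K,K_i,L$ subgroups of the base groups, the subgroups $K$, $K_i$, $L$ are distinguished members that are not elements of $\mathcal H$, respectively $\mathcal H_i$. $K^g$ denotes $gKg^{-1}$. Vertex (base) groups and their subgroups are regarded as subgroups of the amalgamated product or HNN-extension, and $\langle\cdot\rangle$ denotes the subgroup generated. Relative Dehn functions. For $S\subseteq G$ put $F(S,\mathcal H)=F(S)\ast\left(\ast_{H\in\mathcal H}H\right)$, where $F(S)$ is the free group on $S$. A presentation $\langle S,\mathcal H\mid R\rangle$ of $(G,\mathcal H)$ consists of $S\subseteq G$ such that the natural map $F(S,\mathcal H)\to G$ is surjective and $R\subseteq F(S,\mathcal H)$ normally generating its kernel; it is finite if $S$ and $R$ are finite. For a finite presentation, a function $f\colon\mathbb N\to\mathbb N$ is a relative isoperimetric function if every word $W$ of length at most $n$ over $S^{\pm1}\sqcup\bigsqcup_{H\in\mathcal H}(H\setminus\{1\})$ representing $1$ in $G$ can be written in $F(S,\mathcal H)$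 as $W=\prod_{i=1}^k f_i^{-1}R_if_i$ with $R_i\in R\cup R^{-1}$, $f_i\in F(S,\mathcal H)$ and $k\le f(n)$. The smallest such function is the relative Dehn function associated with the finite presentation; it is well-defined if it takes only finite values (a property independent of the finite presentation). $(G,\mathcal H)\in\mathcal D$ means that $(G,\mathcal H)$ has a finite presentation and its relative Dehn function is well-defined. "A relative Dehn function of $(G,\mathcal H)$" means one associated with some finite presentation. Under the stated hypotheses the pairs formed from the amalgamated product and the HNN-extensions also belong to $\mathcal D$. For $f,g\colon \mathbb{N}\to \mathbb{N}$, $f\preceq g$ means there exist $C,K,L\in \mathbb{N}$ with $f(n)\leq Cg(Kn)+Ln$ for every $n$. A function $g\colon\mathbb N\to\mathbb N$ is super-additive if $g(m)+g(n)\le g(m+n)$ for all $m,n$. If $g(0)=0$, its super-additive closure is $\overline{g}(n) = \max\left\{ \sum_{i=1}^k g(n_i) \mid k\in\mathbb{N},\ n_i\in\mathbb{N},\ \sum_{i=1}^kn_i=n \right\}$, the least super-additive function with $g\le\overline g$. *)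

theory Defs
  imports "HOL-Algebra.Generated_Groups"
begin

section \<open>Groups given by generators and relations\<close>

text \<open>
  The free products, amalgamated products and HNN-extensions below are all quotients of a free
  monoid of words by a congruence. When every letter is invertible modulo the congruence, the
  quotient is a group (lemma \<open>group_presented\<close>); this covers all the uses below.
\<close>

inductive word_eq :: "('l list \<times> 'l list) set \<Rightarrow> 'l list \<Rightarrow> 'l list \<Rightarrow> bool"
  for R :: "('l list \<times> 'l list) set" where
  rel: "(u, v) \<in> R \<Longrightarrow> word_eq R (x @ u @ y) (x @ v @ y)"
| refl: "word_eq R u u"
| sym: "word_eq R u v \<Longrightarrow> word_eq R v u"
| trans: "word_eq R u v \<Longrightarrow> word_eq R v w \<Longrightarrow> word_eq R u w"

definition word_class :: "('l list \<times> 'l list) set \<Rightarrow> 'l list \<Rightarrow> 'l list set" where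
  "word_class R u = {v. word_eq R u v}"

definition presented :: "'l set \<Rightarrow> ('l list \<times> 'l list) set \<Rightarrow> 'l list set monoid" where
  "presented L R =
     \<lparr>carrier = word_class R ` lists L,
      monoid.mult = (\<lambda>A B. {w. \<exists>u\<in>A. \<exists>v\<in>B. word_eq R (u @ v) w}),
      monoid.one = word_class R []\<rparr>"

text \<open>
  The multiplication table of \<open>G\<close> restricted to \<open>H\<close>, written with the letters \<open>\<iota> h\<close>: these are
  the relations of \<open>H\<close> on the generating set of all its elements.
\<close>

definition table_rels :: "'a monoid \<Rightarrow> 'a set \<Rightarrow> ('a \<Rightarrow> 'l) \<Rightarrow> ('l list \<times> 'l list) set" where
  "table_rels G H \<iota> =
     insert ([\<iota> \<one>\<^bsub>G\<^esub>], []) {([\<iota> x, \<iota> y], [\<iota> (x \<otimes>\<^bsub>G\<^esub> y)]) | x y. x \<in> H \<and> y \<in> H}"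

section \<open>Relative presentations and relative Dehn functions\<close>

definition group_pair :: "'a monoid \<Rightarrow> 'a set set \<Rightarrow> bool" where
  "group_pair G \<H> \<longleftrightarrow> group G \<and> finite \<H> \<and> (\<forall>H\<in>\<H>. subgroup H G)"

text \<open>
  The letters are formal: \<open>Gen s\<close> and \<open>GenInv s\<close> stand for \<open>s\<close> and its formal inverse, and
  \<open>Per H h\<close> is the copy of \<open>h\<close> in the free factor \<open>H\<close>, so that the copies of an element lying
  in several members of the collection are different letters.
\<close>

datatype 'a rel_letter = Gen 'a | GenInv 'a | Per "'a set" 'a

definition rel_alphabet :: "'a set \<Rightarrow> 'a set set \<Rightarrow> 'a rel_letter set" where
  "rel_alphabet S \<H> = Gen ` S \<union> GenInv ` S \<union> (\<Union>H\<in>\<H>. Per H ` H)"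

definition rel_free_rels ::
    "'a monoid \<Rightarrow> 'a set \<Rightarrow> 'a set set \<Rightarrow> ('a rel_letter list \<times> 'a rel_letter list) set" where
  "rel_free_rels G S \<H> =
     (\<Union>s\<in>S. {([Gen s, GenInv s], []), ([GenInv s, Gen s], [])})
     \<union> (\<Union>H\<in>\<H>. table_rels G H (Per H))"

text \<open>The group \<open>F(S, \<H>)\<close>, the free product of the free group on \<open>S\<close> and all \<open>H \<in> \<H>\<close>.\<close>

definition rel_free :: "'a monoid \<Rightarrow> 'a set \<Rightarrow> 'a set set \<Rightarrow> 'a rel_letter list set monoid" where
  "rel_free G S \<H> = presented (rel_alphabet S \<H>) (rel_free_rels G S \<H>)"

definition rel_elem ::
    "'a monoid \<Rightarrow> 'a set \<Rightarrow> 'a set set \<Rightarrow> 'a rel_letter list \<Rightarrow> 'a rel_letter list set" where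
  "rel_elem G S \<H> w = word_class (rel_free_rels G S \<H>) w"

fun letter_value :: "'a monoid \<Rightarrow> 'a rel_letter \<Rightarrow> 'a" where
  "letter_value G (Gen s) = s"
| "letter_value G (GenInv s) = inv\<^bsub>G\<^esub> s"
| "letter_value G (Per H h) = h"

fun word_value :: "'a monoid \<Rightarrow> 'a rel_letter list \<Rightarrow> 'a" where
  "word_value G [] = \<one>\<^bsub>G\<^esub>"
| "word_value G (l # w) = letter_value G l \<otimes>\<^bsub>G\<^esub> word_value G w"

text \<open>
  The choice of a representative in the natural map \<open>F(S, \<H>) \<rightarrow> G\<close> is immaterial
  (lemma \<open>rel_nat_map_elem\<close>).
\<close>

definition rel_nat_map :: "'a monoid \<Rightarrow> 'a rel_letter list set \<Rightarrow> 'a" where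
  "rel_nat_map G A = word_value G (SOME w. w \<in> A)"

definition normal_closure :: "'a monoid \<Rightarrow> 'a set \<Rightarrow> 'a set" where
  "normal_closure G R = \<Inter>{N. N \<lhd> G \<and> R \<subseteq> N}"

definition rel_presentation ::
    "'a monoid \<Rightarrow> 'a set set \<Rightarrow> 'a set \<Rightarrow> 'a rel_letter list set set \<Rightarrow> bool" where
  "rel_presentation G \<H> S R \<longleftrightarrow>
     S \<subseteq> carrier G \<and>
     R \<subseteq> carrier (rel_free G S \<H>) \<and>
     rel_nat_map G ` carrier (rel_free G S \<H>) = carrier G \<and>
     normal_closure (rel_free G S \<H>) R = kernel (rel_free G S \<H>) G (rel_nat_map G)"

definition finite_rel_presentation ::
    "'a monoid \<Rightarrow> 'a set set \<Rightarrow> 'a set \<Rightarrow> 'a rel_letter list set set \<Rightarrow> bool" where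
  "finite_rel_presentation G \<H> S R \<longleftrightarrow> rel_presentation G \<H> S R \<and> finite S \<and> finite R"

text \<open>The words over \<open>S\<^sup>\<plusminus>\<^sup>1\<close> and the disjoint union of the sets \<open>H - {1}\<close>.\<close>

definition rel_words :: "'a monoid \<Rightarrow> 'a set set \<Rightarrow> 'a set \<Rightarrow> 'a rel_letter list set" where
  "rel_words G \<H> S = lists (rel_alphabet S \<H> - (\<lambda>H. Per H \<one>\<^bsub>G\<^esub>) ` \<H>)"

definition conj_prod :: "'a monoid \<Rightarrow> ('a \<times> 'a) list \<Rightarrow> 'a" where
  "conj_prod F ps = foldr (\<otimes>\<^bsub>F\<^esub>) (map (\<lambda>(f, r). inv\<^bsub>F\<^esub> f \<otimes>\<^bsub>F\<^esub> r \<otimes>\<^bsub>F\<^esub> f) ps) \<one>\<^bsub>F\<^esub>"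

definition rel_isoperimetric ::
    "'a monoid \<Rightarrow> 'a set set \<Rightarrow> 'a set \<Rightarrow> 'a rel_letter list set set \<Rightarrow> (nat \<Rightarrow> nat) \<Rightarrow> bool" where
  "rel_isoperimetric G \<H> S R f \<longleftrightarrow>
     (let F = rel_free G S \<H> in
      \<forall>n. \<forall>W \<in> rel_words G \<H> S. length W \<le> n \<and> word_value G W = \<one>\<^bsub>G\<^esub> \<longrightarrow>
        (\<exists>ps. length ps \<le> f n \<and>
              set ps \<subseteq> carrier F \<times> (R \<union> (\<lambda>r. inv\<^bsub>F\<^esub> r) ` R) \<and>
              rel_elem G S \<H> W = conj_prod F ps))"

text \<open>
  Isoperimetric functions take finite values by their type, so the relative Dehn function of a
  presentation is well-defined iff a function as in the following definition exists.
\<close>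

definition rel_dehn_of ::
    "'a monoid \<Rightarrow> 'a set set \<Rightarrow> 'a set \<Rightarrow> 'a rel_letter list set set \<Rightarrow> (nat \<Rightarrow> nat) \<Rightarrow> bool" where
  "rel_dehn_of G \<H> S R \<Delta> \<longleftrightarrow>
     rel_isoperimetric G \<H> S R \<Delta> \<and> (\<forall>f. rel_isoperimetric G \<H> S R f \<longrightarrow> \<Delta> \<le> f)"

definition rel_dehn_function :: "'a monoid \<Rightarrow> 'a set set \<Rightarrow> (nat \<Rightarrow> nat) \<Rightarrow> bool" where
  "rel_dehn_function G \<H> \<Delta> \<longleftrightarrow>
     group_pair G \<H> \<and> (\<exists>S R. finite_rel_presentation G \<H> S R \<and> rel_dehn_of G \<H> S R \<Delta>)"

definition class_D :: "'a monoid \<Rightarrow> 'a set set \<Rightarrow> bool" where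
  "class_D G \<H> \<longleftrightarrow>
     group_pair G \<H> \<and> (\<exists>S R. finite_rel_presentation G \<H> S R \<and> (\<exists>\<Delta>. rel_dehn_of G \<H> S R \<Delta>))"

section \<open>Amalgamated products and HNN-extensions\<close>

definition amalg_rels ::
    "'a monoid \<Rightarrow> 'b monoid \<Rightarrow> 'c monoid \<Rightarrow> ('c \<Rightarrow> 'a) \<Rightarrow> ('c \<Rightarrow> 'b)
      \<Rightarrow> (('a + 'b) list \<times> ('a + 'b) list) set" where
  "amalg_rels G1 G2 C \<delta>1 \<delta>2 =
     table_rels G1 (carrier G1) Inl \<union> table_rels G2 (carrier G2) Inr
     \<union> {([Inl (\<delta>1 c)], [Inr (\<delta>2 c)]) | c. c \<in> carrier C}"

definition amalg ::
    "'a monoid \<Rightarrow> 'b monoid \<Rightarrow> 'c monoid \<Rightarrow> ('c \<Rightarrow> 'a) \<Rightarrow> ('c \<Rightarrow> 'b) \<Rightarrow> ('a + 'b) list set monoid" where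
  "amalg G1 G2 C \<delta>1 \<delta>2 = presented (Inl ` carrier G1 \<union> Inr ` carrier G2) (amalg_rels G1 G2 C \<delta>1 \<delta>2)"

definition amalg_inl ::
    "'a monoid \<Rightarrow> 'b monoid \<Rightarrow> 'c monoid \<Rightarrow> ('c \<Rightarrow> 'a) \<Rightarrow> ('c \<Rightarrow> 'b) \<Rightarrow> 'a \<Rightarrow> ('a + 'b) list set" where
  "amalg_inl G1 G2 C \<delta>1 \<delta>2 x = word_class (amalg_rels G1 G2 C \<delta>1 \<delta>2) [Inl x]"

definition amalg_inr ::
    "'a monoid \<Rightarrow> 'b monoid \<Rightarrow> 'c monoid \<Rightarrow> ('c \<Rightarrow> 'a) \<Rightarrow> ('c \<Rightarrow> 'b) \<Rightarrow> 'b \<Rightarrow> ('a + 'b) list set" where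
  "amalg_inr G1 G2 C \<delta>1 \<delta>2 y = word_class (amalg_rels G1 G2 C \<delta>1 \<delta>2) [Inr y]"

datatype 'a hnn_letter = Base 'a | Stable | StableInv

definition hnn_rels ::
    "'a monoid \<Rightarrow> 'a set \<Rightarrow> ('a \<Rightarrow> 'a) \<Rightarrow> ('a hnn_letter list \<times> 'a hnn_letter list) set" where
  "hnn_rels G C \<phi> =
     table_rels G (carrier G) Base
     \<union> {([Stable, StableInv], []), ([StableInv, Stable], [])}
     \<union> {([Stable, Base c, StableInv], [Base (\<phi> c)]) | c. c \<in> C}"

definition hnn :: "'a monoid \<Rightarrow> 'a set \<Rightarrow> ('a \<Rightarrow> 'a) \<Rightarrow> 'a hnn_letter list set monoid" where
  "hnn G C \<phi> = presented (Base ` carrier G \<union> {Stable, StableInv}) (hnn_rels G C \<phi>)"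

definition hnn_base :: "'a monoid \<Rightarrow> 'a set \<Rightarrow> ('a \<Rightarrow> 'a) \<Rightarrow> 'a \<Rightarrow> 'a hnn_letter list set" where
  "hnn_base G C \<phi> x = word_class (hnn_rels G C \<phi>) [Base x]"

definition hnn_stable :: "'a monoid \<Rightarrow> 'a set \<Rightarrow> ('a \<Rightarrow> 'a) \<Rightarrow> 'a hnn_letter list set" where
  "hnn_stable G C \<phi> = word_class (hnn_rels G C \<phi>) [Stable]"

text \<open>\<open>K\<^sup>g = g K g\<^sup>-\<^sup>1\<close>.\<close>

definition conj_set :: "'a monoid \<Rightarrow> 'a set \<Rightarrow> 'a \<Rightarrow> 'a set" where
  "conj_set G K g = (\<lambda>k. g \<otimes>\<^bsub>G\<^esub> k \<otimes>\<^bsub>G\<^esub> inv\<^bsub>G\<^esub> g) ` K"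

section \<open>Comparison of functions\<close>

definition asymp_le :: "(nat \<Rightarrow> nat) \<Rightarrow> (nat \<Rightarrow> nat) \<Rightarrow> bool" (infix \<open>\<preceq>\<close> 50) where
  "f \<preceq> g \<longleftrightarrow> (\<exists>C K L :: nat. \<forall>n. f n \<le> C * g (K * n) + L * n)"

text \<open>
  Only meant for \<open>g 0 = 0\<close>, which makes the set of sums finite. Relative Dehn functions satisfy
  this (lemma \<open>rel_dehn_function_0\<close>).
\<close>

definition superadd_closure :: "(nat \<Rightarrow> nat) \<Rightarrow> nat \<Rightarrow> nat" where
  "superadd_closure g n = Max {sum_list (map g ns) | ns. sum_list ns = n}"

section \<open>Adequacy of the encodings\<close>

lemma word_eq_context: "word_eq R u v \<Longrightarrow> word_eq R (x @ u @ y) (x @ v @ y)"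
proof (induction rule: word_eq.induct)
  case (rel u v x' y')
  then show ?case using word_eq.rel[of u v R "x @ x'" "y' @ y"] by simp
qed (blast intro: word_eq.intros)+

lemma word_eq_append: "word_eq R u u' \<Longrightarrow> word_eq R v v' \<Longrightarrow> word_eq R (u @ v) (u' @ v')"
  using word_eq_context[of R u u' "[]" v] word_eq_context[of R v v' u' "[]"]
  by (auto intro: word_eq.trans)

lemma word_class_eq_iff: "word_class R u = word_class R v \<longleftrightarrow> word_eq R u v"
  unfolding word_class_def by (blast intro: word_eq.intros)

lemma presented_mult:
  "word_class R u \<otimes>\<^bsub>presented L R\<^esub> word_class R v = word_class R (u @ v)"
  unfolding presented_def word_class_def
  by (auto intro: word_eq.intros) (meson word_eq_append word_eq.trans)

lemma presented_one: "\<one>\<^bsub>presented L R\<^esub> = word_class R []"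
  by (simp add: presented_def)

lemma presented_carrier: "carrier (presented L R) = word_class R ` lists L"
  by (simp add: presented_def)

lemma presented_inverse:
  assumes "\<And>l. l \<in> L \<Longrightarrow> \<exists>l'\<in>L. word_eq R [l', l] []" and "w \<in> lists L"
  shows "\<exists>w'\<in>lists L. word_eq R (w' @ w) []"
  using assms(2)
proof (induction w)
  case Nil
  show ?case by (rule bexI[of _ "[]"]) (auto intro: word_eq.refl)
next
  case (Cons l w)
  then obtain w' where w': "w' \<in> lists L" "word_eq R (w' @ w) []" by auto
  obtain l' where l': "l' \<in> L" "word_eq R [l', l] []" using assms(1) Cons.hyps by blast
  have "word_eq R (w' @ [l', l] @ w) (w' @ [] @ w)"
    using l'(2) by (rule word_eq_context)
  then have "word_eq R ((w' @ [l']) @ l # w) []"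
    using w'(2) by (auto intro: word_eq.trans)
  then show ?case using w'(1) l'(1) by (intro bexI[of _ "w' @ [l']"]) auto
qed

lemma group_presented:
  assumes "\<And>l. l \<in> L \<Longrightarrow> \<exists>l'\<in>L. word_eq R [l', l] []"
  shows "group (presented L R)"
proof (rule groupI)
  fix x assume "x \<in> carrier (presented L R)"
  then obtain w where w: "w \<in> lists L" "x = word_class R w" by (auto simp: presented_carrier)
  obtain w' where "w' \<in> lists L" "word_eq R (w' @ w) []"
    using presented_inverse[OF assms w(1)] by blast
  then show "\<exists>y\<in>carrier (presented L R). y \<otimes>\<^bsub>presented L R\<^esub> x = \<one>\<^bsub>presented L R\<^esub>"
    by (auto simp: w(2) presented_carrier presented_mult presented_one word_class_eq_iff
        intro!: bexI[of _ w'])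
next
  fix x y assume "x \<in> carrier (presented L R)" "y \<in> carrier (presented L R)"
  then obtain u v where "u \<in> lists L" "x = word_class R u" "v \<in> lists L" "y = word_class R v"
    by (auto simp: presented_carrier)
  then show "x \<otimes>\<^bsub>presented L R\<^esub> y \<in> carrier (presented L R)"
    unfolding presented_carrier by (auto simp: presented_mult intro!: imageI)
qed (auto simp: presented_carrier presented_mult presented_one)

lemma word_eq_base: "(u, v) \<in> R \<Longrightarrow> word_eq R u v"
  using word_eq.rel[of u v R "[]" "[]"] by simp

lemma table_rels_inverse:
  assumes "group G" "subgroup H G" "table_rels G H \<iota> \<subseteq> R" "h \<in> H"
  shows "inv\<^bsub>G\<^esub> h \<in> H" "word_eq R [\<iota> (inv\<^bsub>G\<^esub> h), \<iota> h] []"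
proof -
  interpret group G by fact
  show i: "inv\<^bsub>G\<^esub> h \<in> H" using assms by (simp add: subgroup.m_inv_closed)
  have h: "h \<in> carrier G" using subgroup.mem_carrier[OF assms(2,4)] .
  have "([\<iota> (inv\<^bsub>G\<^esub> h), \<iota> h], [\<iota> (inv\<^bsub>G\<^esub> h \<otimes>\<^bsub>G\<^esub> h)]) \<in> R"
    using assms(3,4) i by (auto simp: table_rels_def)
  then have "([\<iota> (inv\<^bsub>G\<^esub> h), \<iota> h], [\<iota> \<one>\<^bsub>G\<^esub>]) \<in> R" using h by simp
  moreover have "([\<iota> \<one>\<^bsub>G\<^esub>], []) \<in> R" using assms(3) by (auto simp: table_rels_def)
  ultimately show "word_eq R [\<iota> (inv\<^bsub>G\<^esub> h), \<iota> h] []"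
    by (meson word_eq_base word_eq.trans)
qed

lemma rel_alphabet_iff:
  "Gen s \<in> rel_alphabet S \<H> \<longleftrightarrow> s \<in> S"
  "GenInv s \<in> rel_alphabet S \<H> \<longleftrightarrow> s \<in> S"
  "Per H h \<in> rel_alphabet S \<H> \<longleftrightarrow> H \<in> \<H> \<and> h \<in> H"
  by (auto simp: rel_alphabet_def)

lemma group_rel_free:
  assumes "group_pair G \<H>"
  shows "group (rel_free G S \<H>)"
  unfolding rel_free_def
proof (rule group_presented)
  fix l assume "l \<in> rel_alphabet S \<H>"
  then consider s where "s \<in> S" "l = Gen s" | s where "s \<in> S" "l = GenInv s"
    | H h where "H \<in> \<H>" "h \<in> H" "l = Per H h"
    unfolding rel_alphabet_def by blast
  then show "\<exists>l'\<in>rel_alphabet S \<H>. word_eq (rel_free_rels G S \<H>) [l', l] []"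
  proof cases
    case 1
    then show ?thesis
      by (intro bexI[of _ "GenInv s"] word_eq_base) (auto simp: rel_alphabet_def rel_free_rels_def)
  next
    case 2
    then show ?thesis
      by (intro bexI[of _ "Gen s"] word_eq_base) (auto simp: rel_alphabet_def rel_free_rels_def)
  next
    case 3
    then have "table_rels G H (Per H) \<subseteq> rel_free_rels G S \<H>"
      unfolding rel_free_rels_def by blast
    moreover have "group G" "subgroup H G" using assms 3 by (auto simp: group_pair_def)
    ultimately show ?thesis
      using table_rels_inverse[of G H "Per H" "rel_free_rels G S \<H>" h] 3
      by (intro bexI[of _ "Per H (inv\<^bsub>G\<^esub> h)"]) (auto simp: rel_alphabet_def)
  qed
qed

lemma group_amalg:
  assumes "group G1" "group G2"
  shows "group (amalg G1 G2 C \<delta>1 \<delta>2)"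
  unfolding amalg_def
proof (rule group_presented)
  let ?L = "Inl ` carrier G1 \<union> Inr ` carrier G2" and ?R = "amalg_rels G1 G2 C \<delta>1 \<delta>2"
  fix l assume "l \<in> ?L"
  moreover have "table_rels G1 (carrier G1) Inl \<subseteq> ?R" "table_rels G2 (carrier G2) Inr \<subseteq> ?R"
    by (auto simp: amalg_rels_def)
  ultimately show "\<exists>l'\<in>?L. word_eq ?R [l', l] []"
    using table_rels_inverse[OF assms(1) group.subgroup_self[OF assms(1)], of Inl ?R]
      table_rels_inverse[OF assms(2) group.subgroup_self[OF assms(2)], of Inr ?R]
    by blast
qed

lemma group_hnn:
  assumes "group G"
  shows "group (hnn G C \<phi>)"
  unfolding hnn_def
proof (rule group_presented)
  let ?R = "hnn_rels G C \<phi>"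
  have "word_eq ?R [StableInv, Stable] []" "word_eq ?R [Stable, StableInv] []"
    by (auto intro!: word_eq_base simp: hnn_rels_def)
  moreover have "table_rels G (carrier G) Base \<subseteq> ?R" by (auto simp: hnn_rels_def)
  moreover fix l assume "l \<in> Base ` carrier G \<union> {Stable, StableInv}"
  ultimately show "\<exists>l'\<in>Base ` carrier G \<union> {Stable, StableInv}. word_eq ?R [l', l] []"
    using table_rels_inverse[OF assms group.subgroup_self[OF assms], of Base ?R] by auto
qed

lemma amalg_inl_hom: "amalg_inl G1 G2 C \<delta>1 \<delta>2 \<in> hom G1 (amalg G1 G2 C \<delta>1 \<delta>2)"
  by (rule homI)
    (auto simp: amalg_inl_def amalg_def presented_carrier presented_mult word_class_eq_iff
      amalg_rels_def table_rels_def intro!: word_eq.sym[OF word_eq_base])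

lemma amalg_inr_hom: "amalg_inr G1 G2 C \<delta>1 \<delta>2 \<in> hom G2 (amalg G1 G2 C \<delta>1 \<delta>2)"
  by (rule homI)
    (auto simp: amalg_inr_def amalg_def presented_carrier presented_mult word_class_eq_iff
      amalg_rels_def table_rels_def intro!: word_eq.sym[OF word_eq_base])

lemma amalg_glue:
  "c \<in> carrier C \<Longrightarrow> amalg_inl G1 G2 C \<delta>1 \<delta>2 (\<delta>1 c) = amalg_inr G1 G2 C \<delta>1 \<delta>2 (\<delta>2 c)"
  by (auto simp: amalg_inl_def amalg_inr_def word_class_eq_iff amalg_rels_def
      intro!: word_eq_base)

lemma hnn_base_hom: "hnn_base G C \<phi> \<in> hom G (hnn G C \<phi>)"
  by (rule homI)
    (auto simp: hnn_base_def hnn_def presented_carrier presented_mult word_class_eq_iff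
      hnn_rels_def table_rels_def intro!: word_eq.sym[OF word_eq_base])

lemma hnn_stable_closed: "hnn_stable G C \<phi> \<in> carrier (hnn G C \<phi>)"
  by (auto simp: hnn_stable_def hnn_def presented_carrier)

lemma hnn_stable_conj:
  assumes "group G" "C \<subseteq> carrier G" "c \<in> C"
  shows "hnn_stable G C \<phi> \<otimes>\<^bsub>hnn G C \<phi>\<^esub> hnn_base G C \<phi> c \<otimes>\<^bsub>hnn G C \<phi>\<^esub> inv\<^bsub>hnn G C \<phi>\<^esub> hnn_stable G C \<phi>
         = hnn_base G C \<phi> (\<phi> c)"
proof -
  interpret H: group "hnn G C \<phi>" by (rule group_hnn) fact
  let ?R = "hnn_rels G C \<phi>"
  have "word_class ?R [Stable] \<otimes>\<^bsub>hnn G C \<phi>\<^esub> word_class ?R [StableInv] = \<one>\<^bsub>hnn G C \<phi>\<^esub>"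
    unfolding hnn_def
    by (auto simp: presented_mult presented_one word_class_eq_iff hnn_rels_def
        intro!: word_eq_base)
  moreover have "word_class ?R [StableInv] \<in> carrier (hnn G C \<phi>)"
    by (auto simp: hnn_def presented_carrier)
  ultimately have "inv\<^bsub>hnn G C \<phi>\<^esub> hnn_stable G C \<phi> = word_class ?R [StableInv]"
    using hnn_stable_closed[of G C \<phi>]
    by (metis H.inv_equality H.inv_comm hnn_stable_def)
  then show ?thesis
    using assms(3)
    by (auto simp: hnn_def hnn_stable_def hnn_base_def presented_mult word_class_eq_iff
        hnn_rels_def intro!: word_eq_base)
qed

lemma word_value_closed:
  assumes "group_pair G \<H>" "S \<subseteq> carrier G" "w \<in> lists (rel_alphabet S \<H>)"
  shows "word_value G w \<in> carrier G"
proof -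
  interpret group G using assms(1) by (simp add: group_pair_def)
  have "letter_value G l \<in> carrier G" if "l \<in> rel_alphabet S \<H>" for l
    using that assms(1,2) subgroup.mem_carrier
    by (fastforce simp: rel_alphabet_def group_pair_def)
  then show ?thesis using assms(3) by (induction w) auto
qed

lemma word_value_append:
  assumes "group_pair G \<H>" "S \<subseteq> carrier G"
    and "u \<in> lists (rel_alphabet S \<H>)" "v \<in> lists (rel_alphabet S \<H>)"
  shows "word_value G (u @ v) = word_value G u \<otimes>\<^bsub>G\<^esub> word_value G v"
proof -
  interpret group G using assms(1) by (simp add: group_pair_def)
  show ?thesis
    using assms(3)
  proof (induction u)
    case Nil
    then show ?case using word_value_closed[OF assms(1,2,4)] by simp
  next
    case (Cons l u)
    then show ?case
      using word_value_closed[OF assms(1,2,4)] word_value_closed[OF assms(1,2), of u]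
        word_value_closed[OF assms(1,2), of "[l]"] assms(1,2) subgroup.mem_carrier
      by (fastforce simp: m_assoc rel_alphabet_def group_pair_def)
  qed
qed

lemma rel_free_rels_value:
  assumes "group_pair G \<H>" "S \<subseteq> carrier G" "(u, v) \<in> rel_free_rels G S \<H>"
  shows "u \<in> lists (rel_alphabet S \<H>)" "v \<in> lists (rel_alphabet S \<H>)"
    "word_value G u = word_value G v"
proof -
  interpret group G using assms(1) by (simp add: group_pair_def)
  have sub: "subgroup H G" if "H \<in> \<H>" for H using that assms(1) by (simp add: group_pair_def)
  have *: "u \<in> lists (rel_alphabet S \<H>) \<and> v \<in> lists (rel_alphabet S \<H>) \<and>
        word_value G u = word_value G v"
    using assms(2,3) subgroup.mem_carrier[OF sub] subgroup.one_closed[OF sub]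
      subgroup.m_closed[OF sub]
    unfolding rel_free_rels_def table_rels_def
    by (auto simp: subset_iff rel_alphabet_iff)
  then show "u \<in> lists (rel_alphabet S \<H>)" "v \<in> lists (rel_alphabet S \<H>)"
    "word_value G u = word_value G v" by auto
qed

lemma word_eq_value:
  assumes "group_pair G \<H>" "S \<subseteq> carrier G" "word_eq (rel_free_rels G S \<H>) u v"
  shows "(u \<in> lists (rel_alphabet S \<H>) \<longleftrightarrow> v \<in> lists (rel_alphabet S \<H>)) \<and>
         (u \<in> lists (rel_alphabet S \<H>) \<longrightarrow> word_value G u = word_value G v)"
  using assms(3)
proof (induction rule: word_eq.induct)
  case (rel u v x y)
  note uv = rel_free_rels_value[OF assms(1,2) rel]
  let ?L = "lists (rel_alphabet S \<H>)"
  have "word_value G (x @ u @ y) = word_value G (x @ v @ y)" if "x \<in> ?L" "y \<in> ?L"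
  proof -
    have "u @ y \<in> ?L" "v @ y \<in> ?L" using that uv by auto
    then show ?thesis using that uv by (simp only: word_value_append[OF assms(1,2)])
  qed
  then show ?case using uv by auto
qed auto

lemma rel_nat_map_elem:
  assumes "group_pair G \<H>" "S \<subseteq> carrier G" "w \<in> lists (rel_alphabet S \<H>)"
  shows "rel_nat_map G (rel_elem G S \<H> w) = word_value G w"
proof -
  have "(SOME v. v \<in> rel_elem G S \<H> w) \<in> rel_elem G S \<H> w"
    by (rule someI[of _ w]) (simp add: rel_elem_def word_class_def word_eq.refl)
  then show ?thesis
    using word_eq_value[OF assms(1,2)] assms(3)
    by (auto simp: rel_nat_map_def rel_elem_def word_class_def)
qed

lemma rel_nat_map_hom:
  assumes "group_pair G \<H>" "S \<subseteq> carrier G"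
  shows "rel_nat_map G \<in> hom (rel_free G S \<H>) G"
proof (rule homI)
  note nat_map = rel_nat_map_elem[OF assms, unfolded rel_elem_def]
  fix x assume "x \<in> carrier (rel_free G S \<H>)"
  then obtain u where u: "u \<in> lists (rel_alphabet S \<H>)" "x = word_class (rel_free_rels G S \<H>) u"
    by (auto simp: rel_free_def presented_carrier)
  then show "rel_nat_map G x \<in> carrier G" using nat_map word_value_closed[OF assms] by simp
  fix y assume "y \<in> carrier (rel_free G S \<H>)"
  then obtain v where v: "v \<in> lists (rel_alphabet S \<H>)" "y = word_class (rel_free_rels G S \<H>) v"
    by (auto simp: rel_free_def presented_carrier)
  have "u @ v \<in> lists (rel_alphabet S \<H>)" using u v by auto
  then show "rel_nat_map G (x \<otimes>\<^bsub>rel_free G S \<H>\<^esub> y) = rel_nat_map G x \<otimes>\<^bsub>G\<^esub> rel_nat_map G y"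
    using nat_map u v word_value_append[OF assms]
    by (simp add: rel_free_def presented_mult del: append_in_lists_conv)
qed

lemma rel_dehn_function_0:
  assumes "rel_dehn_function G \<H> \<Delta>"
  shows "\<Delta> 0 = 0"
proof -
  obtain S R where d: "rel_dehn_of G \<H> S R \<Delta>"
    using assms by (auto simp: rel_dehn_function_def)
  have "rel_isoperimetric G \<H> S R (\<Delta>(0 := 0))"
    using d unfolding rel_dehn_of_def rel_isoperimetric_def Let_def
    by (auto simp: conj_prod_def rel_elem_def rel_free_def presented_one)
  then have "\<Delta> \<le> \<Delta>(0 := 0)" using d by (simp add: rel_dehn_of_def)
  from le_funD[OF this, of 0] show ?thesis by simp
qed

end

(*
  The amalgamated product and both HNN-extensions are fundamental groups of a graph of groups: a
  central vertex Q, which is <K1, K2>, <K^t, L> or <K, s^-1 t>, is joined to the base groups A v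
  along edge groups K j. Each tau j K j tau j^-1 lies in Q, where tau j is 1 for a root edge of every
  base group and t for the edge K of the second extension. Normal forms follow from an action of the
  group on the set of reduced forms.

  Areas are counted on words, a step that inserts or deletes a relator costing 1 and free equality
  costing 0. For the upper bound, a word is read from left to right and kept in the form of a stack
  of words over the alphabets of base groups, separated by elements of Q. Whenever the top word has
  its value in the edge group, it is replaced by a single letter of that edge group, at the cost of its
  area in the base group. The lengths paid for add up to at most 2n, so superadditivity bounds the
  cost, and by normal forms the stack of a word representing 1 ends up empty. For the lower bound, a
  transducer turns words of the whole group into words of one base group such that a relator becomes
  a consequence of at most one relator; hence the area in the base group is at most the area of the
  same word in the whole group.

  In an amalgamated product, a generator or peripheral subgroup of the second base group may coincide
  with one of the first. It is then contained in K2 and can be dropped beforehand.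
*)

theory Submission
  imports Defs
begin

section \<open>Words and areas\<close>

text \<open>The upper bound rests on a potential: each letter read raises the lengths already paid
  for plus the weight of the stack by at most 2. For the lower bound the obstacle is that
  \<open>P\<close> need not retract onto a base group, so a derivation in \<open>P\<close> cannot
  simply be mapped there. Instead \<open>P\<close> acts on states together with a cocycle of words.
  The chosen base group copies its letters at \<open>None\<close>; everything else acts on cosets of
  edge groups. The two descriptions must agree on edge groups, so \<open>None\<close> is identified
  with a trivial coset, and infinitely many copies of the cosets make this identification bijective,
  as in Hilbert's hotel. The relators of the whole group are only the rewritten relators of the base
  groups: letters of edge groups are expressed in \<open>Q\<close> by substitution, not by extra
  relators, so the areas compare without further terms. The normal forms are made of elements of
  \<open>P\<close> itself, so the action on them cannot show that the base groups embed. That is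
  proved separately, by letting the base groups act on free \<open>C\<close>-sets.\<close>

inductive der :: "('l list \<times> 'l list) set \<Rightarrow> 'l list set \<Rightarrow> nat \<Rightarrow> 'l list \<Rightarrow> 'l list \<Rightarrow> bool"
  for E :: "('l list \<times> 'l list) set" and T :: "'l list set" where
  free: "word_eq E u v \<Longrightarrow> der E T k u v"
| rel: "r \<in> T \<Longrightarrow> der E T (Suc k) (x @ r @ y) (x @ y)"
| sym: "der E T k u v \<Longrightarrow> der E T k v u"
| trans: "der E T j u v \<Longrightarrow> der E T k v w \<Longrightarrow> der E T (j + k) u w"

lemma der_refl: "der E T k u u"
  by (rule der.free[OF word_eq.refl])

text \<open>The index of \<open>der\<close> only bounds the number of relator steps: a free equality
  may be charged any amount, so slack is added by an idle step.\<close>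

lemma der_mono:
  assumes "der E T k u v" "k \<le> l"
  shows "der E T l u v"
  using der.trans[OF assms(1) der_refl[of E T "l - k" v]] assms(2) by simp

lemma der_context: "der E T k u v \<Longrightarrow> der E T k (x @ u @ y) (x @ v @ y)"
proof (induction rule: der.induct)
  case (free u v k)
  then show ?case by (intro der.free word_eq_context)
next
  case (rel r k x' y')
  then show ?case using der.rel[of r T E k "x @ x'" "y' @ y"] by simp
qed (blast intro: der.intros)+

lemma der_append:
  assumes "der E T j u u'" "der E T k v v'"
  shows "der E T (j + k) (u @ v) (u' @ v')"
  using der.trans[of E T j "u @ v" "u' @ v" k "u' @ v'"]
    der_context[OF assms(1), of "[]" v] der_context[OF assms(2), of u' "[]"]
  by simp

lemma der_free_left: "word_eq E u v \<Longrightarrow> der E T k v w \<Longrightarrow> der E T k u w"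
  using der.trans[OF der.free[of E u v T 0]] by fastforce

lemma der_free_right: "der E T k u v \<Longrightarrow> word_eq E v w \<Longrightarrow> der E T k u w"
  using der.trans[OF _ der.free[of E v w T 0]] by fastforce

lemma word_eq_map:
  assumes "\<And>u v. (u, v) \<in> E \<Longrightarrow> word_eq E' (concat (map \<sigma> u)) (concat (map \<sigma> v))"
    and "word_eq E u v"
  shows "word_eq E' (concat (map \<sigma> u)) (concat (map \<sigma> v))"
  using assms(2)
proof (induction rule: word_eq.induct)
  case (rel u v x y)
  then show ?case using word_eq_context[OF assms(1)[OF rel]] by simp
qed (auto intro: word_eq.intros)

lemma der_map:
  assumes E: "\<And>u v. (u, v) \<in> E \<Longrightarrow> word_eq E' (concat (map \<sigma> u)) (concat (map \<sigma> v))"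
    and T: "\<And>r. r \<in> T \<Longrightarrow> der E' T' C (concat (map \<sigma> r)) []"
    and "der E T k u v"
  shows "der E' T' (C * k) (concat (map \<sigma> u)) (concat (map \<sigma> v))"
  using assms(3)
proof (induction rule: der.induct)
  case (free u v k)
  then show ?case by (intro der.free word_eq_map[OF E])
next
  case (rel r k x y)
  then show ?case
    using der_mono[OF der_context[OF T[OF rel], of "concat (map \<sigma> x)" "concat (map \<sigma> y)"], of "C * Suc k"]
    by simp
next
  case (sym k u v)
  show ?case by (rule der.sym) (rule sym.IH)
next
  case (trans j u v k w)
  then show ?case using der.trans[OF trans.IH] by (simp add: algebra_simps)
qed

text \<open>A relator can be inserted as well as deleted, so its inverse costs one relator too.\<close>

lemma der_inverse:
  assumes "der E T k u []" "word_eq E (v @ u) []"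
  shows "der E T k v []"
proof -
  have "der E T k (v @ u) v" using der_context[OF assms(1), of v "[]"] by simp
  then show ?thesis using der.sym der_free_right[OF _ assms(2)] by blast
qed

section \<open>Products of conjugates compared with derivations of words\<close>

context
  fixes F :: "'a monoid"
  assumes F: "group F"
begin

interpretation group F by (rule F)

lemma conj_prod_closed:
  "set ps \<subseteq> carrier F \<times> carrier F \<Longrightarrow> conj_prod F ps \<in> carrier F"
  by (induction ps) (auto simp: conj_prod_def)

lemma conj_prod_append:
  "set ps \<subseteq> carrier F \<times> carrier F \<Longrightarrow> set qs \<subseteq> carrier F \<times> carrier F \<Longrightarrow>
    conj_prod F (ps @ qs) = conj_prod F ps \<otimes>\<^bsub>F\<^esub> conj_prod F qs"
proof (induction ps)
  case Nil
  then show ?case using conj_prod_closed[of qs] by (simp add: conj_prod_def)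
next
  case (Cons p ps)
  then show ?case
    using conj_prod_closed[of qs] conj_prod_closed[of ps]
    by (cases p) (auto simp: conj_prod_def m_assoc)
qed

text \<open>Inverting f^-1 r f keeps the conjugator and inverts the relator, so only the order of
  the factors is reversed.\<close>

lemma conj_prod_inverse:
  "set ps \<subseteq> carrier F \<times> carrier F \<Longrightarrow>
    conj_prod F (rev (map (\<lambda>(f, r). (f, inv\<^bsub>F\<^esub> r)) ps)) = inv\<^bsub>F\<^esub> (conj_prod F ps)"
proof (induction ps)
  case Nil
  then show ?case by (simp add: conj_prod_def)
next
  case (Cons p ps)
  obtain f r where p: "p = (f, r)" "f \<in> carrier F" "r \<in> carrier F" using Cons.prems by (cases p) auto
  have "set (rev (map (\<lambda>(f, r). (f, inv\<^bsub>F\<^esub> r)) ps)) \<subseteq> carrier F \<times> carrier F"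
    using Cons.prems by auto
  then have "conj_prod F (rev (map (\<lambda>(f, r). (f, inv\<^bsub>F\<^esub> r)) (p # ps)))
      = inv\<^bsub>F\<^esub> (conj_prod F ps) \<otimes>\<^bsub>F\<^esub> conj_prod F [(f, inv\<^bsub>F\<^esub> r)]"
    using p Cons.IH Cons.prems
      conj_prod_append[of "rev (map (\<lambda>(f, r). (f, inv\<^bsub>F\<^esub> r)) ps)" "[(f, inv\<^bsub>F\<^esub> r)]"] by simp
  also have "\<dots> = inv\<^bsub>F\<^esub> (conj_prod F (p # ps))"
    using p Cons.prems conj_prod_closed[of ps]
    by (simp add: conj_prod_def inv_mult_group m_assoc)
  finally show ?case .
qed

end

locale rel_pair =
  fixes G :: "'a monoid" and \<H> :: "'a set set" and S :: "'a set"
  assumes gp: "group_pair G \<H>" and SG: "S \<subseteq> carrier G"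
begin

abbreviation "E \<equiv> rel_free_rels G S \<H>"
abbreviation "F \<equiv> rel_free G S \<H>"
abbreviation "L \<equiv> lists (rel_alphabet S \<H>)"
abbreviation "cl \<equiv> word_class E"
abbreviation "signed T \<equiv> cl ` T \<union> (\<lambda>r. inv\<^bsub>F\<^esub> r) ` cl ` T"

sublocale G: group G
  using gp by (simp add: group_pair_def)

sublocale F: group F
  by (rule group_rel_free[OF gp])

lemma word_eq_alphabet:
  "word_eq E u v \<Longrightarrow> u \<in> L \<longleftrightarrow> v \<in> L"
  using word_eq_value[OF gp SG] by blast

lemma rel_free_elem: "carrier F = cl ` L"
  by (simp add: rel_free_def presented_carrier)

lemma rel_free_mult:
  "cl u \<otimes>\<^bsub>F\<^esub> cl v = cl (u @ v)"
  by (simp add: rel_free_def presented_mult)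

lemma rel_free_one: "\<one>\<^bsub>F\<^esub> = cl []"
  by (simp add: rel_free_def presented_one)

lemma rel_free_inv:
  assumes "u \<in> L" "v \<in> L" "inv\<^bsub>F\<^esub> cl u = cl v"
  shows "word_eq E (u @ v) []" "word_eq E (v @ u) []"
proof -
  have "cl u \<in> carrier F"
    using assms(1) by (simp add: rel_free_elem)
  then show "word_eq E (u @ v) []" "word_eq E (v @ u) []"
    using F.r_inv[of "cl u"] F.l_inv[of "cl u"] assms(3)
    by (auto simp: rel_free_mult rel_free_one word_class_eq_iff)
qed

lemma rel_free_inv_word:
  assumes "u \<in> L"
  obtains v where "v \<in> L" "inv\<^bsub>F\<^esub> cl u = cl v"
proof -
  have "inv\<^bsub>F\<^esub> cl u \<in> carrier F"
    using assms by (intro F.inv_closed) (simp add: rel_free_elem)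
  then show ?thesis using that by (auto simp: rel_free_elem)
qed

text \<open>A factor f^-1 r f costs one step: the relator is deleted in the middle and the
  conjugators cancel freely. A factor with an inverse relator costs no more, by
  \<open>der_inverse\<close>.\<close>

lemma conj_prod_der:
  assumes T: "T \<subseteq> L" and ps: "set ps \<subseteq> carrier F \<times> signed T"
  shows "\<exists>w. conj_prod F ps = cl w \<and> der E T (length ps) w []"
  using ps
proof (induction ps)
  case Nil
  then show ?case by (auto simp: conj_prod_def rel_free_one intro!: exI[of _ "[]"] der_refl)
next
  case (Cons p ps)
  obtain f r where p: "p = (f, r)" by (cases p)
  obtain x where x: "x \<in> L" "f = cl x" using Cons.prems p by (auto simp: rel_free_elem)
  obtain x' where x': "x' \<in> L" "inv\<^bsub>F\<^esub> f = cl x'"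
    using rel_free_inv_word[OF x(1)] x(2) by metis
  have xx: "word_eq E (x' @ x) []" using rel_free_inv[OF x(1) x'(1)] x x' by simp
  have "\<exists>t. r = cl t \<and> der E T 1 t []"
  proof -
    have "r \<in> cl ` T \<or> r \<in> (\<lambda>r. inv\<^bsub>F\<^esub> r) ` cl ` T"
      using Cons.prems p by auto
    then obtain t where t: "t \<in> T" "r = cl t \<or> r = inv\<^bsub>F\<^esub> cl t" by auto
    have d: "der E T 1 t []" using der.rel[OF t(1), of E 0 "[]" "[]"] by simp
    from t(2) show ?thesis
    proof
      assume "r = inv\<^bsub>F\<^esub> cl t"
      moreover obtain t' where "t' \<in> L" "inv\<^bsub>F\<^esub> cl t = cl t'"
        using rel_free_inv_word t(1) T by blast
      moreover from this have "word_eq E (t' @ t) []" using rel_free_inv t(1) T by blast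
      ultimately show ?thesis using der_inverse[OF d] by auto
    qed (use d in auto)
  qed
  then obtain t where t: "r = cl t" "der E T 1 t []" by blast
  obtain w where w: "conj_prod F ps = cl w" "der E T (length ps) w []"
    using Cons by auto
  have "conj_prod F (p # ps) = cl (x' @ t @ x @ w)"
    using w(1) x' t(1) x(2) by (simp add: conj_prod_def p rel_free_mult)
  moreover have "der E T 1 (x' @ t @ x) []"
    using der_free_right[OF der_context[OF t(2), of x' x]] xx by simp
  then have "der E T (1 + length ps) ((x' @ t @ x) @ w) ([] @ [])"
    by (rule der_append) (rule w(2))
  ultimately show ?case by auto
qed

lemma der_alphabet:
  assumes "T \<subseteq> L" "der E T k u v"
  shows "u \<in> L \<longleftrightarrow> v \<in> L"
  using assms(2) by (induction rule: der.induct) (use assms(1) word_eq_alphabet in auto)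

lemma der_value:
  assumes "T \<subseteq> {w \<in> L. word_value G w = \<one>\<^bsub>G\<^esub>}"
    and "der E T k u v" "u \<in> L"
  shows "word_value G u = word_value G v"
proof -
  have T: "T \<subseteq> L" using assms(1) by blast
  have "u \<in> L \<longrightarrow> word_value G u = word_value G v"
    using assms(2)
  proof (induction rule: der.induct)
    case (free u v k)
    then show ?case using word_eq_value[OF gp SG] by blast
  next
    case (rel r k x y)
    have "word_value G (x @ r @ y) = word_value G (x @ y)"
      if xy: "x \<in> L" "y \<in> L"
    proof -
      have r: "r \<in> L" "word_value G r = \<one>\<^bsub>G\<^esub>" using assms(1) rel by auto
      then have "word_value G (r @ y) = word_value G y"
        using word_value_append[OF gp SG r(1) xy(2)] word_value_closed[OF gp SG xy(2)] by simp
      then show ?thesis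
        using word_value_append[OF gp SG xy(1)] xy r(1) by simp
    qed
    then show ?case by auto
  qed (use der_alphabet[OF T] in auto)
  then show ?thesis using assms(3) by blast
qed

text \<open>The induction needs a general target word. A derivation from \<open>u\<close> to
  \<open>v\<close> is recorded as a left factor of \<open>cl v\<close>; such factors multiply under
  transitivity and are inverted under symmetry.\<close>

lemma der_conj_prod_aux:
  assumes T: "T \<subseteq> L" and "der E T k u v"
  shows "u \<in> L \<longrightarrow>
    (\<exists>ps. length ps \<le> k \<and> set ps \<subseteq> carrier F \<times> signed T \<and>
      cl u = conj_prod F ps \<otimes>\<^bsub>F\<^esub> cl v)"
  (is "_ \<longrightarrow> ?P k u v")
  using assms(2)
proof (induction rule: der.induct)
  let ?R = "cl ` T"
  note mult = rel_free_mult and one = rel_free_one and elem = rel_free_elem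
  have RF: "?R \<subseteq> carrier F" using T by (auto simp: elem)
  have sub: "A \<times> signed T \<subseteq> A \<times> carrier F" for A :: "'a rel_letter list set set"
    using RF by blast
  {
    case (free u v k)
    then show ?case
      by (intro impI exI[of _ "[]"]) (simp add: conj_prod_def one mult word_class_eq_iff)
  next
    case (rel r k x y)
    show ?case
    proof
      assume a: "x @ r @ y \<in> L"
      then have x: "x \<in> L" and y: "y \<in> L" by auto
      obtain x' where x': "x' \<in> L" "inv\<^bsub>F\<^esub> cl x = cl x'"
        using rel_free_inv_word[OF x] by blast
      have inv: "inv\<^bsub>F\<^esub> cl x' = cl x"
        using x'(2) x by (metis F.inv_inv elem imageI)
      have "word_eq E (x' @ x) []" using rel_free_inv[OF x x'(1) x'(2)] by blast
      \<comment> \<open>In the free product x r y = (x r x^-1) x y, so in the convention f^-1 r f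
        the conjugator is the inverse \<open>x'\<close> of \<open>x\<close>.\<close>
      then have "word_eq E ((x @ r) @ [] @ y) ((x @ r) @ (x' @ x) @ y)"
        by (rule word_eq.sym[OF word_eq_context])
      then have "cl (x @ r @ y) = conj_prod F [(cl x', cl r)]
          \<otimes>\<^bsub>F\<^esub> cl (x @ y)"
        using inv by (simp add: conj_prod_def one mult word_class_eq_iff)
      then show "?P (Suc k) (x @ r @ y) (x @ y)"
        using x' rel by (intro exI[of _ "[(cl x', cl r)]"]) (auto simp: elem)
    qed
  next
    case (sym k u v)
    show ?case
    proof
      assume v: "v \<in> L"
      then have u: "u \<in> L" using der_alphabet[OF T sym.hyps] by simp
      then obtain ps where ps: "length ps \<le> k"
        "set ps \<subseteq> carrier F \<times> signed T"
        "cl u = conj_prod F ps \<otimes>\<^bsub>F\<^esub> cl v"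
        using sym.IH by blast
      let ?qs = "rev (map (\<lambda>(f, r). (f, inv\<^bsub>F\<^esub> r)) ps)"
      note ps' = subset_trans[OF ps(2) sub]
      have cv: "cl v \<in> carrier F" using v by (simp add: elem)
      have "conj_prod F ?qs \<otimes>\<^bsub>F\<^esub> cl u = cl v"
        unfolding ps(3) conj_prod_inverse[OF F.is_group ps']
        using conj_prod_closed[OF F.is_group ps'] cv by (simp only: F.inv_closed F.l_inv F.l_one F.m_assoc[symmetric])
      moreover have "set ?qs \<subseteq> carrier F \<times> signed T"
      proof -
        have "inv\<^bsub>F\<^esub> r \<in> signed T"
          if r: "r \<in> signed T" for r
        proof (cases "r \<in> ?R")
          case False
          then obtain r' where r': "r' \<in> ?R" "r = inv\<^bsub>F\<^esub> r'" using r by blast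
          then have "inv\<^bsub>F\<^esub> r = r'" using subsetD[OF RF r'(1)] by simp
          then show ?thesis unfolding Un_iff using r'(1) by (intro disjI1) (rule ssubst)
        qed (rule UnI2[OF imageI])
        note inv_mem = this
        show ?thesis
        proof
          fix q assume "q \<in> set ?qs"
          then obtain f r where q: "(f, r) \<in> set ps" "q = (f, inv\<^bsub>F\<^esub> r)"
            by (auto simp only: set_rev set_map)
          show "q \<in> carrier F \<times> signed T"
            unfolding q(2) using subsetD[OF ps(2) q(1)] inv_mem unfolding mem_Sigma_iff by blast
        qed
      qed
      ultimately show "?P k v u" using ps(1) by (intro exI[of _ ?qs] conjI) simp_all
    qed
  next
    case (trans j u v k w)
    show ?case
    proof
      assume u: "u \<in> L"
      have v: "v \<in> L" using u der_alphabet[OF T trans.hyps(1)] by simp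
      have w: "w \<in> L" using v der_alphabet[OF T trans.hyps(2)] by simp
      obtain ps where ps: "length ps \<le> j" "set ps \<subseteq> carrier F \<times> signed T"
        "cl u = conj_prod F ps \<otimes>\<^bsub>F\<^esub> cl v" using trans.IH(1) u by blast
      obtain qs where qs: "length qs \<le> k" "set qs \<subseteq> carrier F \<times> signed T"
        "cl v = conj_prod F qs \<otimes>\<^bsub>F\<^esub> cl w" using trans.IH(2) v by blast
      note ps' = subset_trans[OF ps(2) sub] and qs' = subset_trans[OF qs(2) sub]
      have "cl w \<in> carrier F" using w by (simp add: elem)
      then have "cl u = conj_prod F (ps @ qs) \<otimes>\<^bsub>F\<^esub> cl w"
        using ps(3) qs(3) conj_prod_closed[OF F.is_group ps'] conj_prod_closed[OF F.is_group qs']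
          conj_prod_append[OF F.is_group ps' qs'] by (simp add: F.m_assoc)
      then show "?P (j + k) u w" using ps(1,2) qs(1,2) by (intro exI[of _ "ps @ qs"] conjI) simp_all
    qed
  }
qed

lemma der_conj_prod:
  assumes "T \<subseteq> L" "der E T k u []" "u \<in> L"
  shows "\<exists>ps. length ps \<le> k \<and> set ps \<subseteq> carrier F \<times> signed T \<and> cl u = conj_prod F ps"
proof -
  let ?R = "cl ` T"
  obtain ps where ps: "length ps \<le> k" "set ps \<subseteq> carrier F \<times> signed T"
    "cl u = conj_prod F ps \<otimes>\<^bsub>F\<^esub> cl []"
    using mp[OF der_conj_prod_aux[OF assms(1,2)] assms(3)] by (elim exE conjE)
  have "?R \<subseteq> carrier F" using assms(1) by (auto simp: rel_free_elem)
  then have "signed T \<subseteq> carrier F" by auto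
  then have "set ps \<subseteq> carrier F \<times> carrier F" using ps(2) by (meson Sigma_mono order_refl subset_trans)
  from conj_prod_closed[OF F.is_group this]
  have "cl u = conj_prod F ps"
    using ps(3) by (simp add: rel_free_one[symmetric])
  then show ?thesis using ps(1,2) by (intro exI[of _ ps] conjI)
qed

text \<open>Elements represented by words of finite area are closed under products, inverses and
  conjugation, so they form a normal subgroup containing the relators.\<close>

lemma der_normal_closure:
  assumes T: "T \<subseteq> L"
  shows "normal_closure F (cl ` T)
    \<subseteq> {cl w | w. w \<in> L \<and> (\<exists>k. der E T k w [])}"
proof -
  let ?N = "{cl w | w. w \<in> L \<and> (\<exists>k. der E T k w [])}"
  note mult = rel_free_mult and one = rel_free_one and elem = rel_free_elem
  have "subgroup ?N F"
  proof (rule F.subgroupI)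
    show "?N \<subseteq> carrier F" by (auto simp: elem)
    show "?N \<noteq> {}" using der_refl[of E T 0 "[]"] by force
  next
    fix a assume "a \<in> ?N"
    then obtain w k where w: "a = cl w" "w \<in> L" "der E T k w []" by blast
    obtain v where v: "v \<in> L" "inv\<^bsub>F\<^esub> cl w = cl v"
      using rel_free_inv_word[OF w(2)] by blast
    have "der E T k v []" using der_inverse[OF w(3)] rel_free_inv[OF w(2) v] by blast
    then show "inv\<^bsub>F\<^esub> a \<in> ?N" using w(1) v by auto
  next
    fix a b assume "a \<in> ?N" "b \<in> ?N"
    then obtain u j v k where u: "a = cl u" "u \<in> L" "der E T j u []"
      and v: "b = cl v" "v \<in> L" "der E T k v []" by blast
    have "der E T (j + k) (u @ v) []" using der_append[OF u(3) v(3)] by simp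
    moreover have "u @ v \<in> L" using u v by simp
    ultimately show "a \<otimes>\<^bsub>F\<^esub> b \<in> ?N" unfolding u(1) v(1) mult by blast
  qed
  moreover have "x \<otimes>\<^bsub>F\<^esub> h \<otimes>\<^bsub>F\<^esub> inv\<^bsub>F\<^esub> x \<in> ?N" if x: "x \<in> carrier F" and h: "h \<in> ?N" for x h
  proof -
    obtain w k where w: "h = cl w" "w \<in> L" "der E T k w []" using h by blast
    obtain u where u: "u \<in> L" "x = cl u" using x by (auto simp: elem)
    obtain v where v: "v \<in> L" "inv\<^bsub>F\<^esub> cl u = cl v"
      using rel_free_inv_word[OF u(1)] by blast
    have "der E T k (u @ w @ v) (u @ [] @ v)" using w(3) by (rule der_context)
    then have "der E T k (u @ w @ v) []"
      using der_free_right rel_free_inv[OF u(1) v] by fastforce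
    moreover have "u @ w @ v \<in> L" using u v w by simp
    moreover have "x \<otimes>\<^bsub>F\<^esub> h \<otimes>\<^bsub>F\<^esub> inv\<^bsub>F\<^esub> x = cl (u @ w @ v)"
      using v(2) u(2) w(1) by (simp add: mult)
    ultimately show ?thesis by blast
  qed
  ultimately have "?N \<lhd> F" by (simp add: F.normal_inv_iff)
  moreover have "cl ` T \<subseteq> ?N"
  proof
    fix a assume "a \<in> cl ` T"
    then obtain r where r: "r \<in> T" "a = cl r" by blast
    have "der E T 1 r []" using der.rel[OF r(1), of E 0 "[]" "[]"] by simp
    then show "a \<in> ?N" using r T by blast
  qed
  ultimately show ?thesis unfolding normal_closure_def by blast
qed

text \<open>Isoperimetric functions test only words without the trivial peripheral letters, whereas
  \<open>area_bound\<close> ranges over the full alphabet. Dropping these letters is free and does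
  not lengthen a word.\<close>

lemma word_eq_drop_trivial:
  "w \<in> L \<Longrightarrow> word_eq E w (filter (\<lambda>l. l \<notin> (\<lambda>H. Per H \<one>\<^bsub>G\<^esub>) ` \<H>) w)"
proof (induction w)
  case (Cons l w)
  have "word_eq E [l] []" if "l \<in> (\<lambda>H. Per H \<one>\<^bsub>G\<^esub>) ` \<H>"
    by (rule word_eq_base) (use that in \<open>auto simp: rel_free_rels_def table_rels_def\<close>)
  moreover have "word_eq E w (filter (\<lambda>l. l \<notin> (\<lambda>H. Per H \<one>\<^bsub>G\<^esub>) ` \<H>) w)"
    using Cons by simp
  ultimately show ?case
    using word_eq_append[of _ "[l]" "[]" w] word_eq_append[OF word_eq.refl[of _ "[l]"], of _ w] by auto
qed (simp add: word_eq.refl)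

end

text \<open>Relators are words instead of elements of the free product. The equality of normal
  closure and kernel is split into two halves: relators have value \<one>, and every word of value
  \<one> has some finite area.\<close>

definition word_presentation ::
    "'a monoid \<Rightarrow> 'a set set \<Rightarrow> 'a set \<Rightarrow> 'a rel_letter list set \<Rightarrow> bool" where
  "word_presentation G \<H> S T \<longleftrightarrow>
     group_pair G \<H> \<and> S \<subseteq> carrier G \<and> finite S \<and> finite T \<and>
     T \<subseteq> {w \<in> lists (rel_alphabet S \<H>). word_value G w = \<one>\<^bsub>G\<^esub>} \<and>
     carrier G \<subseteq> word_value G ` lists (rel_alphabet S \<H>) \<and>
     (\<forall>w\<in>lists (rel_alphabet S \<H>). word_value G w = \<one>\<^bsub>G\<^esub> \<longrightarrow>
        (\<exists>k. der (rel_free_rels G S \<H>) T k w []))"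

text \<open>Words with trivial peripheral letters are tested as well, so that substitutions are free
  to produce such letters.\<close>

definition area_bound ::
    "'a monoid \<Rightarrow> 'a set set \<Rightarrow> 'a set \<Rightarrow> 'a rel_letter list set \<Rightarrow> (nat \<Rightarrow> nat) \<Rightarrow> bool" where
  "area_bound G \<H> S T f \<longleftrightarrow>
     (\<forall>w\<in>lists (rel_alphabet S \<H>). word_value G w = \<one>\<^bsub>G\<^esub> \<longrightarrow>
        (\<forall>n\<ge>length w. der (rel_free_rels G S \<H>) T (f n) w []))"

text \<open>One word is chosen for each relator. Both directions between isoperimetric functions and
  area bounds are used: one yields the bound by \<open>\<Delta>\<close>, the other its
  minimality.\<close>

lemma rel_dehn_function_words:
  assumes "rel_dehn_function G \<H> \<Delta>"
  obtains S T where "word_presentation G \<H> S T" "area_bound G \<H> S T \<Delta>"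
    "\<And>f. area_bound G \<H> S T f \<Longrightarrow> \<Delta> \<le> f"
proof -
  obtain S R where gp: "group_pair G \<H>" and pres: "finite_rel_presentation G \<H> S R"
    and dehn: "rel_dehn_of G \<H> S R \<Delta>"
    using assms unfolding rel_dehn_function_def by blast
  let ?F = "rel_free G S \<H>" and ?E = "rel_free_rels G S \<H>" and ?L = "lists (rel_alphabet S \<H>)"
  have SG: "S \<subseteq> carrier G" and RF: "R \<subseteq> carrier ?F" and fin: "finite S" "finite R"
    and surj: "rel_nat_map G ` carrier ?F = carrier G"
    and ker: "normal_closure ?F R = kernel ?F G (rel_nat_map G)"
    using pres by (auto simp: finite_rel_presentation_def rel_presentation_def)
  interpret X: rel_pair G \<H> S by unfold_locales (fact gp SG)+
  note elem = X.rel_free_elem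
  obtain T where T: "T \<subseteq> ?L" "finite T" "word_class ?E ` T = R"
    using finite_subset_image[OF fin(2)] RF elem by metis
  have val: "rel_nat_map G (word_class ?E w) = word_value G w" if "w \<in> ?L" for w
    using rel_nat_map_elem[OF gp SG that] by (simp add: rel_elem_def)
  have "R \<subseteq> normal_closure ?F R" by (auto simp: normal_closure_def)
  then have "word_value G r = \<one>\<^bsub>G\<^esub>" if "r \<in> T" for r
    using that T val unfolding ker kernel_def by force
  then have Tval: "T \<subseteq> {w \<in> ?L. word_value G w = \<one>\<^bsub>G\<^esub>}" using T by blast
  have "\<exists>k. der ?E T k w []" if w: "w \<in> ?L" "word_value G w = \<one>\<^bsub>G\<^esub>" for w
  proof -
    have "word_class ?E w \<in> normal_closure ?F R"
      unfolding ker kernel_def using w val by (auto simp: elem)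
    then obtain w' k where "word_class ?E w = word_class ?E w'" "der ?E T k w' []"
      using X.der_normal_closure[OF T(1)] T(3) by auto
    then show ?thesis by (auto simp: word_class_eq_iff intro: der_free_left)
  qed
  moreover have "carrier G \<subseteq> word_value G ` ?L"
    unfolding surj[symmetric] elem using val by auto
  ultimately have wp: "word_presentation G \<H> S T"
    unfolding word_presentation_def using gp SG fin T Tval by blast
  have to_rel: "rel_isoperimetric G \<H> S R f" if f: "area_bound G \<H> S T f" for f
    unfolding rel_isoperimetric_def Let_def
  proof (intro allI ballI impI)
    fix n W assume W: "W \<in> rel_words G \<H> S" "length W \<le> n \<and> word_value G W = \<one>\<^bsub>G\<^esub>"
    have WL: "W \<in> ?L" using W(1) unfolding rel_words_def by blast
    then have "der ?E T (f n) W []" using f W unfolding area_bound_def by blast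
    from X.der_conj_prod[OF T(1) this WL] show "\<exists>ps. length ps \<le> f n \<and>
              set ps \<subseteq> carrier ?F \<times> (R \<union> (\<lambda>r. inv\<^bsub>?F\<^esub> r) ` R) \<and>
              rel_elem G S \<H> W = conj_prod ?F ps"
      unfolding T(3) rel_elem_def .
  qed
  have of_rel: "area_bound G \<H> S T f" if f: "rel_isoperimetric G \<H> S R f" for f
    unfolding area_bound_def
  proof (intro ballI impI allI)
    fix w n assume w: "w \<in> ?L" "word_value G w = \<one>\<^bsub>G\<^esub>" "length w \<le> n"
    let ?w = "filter (\<lambda>l. l \<notin> (\<lambda>H. Per H \<one>\<^bsub>G\<^esub>) ` \<H>) w"
    have we: "word_eq ?E w ?w" using w(1) by (rule X.word_eq_drop_trivial)
    have "word_value G ?w = \<one>\<^bsub>G\<^esub>" using word_eq_value[OF gp SG we] w by simp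
    moreover have "?w \<in> rel_words G \<H> S" using w(1) unfolding rel_words_def by auto
    moreover have "length ?w \<le> n" using w(3) length_filter_le le_trans by blast
    ultimately obtain ps where ps: "length ps \<le> f n"
      "set ps \<subseteq> carrier ?F \<times> (R \<union> (\<lambda>r. inv\<^bsub>?F\<^esub> r) ` R)" "word_class ?E ?w = conj_prod ?F ps"
      using f unfolding rel_isoperimetric_def Let_def rel_elem_def by meson
    obtain v where v: "conj_prod ?F ps = word_class ?E v" "der ?E T (length ps) v []"
      using X.conj_prod_der[OF T(1) ps(2)[folded T(3)]] by (elim exE conjE)
    have "word_eq ?E w v" using we ps(3) v(1) unfolding word_class_eq_iff[symmetric] by simp
    then show "der ?E T (f n) w []" using der_free_left der_mono[OF v(2) ps(1)] by blast
  qed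
  show ?thesis
    using that[OF wp of_rel] to_rel dehn by (auto simp: rel_dehn_of_def)
qed

section \<open>Change of presentation\<close>

abbreviation subst :: "('l \<Rightarrow> 'm list) \<Rightarrow> 'l list \<Rightarrow> 'm list" where
  "subst \<sigma> w \<equiv> concat (map \<sigma> w)"

lemma subst_lists:
  "(\<And>l. l \<in> A \<Longrightarrow> \<sigma> l \<in> lists B) \<Longrightarrow> w \<in> lists A \<Longrightarrow> subst \<sigma> w \<in> lists B"
  by (induction w) auto

lemma subst_length:
  "(\<And>l. l \<in> A \<Longrightarrow> length (\<sigma> l) \<le> K) \<Longrightarrow> w \<in> lists A \<Longrightarrow> length (subst \<sigma> w) \<le> K * length w"
  by (induction w) (auto intro: add_mono)

lemma subst_value:
  assumes "group_pair G \<H>" "S \<subseteq> carrier G"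
    and "\<And>l. l \<in> A \<Longrightarrow> \<sigma> l \<in> lists (rel_alphabet S \<H>)"
    and "\<And>l. l \<in> A \<Longrightarrow> word_value G (\<sigma> l) = letter_value G l" and "w \<in> lists A"
  shows "word_value G (subst \<sigma> w) = word_value G w"
  using assms(5)
proof (induction w)
  case (Cons l w)
  then show ?case
    using word_value_append[OF assms(1,2) assms(3), of l "subst \<sigma> w"]
      subst_lists[of A \<sigma> "rel_alphabet S \<H>" w] assms(3,4) by simp
qed simp

text \<open>The substituted word has length at most K n and is filled over \<open>T\<close>; the
  filling is pulled back through \<open>\<sigma>'\<close>, each relator costing \<open>C\<close>.
  The linear term pays for the passage from the word to its round trip, \<open>L\<close> per
  letter.\<close>

lemma area_bound_transfer:
  assumes f: "area_bound G \<H> S T f"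
    and \<sigma>: "\<And>l. l \<in> rel_alphabet S' \<H>' \<Longrightarrow> \<sigma> l \<in> lists (rel_alphabet S \<H>)"
      "\<And>l. l \<in> rel_alphabet S' \<H>' \<Longrightarrow> length (\<sigma> l) \<le> K"
      "\<And>w. w \<in> lists (rel_alphabet S' \<H>') \<Longrightarrow> word_value G' w = \<one>\<^bsub>G'\<^esub> \<Longrightarrow>
        word_value G (subst \<sigma> w) = \<one>\<^bsub>G\<^esub>"
    and \<sigma>': "\<And>u v. (u, v) \<in> rel_free_rels G S \<H> \<Longrightarrow>
        word_eq (rel_free_rels G' S' \<H>') (subst \<sigma>' u) (subst \<sigma>' v)"
      "\<And>r. r \<in> T \<Longrightarrow> der (rel_free_rels G' S' \<H>') T' C (subst \<sigma>' r) []"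
    and ret: "\<And>l. l \<in> rel_alphabet S' \<H>' \<Longrightarrow>
        der (rel_free_rels G' S' \<H>') T' L [l] (subst \<sigma>' (\<sigma> l))"
  shows "area_bound G' \<H>' S' T' (\<lambda>n. C * f (K * n) + L * n)"
  unfolding area_bound_def
proof (intro ballI impI allI)
  fix w n assume w: "w \<in> lists (rel_alphabet S' \<H>')" "word_value G' w = \<one>\<^bsub>G'\<^esub>" "length w \<le> n"
  let ?E = "rel_free_rels G' S' \<H>'"
  have "length (subst \<sigma> w) \<le> K * length w" by (rule subst_length[OF \<sigma>(2) w(1)])
  then have "length (subst \<sigma> w) \<le> K * n" using w(3) by (meson le_trans mult_le_mono2)
  moreover have "subst \<sigma> w \<in> lists (rel_alphabet S \<H>)" by (rule subst_lists[OF \<sigma>(1) w(1)])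
  ultimately have "der (rel_free_rels G S \<H>) T (f (K * n)) (subst \<sigma> w) []"
    using f \<sigma>(3)[OF w(1,2)] unfolding area_bound_def by blast
  from der_map[OF \<sigma>' this] have 1: "der ?E T' (C * f (K * n)) (subst \<sigma>' (subst \<sigma> w)) []" by simp
  have "der ?E T' (L * length w) w (subst \<sigma>' (subst \<sigma> w))"
    using w(1)
  proof (induction w)
    case (Cons l w)
    then show ?case using der_append[OF ret[of l], of "L * length w" w "subst \<sigma>' (subst \<sigma> w)"] by simp
  qed (simp add: der_refl)
  from der.trans[OF this 1] show "der ?E T' (C * f (K * n) + L * n) w []"
    by (rule der_mono) (use w(3) in simp)
qed

lemma word_presentationD:
  assumes "word_presentation G \<H> S T"
  shows "group_pair G \<H>" "group G" "S \<subseteq> carrier G" "finite S" "finite T"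
    "T \<subseteq> {w \<in> lists (rel_alphabet S \<H>). word_value G w = \<one>\<^bsub>G\<^esub>}"
    "\<And>g. g \<in> carrier G \<Longrightarrow> \<exists>w\<in>lists (rel_alphabet S \<H>). word_value G w = g"
    "\<And>w. w \<in> lists (rel_alphabet S \<H>) \<Longrightarrow> word_value G w = \<one>\<^bsub>G\<^esub> \<Longrightarrow>
      \<exists>k. der (rel_free_rels G S \<H>) T k w []"
  using assms by (auto simp: word_presentation_def group_pair_def)

lemma der_uniform:
  assumes "finite X" "\<And>x. x \<in> X \<Longrightarrow> \<exists>k. der E T k (u x) (v x)"
  obtains C where "\<And>x. x \<in> X \<Longrightarrow> der E T C (u x) (v x)"
proof -
  obtain k where k: "\<And>x. x \<in> X \<Longrightarrow> der E T (k x) (u x) (v x)" using assms(2) by metis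
  show ?thesis
    by (rule that[of "sum k X"]) (rule der_mono[OF k], auto intro: member_le_sum assms(1))
qed

lemma inverse_word:
  assumes gp: "group_pair G \<H>" and SG: "S \<subseteq> carrier G" and v: "v \<in> lists (rel_alphabet S \<H>)"
  obtains v' where "v' \<in> lists (rel_alphabet S \<H>)"
    "word_eq (rel_free_rels G S \<H>) (v @ v') []" "word_eq (rel_free_rels G S \<H>) (v' @ v) []"
    "word_value G v' = inv\<^bsub>G\<^esub> (word_value G v)"
proof -
  interpret group G using gp by (simp add: group_pair_def)
  interpret X: rel_pair G \<H> S by unfold_locales (fact gp SG)+
  obtain v' where v': "v' \<in> X.L" "inv\<^bsub>X.F\<^esub> X.cl v = X.cl v'" using X.rel_free_inv_word[OF v] .
  note e = X.rel_free_inv[OF v v']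
  have "v' @ v \<in> lists (rel_alphabet S \<H>)" using v v'(1) by simp
  then have "word_value G (v' @ v) = \<one>\<^bsub>G\<^esub>" using word_eq_value[OF gp SG e(2)] by simp
  then have "word_value G v' = inv\<^bsub>G\<^esub> (word_value G v)"
    using word_value_append[OF gp SG v'(1) v] word_value_closed[OF gp SG] v v'(1)
    by (simp add: inv_equality)
  then show ?thesis using that[OF v'(1) e] by blast
qed

lemma der_same_value:
  assumes wp: "word_presentation G \<H> S T"
    and uv: "u \<in> lists (rel_alphabet S \<H>)" "v \<in> lists (rel_alphabet S \<H>)" "word_value G u = word_value G v"
  shows "\<exists>k. der (rel_free_rels G S \<H>) T k u v"
proof -
  note wpD = word_presentationD[OF wp]
  interpret group G by (rule wpD(2))
  let ?E = "rel_free_rels G S \<H>"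
  obtain v' where v': "v' \<in> lists (rel_alphabet S \<H>)" "word_eq ?E (v' @ v) []"
    "word_value G v' = inv\<^bsub>G\<^esub> (word_value G v)"
    using inverse_word[OF wpD(1,3) uv(2)] by blast
  have "u @ v' \<in> lists (rel_alphabet S \<H>)" using uv v' by simp
  moreover have "word_value G (u @ v') = \<one>\<^bsub>G\<^esub>"
    using word_value_append[OF wpD(1,3) uv(1) v'(1)] v'(3) uv(3) word_value_closed[OF wpD(1,3) uv(2)]
    by simp
  ultimately obtain k where "der ?E T k (u @ v') []" using wpD(8) by blast
  from der_context[OF this, of "[]" v] have k: "der ?E T k (u @ v' @ v) v" by simp
  have "word_eq ?E (u @ v' @ v) u" using word_eq_context[OF v'(2), of u "[]"] by simp
  then show ?thesis using der_free_left[OF word_eq.sym k] by blast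
qed

text \<open>Peripheral letters are kept, so lengths stay bounded although the alphabet may be
  infinite. \<open>GenInv s\<close> goes to an inverse of the word for \<open>s\<close> in the free
  product, not merely in \<open>G\<close>; otherwise cancelling \<open>Gen s\<close> against
  \<open>GenInv s\<close> would cost relators.\<close>

lemma generator_subst:
  assumes wp: "word_presentation G \<H> S T" and S': "S' \<subseteq> carrier G" "finite S'"
  obtains \<sigma> K where
    "\<And>l. l \<in> rel_alphabet S' \<H> \<Longrightarrow> \<sigma> l \<in> lists (rel_alphabet S \<H>)"
    "\<And>l. l \<in> rel_alphabet S' \<H> \<Longrightarrow> word_value G (\<sigma> l) = letter_value G l"
    "\<And>l. l \<in> rel_alphabet S' \<H> \<Longrightarrow> length (\<sigma> l) \<le> K"
    "\<And>u v. (u, v) \<in> rel_free_rels G S' \<H> \<Longrightarrow>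
        word_eq (rel_free_rels G S \<H>) (subst \<sigma> u) (subst \<sigma> v)"
    "\<And>H h. \<sigma> (Per H h) = [Per H h]"
proof -
  note wpD = word_presentationD[OF wp]
  interpret group G by (rule wpD(2))
  let ?E = "rel_free_rels G S \<H>" and ?L = "lists (rel_alphabet S \<H>)"
  have "\<exists>w. w \<in> ?L \<and> word_value G w = s" if "s \<in> S'" for s using wpD(7) S' that by blast
  then obtain p where p: "\<And>s. s \<in> S' \<Longrightarrow> p s \<in> ?L" "\<And>s. s \<in> S' \<Longrightarrow> word_value G (p s) = s" by metis
  have "\<exists>w. w \<in> ?L \<and> word_eq ?E (p s @ w) [] \<and> word_eq ?E (w @ p s) [] \<and> word_value G w = inv\<^bsub>G\<^esub> s"
    if "s \<in> S'" for s
    using inverse_word[OF wpD(1,3) p(1)[OF that]] p(2)[OF that] by metis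
  then obtain q where q: "\<And>s. s \<in> S' \<Longrightarrow> q s \<in> ?L" "\<And>s. s \<in> S' \<Longrightarrow> word_value G (q s) = inv\<^bsub>G\<^esub> s"
      "\<And>s. s \<in> S' \<Longrightarrow> word_eq ?E (p s @ q s) []" "\<And>s. s \<in> S' \<Longrightarrow> word_eq ?E (q s @ p s) []"
    by metis
  define \<sigma> where "\<sigma> = (\<lambda>l. case l of Gen s \<Rightarrow> p s | GenInv s \<Rightarrow> q s | Per H h \<Rightarrow> [Per H h])"
  have \<sigma>: "\<sigma> (Gen s) = p s" "\<sigma> (GenInv s) = q s" "\<sigma> (Per H h) = [Per H h]" for s H h
    by (simp_all add: \<sigma>_def)
  \<comment> \<open>The sum covers the finitely many generators and their inverses, the successor a
    single peripheral letter.\<close>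
  define K where "K = Suc (sum (\<lambda>s. length (p s) + length (q s)) S')"
  have len: "length (p s) + length (q s) \<le> sum (\<lambda>s. length (p s) + length (q s)) S'" if "s \<in> S'" for s
    using that S'(2) by (intro member_le_sum) auto
  show ?thesis
  proof (rule that[of \<sigma> K])
    fix l assume l: "l \<in> rel_alphabet S' \<H>"
    show "\<sigma> l \<in> ?L"
      using l p(1) q(1) by (cases l) (auto simp: \<sigma> rel_alphabet_iff)
    show "word_value G (\<sigma> l) = letter_value G l"
      using l p(2) q(2) wpD(1) subgroup.mem_carrier
      by (cases l) (fastforce simp: \<sigma> rel_alphabet_iff group_pair_def)+
    show "length (\<sigma> l) \<le> K"
      using l len by (cases l) (fastforce simp: \<sigma> rel_alphabet_iff K_def)+
  next
    fix u v assume "(u, v) \<in> rel_free_rels G S' \<H>"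
    then consider s where "s \<in> S'" "u = [Gen s, GenInv s] \<or> u = [GenInv s, Gen s]" "v = []"
      | H where "H \<in> \<H>" "(u, v) \<in> table_rels G H (Per H)"
      unfolding rel_free_rels_def by blast
    then show "word_eq ?E (subst \<sigma> u) (subst \<sigma> v)"
    proof cases
      case 1
      then show ?thesis using q by (auto simp: \<sigma>)
    next
      case 2
      then have "(u, v) \<in> ?E" unfolding rel_free_rels_def by blast
      moreover have "subst \<sigma> u = u" "subst \<sigma> v = v" using 2(2) by (auto simp: table_rels_def \<sigma>)
      ultimately show ?thesis by (simp add: word_eq_base)
    qed
  qed (rule \<sigma>(3))
qed

text \<open>The round trip between the two alphabets fixes peripheral letters. Its cost per letter
  is therefore bounded over the finitely many generators and their inverses.\<close>

lemma change_presentation: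
  assumes wp: "word_presentation G \<H> S T" "word_presentation G \<H> S' T'" and f: "area_bound G \<H> S T f"
  obtains C K L where "area_bound G \<H> S' T' (\<lambda>n. C * f (K * n) + L * n)"
proof -
  note D = word_presentationD[OF wp(1)] and D' = word_presentationD[OF wp(2)]
  let ?E' = "rel_free_rels G S' \<H>" and ?L = "rel_alphabet S \<H>" and ?L' = "rel_alphabet S' \<H>"
  obtain \<sigma> K where \<sigma>: "\<And>l. l \<in> ?L' \<Longrightarrow> \<sigma> l \<in> lists ?L"
    "\<And>l. l \<in> ?L' \<Longrightarrow> word_value G (\<sigma> l) = letter_value G l"
    "\<And>l. l \<in> ?L' \<Longrightarrow> length (\<sigma> l) \<le> K"
    "\<And>H h. \<sigma> (Per H h) = [Per H h]"
    using generator_subst[OF wp(1) D'(3,4)] by metis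
  obtain \<sigma>' where \<sigma>': "\<And>l. l \<in> ?L \<Longrightarrow> \<sigma>' l \<in> lists ?L'"
    "\<And>l. l \<in> ?L \<Longrightarrow> word_value G (\<sigma>' l) = letter_value G l"
    "\<And>u v. (u, v) \<in> rel_free_rels G S \<H> \<Longrightarrow> word_eq ?E' (subst \<sigma>' u) (subst \<sigma>' v)"
    "\<And>H h. \<sigma>' (Per H h) = [Per H h]"
    using generator_subst[OF wp(2) D(3,4)] by metis
  have "\<exists>k. der ?E' T' k (subst \<sigma>' r) []" if "r \<in> T" for r
  proof -
    have r: "r \<in> lists ?L" "word_value G r = \<one>\<^bsub>G\<^esub>" using D(6) that by auto
    have "subst \<sigma>' r \<in> lists ?L'" by (rule subst_lists[OF \<sigma>'(1) r(1)])
    then show ?thesis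
      by (rule D'(8)) (simp add: subst_value[OF D'(1,3) \<sigma>'(1,2) r(1)] r(2))
  qed
  then obtain C where C: "\<And>r. r \<in> T \<Longrightarrow> der ?E' T' C (subst \<sigma>' r) []"
    using der_uniform[OF D(5), of ?E' T' "subst \<sigma>'" "\<lambda>_. []"] by blast
  let ?X = "Gen ` S' \<union> GenInv ` S'"
  have "\<exists>k. der ?E' T' k [l] (subst \<sigma>' (\<sigma> l))" if l: "l \<in> ?X" for l
  proof -
    interpret group G by (rule D(2))
    have l': "l \<in> ?L'" using l by (auto simp: rel_alphabet_def)
    have "word_value G (subst \<sigma>' (\<sigma> l)) = word_value G (\<sigma> l)"
      using subst_value[OF D'(1,3) \<sigma>'(1,2) \<sigma>(1)[OF l']] .
    moreover have "letter_value G l \<in> carrier G" using l D'(3) by auto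
    ultimately show ?thesis
      using der_same_value[OF wp(2), of "[l]" "subst \<sigma>' (\<sigma> l)"] l' \<sigma>(2)[OF l']
        subst_lists[OF \<sigma>'(1) \<sigma>(1)[OF l']] by simp
  qed
  then obtain L where L: "\<And>l. l \<in> ?X \<Longrightarrow> der ?E' T' L [l] (subst \<sigma>' (\<sigma> l))"
    using der_uniform[of ?X ?E' T' "\<lambda>l. [l]" "\<lambda>l. subst \<sigma>' (\<sigma> l)"] D'(4) by blast
  have "area_bound G \<H> S' T' (\<lambda>n. C * f (K * n) + L * n)"
  proof (rule area_bound_transfer[OF f \<sigma>(1,3) _ \<sigma>'(3) C])
    fix w assume "w \<in> lists ?L'" "word_value G w = \<one>\<^bsub>G\<^esub>"
    then show "word_value G (subst \<sigma> w) = \<one>\<^bsub>G\<^esub>" using subst_value[OF D(1,3) \<sigma>(1,2)] by simp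
  next
    fix l assume l: "l \<in> ?L'"
    show "der ?E' T' L [l] (subst \<sigma>' (\<sigma> l))"
    proof (cases "l \<in> ?X")
      case False
      then obtain H h where "l = Per H h" using l by (auto simp: rel_alphabet_def)
      then show ?thesis by (simp add: \<sigma>(4) \<sigma>'(4) der_refl)
    qed (rule L)
  qed
  then show ?thesis by (rule that)
qed

text \<open>Letters and values are taken in the ambient group \<open>P\<close>, so that all base
  groups and the whole group share one type of letters.\<close>

definition subgroup_presentation ::
    "'a monoid \<Rightarrow> 'a set \<Rightarrow> 'a set set \<Rightarrow> 'a set \<Rightarrow> 'a rel_letter list set \<Rightarrow> (nat \<Rightarrow> nat) \<Rightarrow> bool" where
  "subgroup_presentation P A \<H> S T f \<longleftrightarrow>
     group_pair P \<H> \<and> (\<forall>H\<in>\<H>. H \<subseteq> A) \<and> S \<subseteq> A \<and> finite S \<and> finite T \<and>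
     T \<subseteq> {w \<in> lists (rel_alphabet S \<H>). word_value P w = \<one>\<^bsub>P\<^esub>} \<and>
     A \<subseteq> word_value P ` lists (rel_alphabet S \<H>) \<and> area_bound P \<H> S T f"

section \<open>Superadditive functions and closures\<close>

definition superadditive :: "(nat \<Rightarrow> nat) \<Rightarrow> bool" where
  "superadditive f \<longleftrightarrow> (\<forall>m n. f m + f n \<le> f (m + n))"

lemma superadditive_mono:
  assumes "superadditive f" "m \<le> n"
  shows "f m \<le> f n"
  using assms(1)[unfolded superadditive_def, rule_format, of m "n - m"] assms(2) by simp

lemma superadd_closure_sums:
  fixes g :: "nat \<Rightarrow> nat"
  assumes "g 0 = (0::nat)"
  shows "finite {sum_list (map g ns) | ns. sum_list ns = n}"
proof -
  have "{sum_list (map g ns) | ns. sum_list ns = n}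
      \<subseteq> (\<lambda>ns. sum_list (map g ns)) ` {ns. set ns \<subseteq> {..n} \<and> length ns \<le> n}"
  proof
    fix x assume "x \<in> {sum_list (map g ns) | ns. sum_list ns = n}"
    then obtain ns where ns: "x = sum_list (map g ns)" "sum_list ns = n" by blast
    let ?ms = "filter ((<) 0) ns"
    have ms: "sum_list (map g ?ms) = sum_list (map g ns)" "sum_list ?ms = sum_list ns"
      using assms by (induction ns) auto
    have "length xs \<le> sum_list xs" if "0 \<notin> set xs" for xs :: "nat list"
      using that by (induction xs) auto
    from this[of ?ms] have "length ?ms \<le> n" by (simp add: ms(2) ns(2))
    moreover have "set ?ms \<subseteq> {..n}" using member_le_sum_list[of _ ns] ns(2) by auto
    ultimately show "x \<in> (\<lambda>ns. sum_list (map g ns)) ` {ns. set ns \<subseteq> {..n} \<and> length ns \<le> n}"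
      by (intro image_eqI[where x = ?ms]) (simp_all add: ms(1) ns(1))
  qed
  then show ?thesis by (rule finite_subset) (simp add: finite_lists_length_le)
qed

lemma superadd_closure_ge:
  assumes "g 0 = 0" "sum_list ns = n"
  shows "sum_list (map g ns) \<le> superadd_closure g n"
  unfolding superadd_closure_def by (rule Max_ge[OF superadd_closure_sums[of g, OF assms(1)]]) (use assms(2) in blast)

lemma le_superadd_closure: "g 0 = 0 \<Longrightarrow> g n \<le> superadd_closure g n"
  using superadd_closure_ge[of g "[n]" n] by simp

lemma superadditive_closure:
  assumes "g 0 = 0"
  shows "superadditive (superadd_closure g)"
proof -
  have ex: "\<exists>ns. sum_list ns = n \<and> superadd_closure g n = sum_list (map g ns)" for n
  proof -
    have "superadd_closure g n \<in> {sum_list (map g ns) | ns. sum_list ns = n}"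
      unfolding superadd_closure_def
      by (rule Max_in[OF superadd_closure_sums[of g, OF assms]]) (auto intro: exI[of _ "[n]"])
    then show ?thesis by auto
  qed
  show ?thesis
    unfolding superadditive_def
  proof (intro allI)
    fix m n
    obtain ms ns where "sum_list ms = m" "superadd_closure g m = sum_list (map g ms)"
      "sum_list ns = n" "superadd_closure g n = sum_list (map g ns)" using ex by meson
    then show "superadd_closure g m + superadd_closure g n \<le> superadd_closure g (m + n)"
      using superadd_closure_ge[of g, OF assms, of "ms @ ns" "m + n"] by simp
  qed
qed

section \<open>Normal forms in a graph of groups\<close>

lemma word_eq_table:
  assumes "table_rels G H \<iota> \<subseteq> R"
  shows "word_eq R [\<iota> \<one>\<^bsub>G\<^esub>] []"
    and "x \<in> H \<Longrightarrow> y \<in> H \<Longrightarrow> word_eq R [\<iota> x, \<iota> y] [\<iota> (x \<otimes>\<^bsub>G\<^esub> y)]"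
  using assms by (auto simp: table_rels_def intro!: word_eq_base)

section \<open>Representatives of left and right cosets\<close>

context group
begin

lemma mult_inv_cancel:
  "x \<in> carrier G \<Longrightarrow> y \<in> carrier G \<Longrightarrow> inv x \<otimes> (x \<otimes> y) = y"
  "x \<in> carrier G \<Longrightarrow> y \<in> carrier G \<Longrightarrow> x \<otimes> (inv x \<otimes> y) = y"
  by (simp_all add: m_assoc[symmetric])

text \<open>The predicate under the choice depends on \<open>p\<close> only through the coset p H,
  so equal cosets get equal representatives; the coset \<open>H\<close> itself is represented by
  \<one>.\<close>

definition coset_rep :: "'a set \<Rightarrow> 'a \<Rightarrow> 'a" where
  "coset_rep H p = (if p \<in> H then \<one> else (SOME x. \<exists>k\<in>H. x = p \<otimes> k))"

lemma coset_rep: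
  assumes H: "subgroup H G" and p: "p \<in> carrier G"
  shows "coset_rep H p \<in> carrier G" "inv (coset_rep H p) \<otimes> p \<in> H"
proof -
  interpret K: subgroup H G by (rule H)
  have "\<exists>k\<in>H. coset_rep H p = p \<otimes> k"
  proof (cases "p \<in> H")
    case True
    then show ?thesis using K.m_inv_closed[OF True] p by (auto simp: coset_rep_def intro: bexI[of _ "inv p"])
  next
    case False
    have "\<exists>x. \<exists>k\<in>H. x = p \<otimes> k" using K.one_closed by blast
    from someI_ex[OF this] show ?thesis using False by (simp add: coset_rep_def)
  qed
  then obtain k where k: "k \<in> H" "coset_rep H p = p \<otimes> k" by blast
  then show "coset_rep H p \<in> carrier G" using p K.mem_carrier by simp
  have "inv (coset_rep H p) \<otimes> p = inv k"
    using k p K.mem_carrier[OF k(1)] by (simp add: inv_mult_group m_assoc)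
  then show "inv (coset_rep H p) \<otimes> p \<in> H" using k(1) K.m_inv_closed by simp
qed

lemma coset_rep_mult:
  assumes H: "subgroup H G" and p: "p \<in> carrier G" and k: "k \<in> H"
  shows "coset_rep H (p \<otimes> k) = coset_rep H p"
proof -
  interpret K: subgroup H G by (rule H)
  have "p \<otimes> k \<in> H \<longleftrightarrow> p \<in> H"
  proof
    assume "p \<otimes> k \<in> H"
    then have "p \<otimes> k \<otimes> inv k \<in> H" using k K.m_closed K.m_inv_closed by blast
    then show "p \<in> H" using p K.mem_carrier[OF k] by (simp add: m_assoc)
  qed (use k K.m_closed in blast)
  moreover have "(\<lambda>x. \<exists>k'\<in>H. x = p \<otimes> k \<otimes> k') = (\<lambda>x. \<exists>k'\<in>H. x = p \<otimes> k')"
  proof (intro ext iffI)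
    fix x assume "\<exists>k'\<in>H. x = p \<otimes> k \<otimes> k'"
    then obtain k' where "k' \<in> H" "x = p \<otimes> k \<otimes> k'" by blast
    then show "\<exists>k'\<in>H. x = p \<otimes> k'"
      using p k K.mem_carrier by (intro bexI[of _ "k \<otimes> k'"]) (auto simp: m_assoc)
  next
    fix x assume "\<exists>k'\<in>H. x = p \<otimes> k'"
    then obtain k' where k': "k' \<in> H" "x = p \<otimes> k'" by blast
    have c: "k \<in> carrier G" "k' \<in> carrier G" using k k'(1) by auto
    have "k \<otimes> (inv k \<otimes> k') = k'" using c by (simp add: m_assoc[symmetric])
    then have "x = p \<otimes> k \<otimes> (inv k \<otimes> k')" using p c k'(2) by (simp add: m_assoc)
    then show "\<exists>k'\<in>H. x = p \<otimes> k \<otimes> k'" using k k'(1) by (intro bexI[of _ "inv k \<otimes> k'"]) auto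
  qed
  ultimately show ?thesis by (simp add: coset_rep_def)
qed

lemma coset_rep_K: "k \<in> H \<Longrightarrow> coset_rep H k = \<one>"
  by (simp add: coset_rep_def)

lemma coset_rep_one: "subgroup H G \<Longrightarrow> coset_rep H \<one> = \<one>"
  by (rule coset_rep_K) (rule subgroup.one_closed)

lemma coset_rep_eq_one: "subgroup H G \<Longrightarrow> p \<in> carrier G \<Longrightarrow> coset_rep H p = \<one> \<Longrightarrow> p \<in> H"
  using coset_rep(2)[of H p] by simp

lemma coset_rep_rep:
  assumes H: "subgroup H G" and p: "p \<in> carrier G"
  shows "coset_rep H (coset_rep H p) = coset_rep H p"
proof -
  have "inv (coset_rep H p) \<otimes> p \<in> H" by (rule coset_rep(2)[OF H p])
  then have "coset_rep H (coset_rep H p \<otimes> (inv (coset_rep H p) \<otimes> p)) = coset_rep H (coset_rep H p)"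
    by (rule coset_rep_mult[OF H coset_rep(1)[OF H p]])
  then show ?thesis using p coset_rep(1)[OF H p] by (simp add: m_assoc[symmetric])
qed

text \<open>Inversion exchanges left and right cosets: the representative of H g is the inverse of
  that of g^-1 H.\<close>

definition right_rep :: "'a set \<Rightarrow> 'a \<Rightarrow> 'a" where
  "right_rep H g = inv (coset_rep H (inv g))"

lemma right_rep:
  assumes H: "subgroup H G" and g: "g \<in> carrier G"
  shows "right_rep H g \<in> carrier G" "g \<otimes> inv (right_rep H g) \<in> H"
proof -
  note c = coset_rep[OF H inv_closed[OF g]]
  show "right_rep H g \<in> carrier G" using c(1) by (simp add: right_rep_def)
  have "inv (inv (coset_rep H (inv g)) \<otimes> inv g) \<in> H" by (rule subgroup.m_inv_closed[OF H c(2)])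
  then show "g \<otimes> inv (right_rep H g) \<in> H" using c(1) g by (simp add: right_rep_def inv_mult_group)
qed

lemma right_rep_mult:
  assumes H: "subgroup H G" and g: "g \<in> carrier G" and k: "k \<in> H"
  shows "right_rep H (k \<otimes> g) = right_rep H g"
  using coset_rep_mult[OF H inv_closed[OF g] subgroup.m_inv_closed[OF H k]] g subgroup.mem_carrier[OF H k]
  by (simp add: right_rep_def inv_mult_group)

lemma right_rep_H: "subgroup H G \<Longrightarrow> k \<in> H \<Longrightarrow> right_rep H k = \<one>"
  using coset_rep_K[of "inv k" H] subgroup.m_inv_closed[of H G k] by (simp add: right_rep_def)

lemma right_rep_eq_one:
  assumes H: "subgroup H G" and g: "g \<in> carrier G" and "right_rep H g = \<one>"
  shows "g \<in> H"
  using right_rep(2)[OF H g] g assms(3) by simp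

lemma right_rep_rep:
  assumes H: "subgroup H G" and g: "g \<in> carrier G"
  shows "right_rep H (right_rep H g) = right_rep H g"
  using coset_rep_rep[OF H inv_closed[OF g]] coset_rep(1)[OF H inv_closed[OF g]] by (simp add: right_rep_def)

end

text \<open>A star of groups inside \<open>P\<close>: the central group is \<open>Q\<close>, and
  edge \<open>j\<close> joins it to the base group \<open>A (vertex j)\<close>. The axioms only
  place these subgroups in \<open>P\<close>; that they generate their products as freely as possible
  is expressed by \<open>has_normal_forms\<close>.\<close>

locale gluing = group P for P :: "'p monoid" (structure) +
  fixes Q :: "'p set"
    and vertex :: "'j::finite \<Rightarrow> 'v::finite" and root :: "'v \<Rightarrow> 'j"
    and A :: "'v \<Rightarrow> 'p set" and K :: "'j \<Rightarrow> 'p set" and \<tau> :: "'j \<Rightarrow> 'p"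
  assumes subgroup_Q: "subgroup Q P"
    and subgroup_A: "subgroup (A v) P"
    and subgroup_K: "subgroup (K j) P"
    and K_subset: "K j \<subseteq> A (vertex j)"
    and \<tau>_closed: "\<tau> j \<in> carrier P"
    and conj_K: "conj_set P (K j) (\<tau> j) \<subseteq> Q"
    and vertex_root: "vertex (root v) = v"
    and \<tau>_root: "\<tau> (root v) = \<one>"
begin

lemmas Q_closed = subgroup.mem_carrier[OF subgroup_Q]
lemmas A_closed = subgroup.mem_carrier[OF subgroup_A]
lemmas K_closed = subgroup.mem_carrier[OF subgroup_K]

lemma conj_K_Q: "k \<in> K j \<Longrightarrow> \<tau> j \<otimes> k \<otimes> inv (\<tau> j) \<in> Q"
  using conj_K[of j] by (auto simp: conj_set_def)

text \<open>
  An element of \<open>P\<close> is spelled as an element of \<open>Q\<close> followed by excursions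
  \<open>\<tau> i a (\<tau> j)\<^sup>-\<^sup>1 q\<close> through a base group; the last excursion is the head of the list.
\<close>

fun stack_value :: "'p \<Rightarrow> ('p \<times> 'j \<times> 'p \<times> 'j) list \<Rightarrow> 'p" where
  "stack_value q [] = q"
| "stack_value q ((p, i, a, j) # st) = stack_value p st \<otimes> (\<tau> i \<otimes> a \<otimes> inv (\<tau> j)) \<otimes> q"

text \<open>These are the two conditions against backtracking of a reduced path in a graph of
  groups: at a base vertex, an excursion does not return along its own edge by an element of the
  edge group; at the central vertex, two successive excursions are not joined through the edge they
  share.\<close>

fun reduced :: "'p \<Rightarrow> ('p \<times> 'j \<times> 'p \<times> 'j) list \<Rightarrow> bool" where
  "reduced q [] \<longleftrightarrow> q \<in> Q"
| "reduced q ((p, i, a, j) # st) \<longleftrightarrow> q \<in> Q \<and> reduced p st \<and> vertex i = vertex j \<and> a \<in> A (vertex i)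
     \<and> \<not> (i = j \<and> a \<in> K i)
     \<and> (case st of [] \<Rightarrow> True | (_, _, _, l) # _ \<Rightarrow> \<not> (l = i \<and> p \<in> conj_set P (K i) (\<tau> i)))"

definition has_normal_forms :: bool where
  "has_normal_forms \<longleftrightarrow> (\<forall>q st. reduced q st \<longrightarrow> stack_value q st = \<one> \<longrightarrow> st = [])"

end

lemma subgroup_conj_set:
  fixes G :: "'a monoid" (structure)
  assumes "group G" "subgroup H G" "t \<in> carrier G"
  shows "subgroup (conj_set G H t) G"
proof -
  interpret group G by fact
  interpret H: subgroup H G by fact
  show ?thesis
  proof (rule subgroupI)
    show "conj_set G H t \<subseteq> carrier G" using assms(3) by (auto simp: conj_set_def)
    show "conj_set G H t \<noteq> {}" unfolding conj_set_def using H.one_closed by blast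
  next
    fix a assume "a \<in> conj_set G H t"
    then obtain k where k: "k \<in> H" "a = t \<otimes> k \<otimes> inv t" by (auto simp: conj_set_def)
    then have "inv a = t \<otimes> inv k \<otimes> inv t" using assms(3) by (simp add: inv_mult_group m_assoc)
    then show "inv a \<in> conj_set G H t" using k(1) by (auto simp: conj_set_def)
  next
    fix a b assume "a \<in> conj_set G H t" "b \<in> conj_set G H t"
    then obtain k l where kl: "k \<in> H" "l \<in> H" "a = t \<otimes> k \<otimes> inv t" "b = t \<otimes> l \<otimes> inv t"
      by (auto simp: conj_set_def)
    then have "a \<otimes> b = t \<otimes> (k \<otimes> l) \<otimes> inv t"
      using assms(3) by (simp add: m_assoc inv_solve_left')
    then show "a \<otimes> b \<in> conj_set G H t" using kl(1,2) by (auto simp: conj_set_def)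
  qed
qed

section \<open>The action on normal forms\<close>

context gluing
begin

text \<open>
  Normal forms in the graph of groups with central vertex \<open>Q\<close>, written \<open>None\<close>. A pair
  \<open>(g, [(j\<^sub>1, b\<^sub>1, r\<^sub>1), \<dots>])\<close> stands for \<open>g e\<^sub>1 r\<^sub>1 e\<^sub>2 r\<^sub>2 \<dots>\<close>, where \<open>e\<close> is \<open>\<tau> j\<close> if \<open>b\<close> and
  \<open>(\<tau> j)\<^sup>-\<^sup>1\<close> otherwise, and the \<open>r\<close> are fixed representatives of right cosets of edge groups.
\<close>

fun side :: "'j \<Rightarrow> bool \<Rightarrow> 'v option" where
  "side j b = (if b then Some (vertex j) else None)"

fun side_group :: "'v option \<Rightarrow> 'p set" where
  "side_group None = Q"
| "side_group (Some v) = A v"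

definition edge_group :: "'j \<Rightarrow> bool \<Rightarrow> 'p set" where
  "edge_group j b = (if b then K j else conj_set P (K j) (\<tau> j))"

text \<open>Moves an element \<open>k\<close> of an edge group to the left across its edge letter: e
  k = (carry k) e.\<close>

definition carry :: "'j \<Rightarrow> bool \<Rightarrow> 'p \<Rightarrow> 'p" where
  "carry j b k = (if b then \<tau> j \<otimes> k \<otimes> inv (\<tau> j) else inv (\<tau> j) \<otimes> k \<otimes> \<tau> j)"

fun tail_ok :: "'v option \<Rightarrow> ('j \<times> bool \<times> 'p) list \<Rightarrow> bool" where
  "tail_ok s [] \<longleftrightarrow> s = None"
| "tail_ok s ((j, b, r) # ys) \<longleftrightarrow> s = side j (\<not> b) \<and> r \<in> side_group (side j b) \<and>
     right_rep (edge_group j b) r = r \<and> tail_ok (side j b) ys \<and>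
     \<not> (r = \<one> \<and> (\<exists>r' ys'. ys = (j, \<not> b, r') # ys'))"

definition forms :: "'v option \<Rightarrow> ('p \<times> ('j \<times> bool \<times> 'p) list) set" where
  "forms s = {(g, ys). g \<in> side_group s \<and> tail_ok s ys}"

text \<open>Left multiplication by the edge letter e: the leading element is split as k r with
  \<open>k\<close> in the edge group, \<open>k\<close> is carried to the left of e, and e cancels
  against a following inverse edge letter if r is \<one>.\<close>

definition cross :: "'j \<Rightarrow> bool \<Rightarrow> 'p \<times> ('j \<times> bool \<times> 'p) list \<Rightarrow> 'p \<times> ('j \<times> bool \<times> 'p) list" where
  "cross j b x = (let g = fst x; ys = snd x; r = right_rep (edge_group j b) g;
      k = carry j b (g \<otimes> inv r) in
      if r = \<one> \<and> (\<exists>r' ys'. ys = (j, \<not> b, r') # ys') then (k \<otimes> snd (snd (hd ys)), tl ys)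
      else (k, (j, b, r) # ys))"

definition translate :: "'p \<Rightarrow> 'p \<times> ('j \<times> bool \<times> 'p) list \<Rightarrow> 'p \<times> ('j \<times> bool \<times> 'p) list" where
  "translate a x = (a \<otimes> fst x, snd x)"

lemma subgroup_side: "subgroup (side_group s) P"
  using subgroup_Q subgroup_A by (cases s) auto

lemma subgroup_edge: "subgroup (edge_group j b) P"
  using subgroup_K subgroup_conj_set[OF is_group subgroup_K \<tau>_closed] by (simp add: edge_group_def)

lemma edge_subset: "edge_group j b \<subseteq> side_group (side j b)"
  using K_subset conj_K by (simp add: edge_group_def)

lemmas side_closed = subgroup.mem_carrier[OF subgroup_side]
lemmas edge_closed = subgroup.mem_carrier[OF subgroup_edge]

lemma conj_cancel:
  "t \<in> carrier P \<Longrightarrow> k \<in> carrier P \<Longrightarrow> inv t \<otimes> (t \<otimes> k \<otimes> inv t) \<otimes> t = k"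
  "t \<in> carrier P \<Longrightarrow> k \<in> carrier P \<Longrightarrow> t \<otimes> (inv t \<otimes> k \<otimes> t) \<otimes> inv t = k"
  by (simp_all add: m_assoc mult_inv_cancel)

lemma carry:
  assumes "k \<in> edge_group j b"
  shows "carry j b k \<in> edge_group j (\<not> b)" "carry j (\<not> b) (carry j b k) = k"
proof -
  have t: "\<tau> j \<in> carrier P" by (rule \<tau>_closed)
  show "carry j b k \<in> edge_group j (\<not> b)"
  proof (cases b)
    case False
    then obtain h where "h \<in> K j" "k = \<tau> j \<otimes> h \<otimes> inv (\<tau> j)"
      using assms by (auto simp: edge_group_def conj_set_def)
    then show ?thesis using False conj_cancel(1)[OF t K_closed] by (simp add: carry_def edge_group_def)
  qed (use assms in \<open>auto simp: carry_def edge_group_def conj_set_def\<close>)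
  show "carry j (\<not> b) (carry j b k) = k"
    using conj_cancel[OF t edge_closed[OF assms]] by (simp add: carry_def)
qed

lemma carry_mult:
  assumes "k \<in> carrier P" "l \<in> carrier P"
  shows "carry j b (k \<otimes> l) = carry j b k \<otimes> carry j b l"
  using assms \<tau>_closed[of j] by (simp add: carry_def m_assoc mult_inv_cancel)

lemma cross_closed:
  assumes "x \<in> forms (side j b)"
  shows "cross j b x \<in> forms (side j (\<not> b))"
proof -
  obtain g ys where x: "x = (g, ys)" by (cases x)
  have g: "g \<in> side_group (side j b)" and ys: "tail_ok (side j b) ys" using assms by (auto simp: forms_def x)
  let ?r = "right_rep (edge_group j b) g"
  note r = right_rep[OF subgroup_edge[of j b] side_closed[OF g]]
  note k = carry(1)[OF r(2)]
  have k': "carry j b (g \<otimes> inv ?r) \<in> side_group (side j (\<not> b))" using k edge_subset by blast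
  show ?thesis
  proof (cases "?r = \<one> \<and> (\<exists>r' ys'. ys = (j, \<not> b, r') # ys')")
    case True
    then obtain r' ys' where "ys = (j, \<not> b, r') # ys'" by blast
    then show ?thesis
      using True ys k' subgroup.m_closed[OF subgroup_side k'] by (simp add: cross_def x forms_def)
  next
    case False
    let ?k = "g \<otimes> inv ?r"
    have c: "?r \<in> carrier P" "g \<in> carrier P" using r(1) side_closed[OF g] by auto
    have "?k \<in> side_group (side j b)" using r(2) edge_subset by blast
    then have "inv ?k \<otimes> g \<in> side_group (side j b)"
      using g subgroup.m_closed[OF subgroup_side] subgroup.m_inv_closed[OF subgroup_side] by blast
    moreover have "inv ?k \<otimes> g = ?r" using c by (simp add: inv_mult_group m_assoc)
    ultimately have "tail_ok (side j (\<not> b)) ((j, b, ?r) # ys)"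
      using ys False right_rep_rep[OF subgroup_edge side_closed[OF g]] by auto
    then show ?thesis using False k' unfolding cross_def x forms_def by (auto simp: Let_def)
  qed
qed

lemma cross_inverse:
  assumes "x \<in> forms (side j b)"
  shows "cross j (\<not> b) (cross j b x) = x"
proof -
  obtain g ys where x: "x = (g, ys)" by (cases x)
  have g: "g \<in> side_group (side j b)" and ys: "tail_ok (side j b) ys" using assms by (auto simp: forms_def x)
  let ?r = "right_rep (edge_group j b) g" let ?k = "g \<otimes> inv ?r"
  note r = right_rep[OF subgroup_edge[of j b] side_closed[OF g]]
  note k = carry[OF r(2)]
  have c: "?r \<in> carrier P" "g \<in> carrier P" "carry j b ?k \<in> carrier P"
    using r(1) side_closed[OF g] edge_closed[OF k(1)] by auto
  show ?thesis
  proof (cases "?r = \<one> \<and> (\<exists>r' ys'. ys = (j, \<not> b, r') # ys')")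
    case True
    then obtain r' ys' where y: "ys = (j, \<not> b, r') # ys'" by blast
    have r': "r' \<in> carrier P" "right_rep (edge_group j (\<not> b)) r' = r'"
        "\<not> (r' = \<one> \<and> (\<exists>r'' ys''. ys' = (j, b, r'') # ys''))"
      using ys y side_closed[of r'] by auto
    have "right_rep (edge_group j (\<not> b)) (carry j b ?k \<otimes> r') = r'"
      using right_rep_mult[OF subgroup_edge r'(1) k(1)] r'(2) by simp
    \<comment> \<open>The tail condition on \<open>r'\<close> and \<open>ys'\<close> rules out a
      second cancellation, so crossing back restores the removed edge.\<close>
    then have "cross j (\<not> b) (carry j b ?k \<otimes> r', ys') = (carry j (\<not> b) (carry j b ?k), ys)"
      using r' y c(3) unfolding cross_def by (auto simp: m_assoc)
    then show ?thesis using True y k(2) c by (simp add: cross_def x)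
  next
    case False
    have "right_rep (edge_group j (\<not> b)) (carry j b ?k) = \<one>" by (rule right_rep_H[OF subgroup_edge k(1)])
    then have "cross j (\<not> b) (carry j b ?k, (j, b, ?r) # ys) = (carry j (\<not> b) (carry j b ?k) \<otimes> ?r, ys)"
      using c(3) by (simp add: cross_def)
    also have "\<dots> = x" using k(2) c x by (simp add: m_assoc)
    finally have "cross j (\<not> b) (carry j b ?k, (j, b, ?r) # ys) = x" .
    moreover have "cross j b x = (carry j b ?k, (j, b, ?r) # ys)"
      unfolding cross_def x Let_def fst_conv snd_conv if_not_P[OF False] ..
    ultimately show ?thesis by simp
  qed
qed

text \<open>The rule e k = (carry k) e holds for the action because multiplying by \<open>k\<close>
  on the left does not change the representative of a right coset.\<close>

lemma cross_translate:
  assumes "x \<in> forms (side j b)" "k \<in> edge_group j b"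
  shows "cross j b (translate k x) = translate (carry j b k) (cross j b x)"
proof -
  obtain g ys where x: "x = (g, ys)" by (cases x)
  have g: "g \<in> side_group (side j b)" and ys: "tail_ok (side j b) ys" using assms by (auto simp: forms_def x)
  let ?r = "right_rep (edge_group j b) g"
  note r = right_rep[OF subgroup_edge[of j b] side_closed[OF g]]
  have c: "g \<in> carrier P" "k \<in> carrier P" "?r \<in> carrier P" "carry j b k \<in> carrier P"
      "carry j b (g \<otimes> inv ?r) \<in> carrier P"
    using side_closed[OF g] edge_closed[OF assms(2)] r(1) edge_closed[OF carry(1)[OF assms(2)]]
      edge_closed[OF carry(1)[OF r(2)]] by auto
  have "carry j b (k \<otimes> g \<otimes> inv ?r) = carry j b k \<otimes> carry j b (g \<otimes> inv ?r)"
    using carry_mult[of k "g \<otimes> inv ?r"] c by (simp add: m_assoc)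
  moreover have "right_rep (edge_group j b) (k \<otimes> g) = ?r"
    by (rule right_rep_mult[OF subgroup_edge c(1) assms(2)])
  moreover have "r' \<in> carrier P" if "ys = (j, \<not> b, r') # ys'" for r' ys'
    using ys that side_closed by auto
  ultimately show ?thesis
    using c unfolding cross_def x translate_def by (auto simp: Let_def m_assoc)
qed

lemma translate_closed: "a \<in> side_group s \<Longrightarrow> x \<in> forms s \<Longrightarrow> translate a x \<in> forms s"
  using subgroup.m_closed[OF subgroup_side] by (auto simp: forms_def translate_def)

lemma translate_mult:
  "a \<in> carrier P \<Longrightarrow> b \<in> carrier P \<Longrightarrow> x \<in> forms s \<Longrightarrow> translate (a \<otimes> b) x = translate a (translate b x)"
  using side_closed by (auto simp: forms_def translate_def m_assoc)

lemma translate_one: "x \<in> forms s \<Longrightarrow> translate \<one> x = x"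
  using side_closed by (auto simp: forms_def translate_def)

text \<open>Left multiplication by \<tau> i a (\<tau> j)^-1, expressed on forms. The middle factor
  acts as a translation at the base vertex.\<close>

definition excursion :: "'j \<Rightarrow> 'p \<Rightarrow> 'j \<Rightarrow> 'p \<times> ('j \<times> bool \<times> 'p) list \<Rightarrow> 'p \<times> ('j \<times> bool \<times> 'p) list" where
  "excursion i a j x = cross i True (translate a (cross j False x))"

lemma excursion_closed:
  assumes "vertex i = vertex j" "a \<in> A (vertex i)" "x \<in> forms None"
  shows "excursion i a j x \<in> forms None"
proof -
  have "cross j False x \<in> forms (side i True)" using cross_closed[of x j False] assms by simp
  then have "translate a (cross j False x) \<in> forms (side i True)"
    using assms(2) by (intro translate_closed) auto
  from cross_closed[OF this] show ?thesis by (simp add: excursion_def)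
qed

lemma excursion_mult:
  assumes "vertex i = vertex j" "vertex j = vertex l" "a \<in> A (vertex i)" "b \<in> A (vertex i)" "x \<in> forms None"
  shows "excursion i a j (excursion j b l x) = excursion i (a \<otimes> b) l x"
proof -
  have x: "cross l False x \<in> forms (side j True)" using cross_closed[of x l False] assms by simp
  have "translate b (cross l False x) \<in> forms (side j True)"
    using assms x by (intro translate_closed) auto
  from cross_inverse[OF this]
  have "cross j False (excursion j b l x) = translate b (cross l False x)" by (simp add: excursion_def)
  then show ?thesis
    using translate_mult[OF _ _ x] A_closed assms by (simp add: excursion_def)
qed

lemma excursion_one:
  assumes "x \<in> forms None"
  shows "excursion j \<one> j x = x"
  using cross_closed[of x j False] cross_inverse[of x j False] assms
  by (simp add: excursion_def translate_one[of _ "side j True"])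

text \<open>Elements of an edge group act through \<open>Q\<close>. The relations of an amalgamated
  product or an HNN-extension compare such elements, and this is why the action on forms respects
  them.\<close>

lemma excursion_K:
  assumes "x \<in> forms None" "k \<in> K j"
  shows "excursion j k j x = translate (\<tau> j \<otimes> k \<otimes> inv (\<tau> j)) x"
  using cross_translate[of "cross j False x" j True k] cross_closed[of x j False]
    cross_inverse[of x j False] assms
  by (simp add: excursion_def edge_group_def carry_def)

lemma stack_value_closed: "reduced q st \<Longrightarrow> stack_value q st \<in> carrier P"
  by (induction q st rule: reduced.induct) (auto simp: Q_closed A_closed \<tau>_closed)

text \<open>A reduced stack acts without cancellation, so each excursion lengthens the form by two
  edges. The rightmost excursion acts first; the last premise says that it does not backtrack into
  the form \<open>x\<close>.\<close>

lemma reduced_length: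
  assumes mult: "\<And>p p' x. p \<in> carrier P \<Longrightarrow> p' \<in> carrier P \<Longrightarrow> x \<in> forms None \<Longrightarrow>
      \<alpha> (p \<otimes> p') x = \<alpha> p (\<alpha> p' x)"
    and Q: "\<And>q x. q \<in> Q \<Longrightarrow> x \<in> forms None \<Longrightarrow> \<alpha> q x = translate q x"
    and exc: "\<And>i j a x. vertex i = vertex j \<Longrightarrow> a \<in> A (vertex i) \<Longrightarrow> x \<in> forms None \<Longrightarrow>
      \<alpha> (\<tau> i \<otimes> a \<otimes> inv (\<tau> j)) x = excursion i a j x"
  shows "reduced q st \<Longrightarrow> x \<in> forms None \<Longrightarrow>
    (case st of [] \<Rightarrow> True | (_, _, _, j) # _ \<Rightarrow>
      \<not> (q \<otimes> fst x \<in> edge_group j False \<and> (\<exists>r ys. snd x = (j, True, r) # ys))) \<Longrightarrow>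
    length (snd x) + 2 * length st \<le> length (snd (\<alpha> (stack_value q st) x))"
proof (induction st arbitrary: q x)
  case Nil
  then show ?case using Q by (simp add: translate_def)
next
  case (Cons e st)
  obtain p i a j where e: "e = (p, i, a, j)" by (cases e)
  obtain g ys where x: "x = (g, ys)" by (cases x)
  have q: "q \<in> Q" and p: "reduced p st" and ij: "vertex i = vertex j" and a: "a \<in> A (vertex i)"
    and na: "\<not> (i = j \<and> a \<in> K i)"
    and join: "case st of [] \<Rightarrow> True | (_, _, _, l) # _ \<Rightarrow> \<not> (l = i \<and> p \<in> edge_group i False)"
    using Cons.prems(1) by (auto simp: e edge_group_def split: list.splits)
  have p': "p \<in> carrier P" using p by (cases st) (auto simp: Q_closed)
  let ?y = "translate q x"
  have y: "?y \<in> forms None" using q Cons.prems(2) by (intro translate_closed) auto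
  let ?r = "right_rep (edge_group j False) (q \<otimes> g)"
  have qg: "q \<otimes> g \<in> carrier P" using y side_closed[of _ None] by (auto simp: forms_def translate_def x)
  \<comment> \<open>The first crossing cannot cancel: a trivial representative would put q g into
    the edge group, against the premise on \<open>x\<close>.\<close>
  have "\<not> (?r = \<one> \<and> (\<exists>r ys'. ys = (j, True, r) # ys'))"
    using Cons.prems(3) right_rep_eq_one[OF subgroup_edge qg] by (auto simp: e x)
  then have z: "cross j False ?y = (carry j False (q \<otimes> g \<otimes> inv ?r), (j, False, ?r) # ys)"
    by (auto simp: cross_def translate_def x Let_def)
  let ?k = "carry j False (q \<otimes> g \<otimes> inv ?r)"
  have k: "?k \<in> K j"
    using carry(1)[OF right_rep(2)[OF subgroup_edge[of j False] qg]] by (simp add: edge_group_def)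
  let ?s = "right_rep (edge_group i True) (a \<otimes> ?k)"
  have ak: "a \<otimes> ?k \<in> carrier P" using A_closed[OF a] K_closed[OF k] by simp
  \<comment> \<open>The second crossing cannot cancel the edge just added: \<open>a\<close> would
    lie in \<open>K i\<close>, since \<open>?k\<close> does.\<close>
  have "\<not> (?s = \<one> \<and> i = j)"
  proof
    assume s: "?s = \<one> \<and> i = j"
    have "edge_group i True = K i" by (simp add: edge_group_def)
    then have "a \<otimes> ?k \<in> K i" using right_rep_eq_one[OF subgroup_edge[of i True] ak conjunct1[OF s]] by blast
    then have "a \<otimes> ?k \<otimes> inv ?k \<in> K i"
      using k s subgroup.m_closed[OF subgroup_K] subgroup.m_inv_closed[OF subgroup_K] by blast
    then have "a \<in> K i" using A_closed[OF a] K_closed[OF k] by (simp add: m_assoc)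
    then show False using na s by blast
  qed
  then have w: "excursion i a j ?y
      = (carry i True (a \<otimes> ?k \<otimes> inv ?s), (i, True, ?s) # (j, False, ?r) # ys)"
    unfolding excursion_def z by (auto simp: cross_def translate_def Let_def)
  let ?l = "carry i True (a \<otimes> ?k \<otimes> inv ?s)"
  have l: "?l \<in> edge_group i False"
    using carry(1)[OF right_rep(2)[OF subgroup_edge[of i True] ak]] by simp
  have W: "excursion i a j ?y \<in> forms None" by (rule excursion_closed[OF ij a y])
  \<comment> \<open>The premise for the next excursion. As \<open>?l\<close> lies in the edge group,
    multiplying by it does not change whether \<open>p\<close> does.\<close>
  have "case st of [] \<Rightarrow> True | (_, _, _, l') # _ \<Rightarrow>
      \<not> (p \<otimes> ?l \<in> edge_group l' False \<and> l' = i)"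
  proof (cases st)
    case (Cons e' st')
    have "p \<in> edge_group i False" if "p \<otimes> ?l \<in> edge_group i False"
    proof -
      have "p \<otimes> ?l \<otimes> inv ?l \<in> edge_group i False"
        using that l subgroup.m_closed[OF subgroup_edge] subgroup.m_inv_closed[OF subgroup_edge] by blast
      then show ?thesis using p' edge_closed[OF l] by (simp add: m_assoc)
    qed
    then show ?thesis using join Cons by (auto split: prod.splits)
  qed simp
  then have "case st of [] \<Rightarrow> True | (_, _, _, l') # _ \<Rightarrow>
      \<not> (p \<otimes> fst (excursion i a j ?y) \<in> edge_group l' False
        \<and> (\<exists>r ys'. snd (excursion i a j ?y) = (l', True, r) # ys'))"
    unfolding w by (auto split: list.splits)
  from Cons.IH[OF p W this]
  have "length ys + 2 * length (e # st) \<le> length (snd (\<alpha> (stack_value p st) (excursion i a j ?y)))"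
    unfolding w by simp
  also have "\<alpha> (stack_value p st) (excursion i a j ?y) = \<alpha> (stack_value q (e # st)) x"
  proof -
    have c: "stack_value p st \<in> carrier P" "\<tau> i \<otimes> a \<otimes> inv (\<tau> j) \<in> carrier P" "q \<in> carrier P"
      using stack_value_closed[OF p] \<tau>_closed A_closed[OF a] Q_closed[OF q] by auto
    show ?thesis
      using mult[OF m_closed[OF c(1,2)] c(3) Cons.prems(2)] mult[OF c(1,2) y]
        Q[OF q Cons.prems(2)] exc[OF ij a y] by (simp add: e)
  qed
  finally show ?case by (simp add: x)
qed

text \<open>On the form of \<one>, a non-empty reduced stack produces a form with edges, whereas
  \<one> acts trivially.\<close>

theorem normal_form:
  assumes mult: "\<And>p p' x. p \<in> carrier P \<Longrightarrow> p' \<in> carrier P \<Longrightarrow> x \<in> forms None \<Longrightarrow>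
      \<alpha> (p \<otimes> p') x = \<alpha> p (\<alpha> p' x)"
    and Q: "\<And>q x. q \<in> Q \<Longrightarrow> x \<in> forms None \<Longrightarrow> \<alpha> q x = translate q x"
    and exc: "\<And>i j a x. vertex i = vertex j \<Longrightarrow> a \<in> A (vertex i) \<Longrightarrow> x \<in> forms None \<Longrightarrow>
      \<alpha> (\<tau> i \<otimes> a \<otimes> inv (\<tau> j)) x = excursion i a j x"
  shows has_normal_forms
  unfolding has_normal_forms_def
proof (intro allI impI)
  fix q st assume st: "reduced q st" "stack_value q st = \<one>"
  have x: "(\<one>, []) \<in> forms None" using subgroup.one_closed[OF subgroup_Q] by (simp add: forms_def)
  have "length (snd (\<one> :: 'p, [] :: ('j \<times> bool \<times> 'p) list)) + 2 * length st
      \<le> length (snd (\<alpha> (stack_value q st) (\<one>, [])))"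
    by (rule reduced_length[OF assms st(1) x]) (auto split: list.splits)
  moreover have "\<alpha> \<one> (\<one>, []) = (\<one>, [])"
    using Q[OF subgroup.one_closed[OF subgroup_Q] x] by (simp add: translate_def)
  ultimately show "st = []" using st(2) by simp
qed

end

context gluing
begin

text \<open>Both sides are actions of \<open>Q\<close>, so agreement on generators suffices. For an
  inverse, \<open>x\<close> is first written as the translate by h of its translate by h^-1.\<close>

lemma generated_translate:
  assumes mult: "\<And>p p' x. p \<in> carrier P \<Longrightarrow> p' \<in> carrier P \<Longrightarrow> x \<in> forms None \<Longrightarrow>
      \<alpha> (p \<otimes> p') x = \<alpha> p (\<alpha> p' x)"
    and one: "\<And>x. x \<in> forms None \<Longrightarrow> \<alpha> \<one> x = x"
    and Q: "Q = generate P X"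
    and X: "\<And>h x. h \<in> X \<Longrightarrow> x \<in> forms None \<Longrightarrow> \<alpha> h x = translate h x"
    and q: "q \<in> Q" and x: "x \<in> forms None"
  shows "\<alpha> q x = translate q x"
proof -
  have closed: "translate q x \<in> forms None" if "q \<in> Q" "x \<in> forms None" for q x
    using that by (intro translate_closed) auto
  have "q \<in> generate P X" using q Q by simp
  then show ?thesis
    using x
  proof (induction arbitrary: x rule: generate.induct)
    case one
    then show ?case using assms(2) translate_one by simp
  next
    case (incl h)
    then show ?case using X by simp
  next
    case (inv h)
    have h: "h \<in> Q" "inv h \<in> Q" using inv(1) Q generate.incl generate.inv by auto
    have y: "translate (inv h) x \<in> forms None" by (rule closed[OF h(2) inv(2)])
    have "\<alpha> (inv h) x = \<alpha> (inv h) (translate h (translate (inv h) x))"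
      using translate_mult[OF Q_closed[OF h(1)] Q_closed[OF h(2)] inv(2)] translate_one[OF inv(2)]
        Q_closed[OF h(1)] by simp
    also have "\<dots> = \<alpha> (inv h \<otimes> h) (translate (inv h) x)"
      using X[OF inv(1) y] mult[OF Q_closed[OF h(2)] Q_closed[OF h(1)] y] by simp
    also have "\<dots> = translate (inv h) x" using assms(2)[OF y] Q_closed[OF h(1)] by simp
    finally show ?case .
  next
    case (eng h1 h2)
    have h: "h1 \<in> Q" "h2 \<in> Q" using eng(1,2) Q by auto
    have "\<alpha> (h1 \<otimes> h2) x = \<alpha> h1 (\<alpha> h2 x)" using mult Q_closed h eng.prems by blast
    also have "\<dots> = translate h1 (translate h2 x)"
      using eng.IH(2)[OF eng.prems] eng.IH(1)[OF closed[OF h(2) eng.prems]] by simp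
    finally show ?case using translate_mult[OF Q_closed[OF h(1)] Q_closed[OF h(2)] eng.prems] by simp
  qed
qed

end

section \<open>Consequences of normal forms for intersections\<close>

locale gluing_normal = gluing +
  assumes normal: has_normal_forms
begin

lemma stack_normal: "reduced q st \<Longrightarrow> stack_value q st = \<one> \<Longrightarrow> st = []"
  using normal by (simp add: has_normal_forms_def)

lemma one_Q: "\<one> \<in> Q"
  by (rule subgroup.one_closed[OF subgroup_Q])

text \<open>Otherwise the excursion through \<open>a\<close>, followed by a^-1 in \<open>Q\<close>,
  would be a non-empty reduced form of \<one>.\<close>

lemma Q_inter_A:
  assumes "a \<in> Q" "a \<in> A v"
  shows "a \<in> K (root v)"
proof (rule ccontr)
  assume "a \<notin> K (root v)"
  then have "reduced (inv a) [(\<one>, root v, a, root v)]"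
    using assms one_Q subgroup.m_inv_closed[OF subgroup_Q] by (simp add: vertex_root)
  moreover have "stack_value (inv a) [(\<one>, root v, a, root v)] = \<one>"
    using Q_closed[OF assms(1)] by (simp add: \<tau>_root)
  ultimately show False using stack_normal by blast
qed

lemma K_root_Q: "K (root v) \<subseteq> Q"
  using conj_K_Q[of _ "root v"] K_closed[of _ "root v"] by (auto simp: \<tau>_root)

text \<open>Excursions through \<open>a\<close> in one base group and a^-1 in the other would form a
  non-empty reduced stack of value \<one>.\<close>

lemma A_inter_A:
  assumes "u \<noteq> v" "a \<in> A u" "a \<in> A v"
  shows "a \<in> K (root u)"
proof (rule ccontr)
  assume n: "a \<notin> K (root u)"
  have "inv a \<notin> K (root v)"
  proof
    assume "inv a \<in> K (root v)"
    then have "inv (inv a) \<in> Q" using K_root_Q[of v] subgroup.m_inv_closed[OF subgroup_Q] by blast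
    then have "a \<in> Q" using A_closed[OF assms(2)] by simp
    then show False using Q_inter_A assms(2) n by blast
  qed
  moreover have "root u \<noteq> root v" using assms(1) vertex_root by metis
  ultimately have "reduced \<one> [(\<one>, root v, inv a, root v), (\<one>, root u, a, root u)]"
    using n assms one_Q subgroup.m_inv_closed[OF subgroup_A] by (simp add: vertex_root)
  moreover have "stack_value \<one> [(\<one>, root v, inv a, root v), (\<one>, root u, a, root u)] = \<one>"
    using A_closed[OF assms(2)] by (simp add: \<tau>_root)
  ultimately show False using stack_normal by blast
qed

text \<open>Guarantees that \<open>Gen (\<tau> j)\<close> is not also a generator letter of a base
  group. In each case the forbidden reduced form of \<one> has an excursion that enters along
  \<open>j\<close> and leaves along the root edge.\<close>

lemma \<tau>_notin_A:
  assumes j: "j \<noteq> root (vertex j)"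
  shows "\<tau> j \<notin> A v"
proof
  assume t: "\<tau> j \<in> A v"
  note it = subgroup.m_inv_closed[OF subgroup_A t]
  show False
  proof (cases "v = vertex j")
    case True
    then have "reduced \<one> [(\<one>, j, inv (\<tau> j), root (vertex j))]"
      using j one_Q it by (simp add: vertex_root)
    moreover have "stack_value \<one> [(\<one>, j, inv (\<tau> j), root (vertex j))] = \<one>"
      using \<tau>_closed[of j] by (simp add: \<tau>_root)
    ultimately show False using stack_normal by blast
  next
    case False
    have one: "\<one> \<in> A (vertex j)" by (rule subgroup.one_closed[OF subgroup_A])
    have "inv (\<tau> j) \<notin> K (root v)"
    proof
      assume "inv (\<tau> j) \<in> K (root v)"
      then have "inv (\<tau> j) \<in> Q" using K_root_Q by blast
      then have "reduced (inv (\<tau> j)) [(\<one>, j, \<one>, root (vertex j))]"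
        using j one_Q one by (simp add: vertex_root)
      moreover have "stack_value (inv (\<tau> j)) [(\<one>, j, \<one>, root (vertex j))] = \<one>"
        using \<tau>_closed[of j] by (simp add: \<tau>_root)
      ultimately show False using stack_normal by blast
    qed
    moreover have "root (vertex j) \<noteq> root v" using False vertex_root by metis
    ultimately have "reduced \<one> [(\<one>, root v, inv (\<tau> j), root v), (\<one>, j, \<one>, root (vertex j))]"
      using j one_Q one it by (simp add: vertex_root)
    moreover have "stack_value \<one> [(\<one>, root v, inv (\<tau> j), root v), (\<one>, j, \<one>, root (vertex j))] = \<one>"
      using \<tau>_closed[of j] by (simp add: \<tau>_root)
    ultimately show False using stack_normal by blast
  qed
qed

end

section \<open>The upper bound\<close>

context gluing
begin

lemma reduced_Q: "reduced q st \<Longrightarrow> q \<in> Q"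
  by (cases st) auto

lemma reduced_change_top: "reduced q st \<Longrightarrow> p \<in> Q \<Longrightarrow> reduced p st"
  by (cases st) auto

end

text \<open>Letters carry elements and subgroups of \<open>P\<close>, so letters of two base groups
  might coincide. The disjointness assumptions on \<open>S\<close> and \<open>\<H>\<close> ensure
  that a generator or a peripheral subgroup determines its base group, and injectivity of
  \<open>K\<close> and \<open>\<tau>\<close> does the same for edges.\<close>

locale gluing_presented = gluing_normal P Q vertex root A K \<tau>
  for P :: "'p monoid" (structure) and Q and vertex :: "'j::finite \<Rightarrow> 'v::finite" and root A K \<tau> +
  fixes S :: "'v \<Rightarrow> 'p set" and \<H> :: "'v \<Rightarrow> 'p set set"
    and T :: "'v \<Rightarrow> 'p rel_letter list set" and f :: "'v \<Rightarrow> nat \<Rightarrow> nat"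
  assumes base_presentation:
      "subgroup_presentation P (A v) (\<H> v \<union> K ` {j. vertex j = v}) (S v) (T v) (f v)"
    and K_inj: "vertex i = vertex j \<Longrightarrow> K i = K j \<Longrightarrow> i = j"
    and K_notin: "K j \<notin> \<H> (vertex j)"
    and \<H>_disjoint: "H \<in> \<H> u \<Longrightarrow> H \<in> \<H> v \<Longrightarrow> u = v"
    and S_disjoint: "s \<in> S u \<Longrightarrow> s \<in> S v \<Longrightarrow> u = v"
    and \<tau>_inj: "i \<noteq> root (vertex i) \<Longrightarrow> j \<noteq> root (vertex j) \<Longrightarrow> \<tau> i = \<tau> j \<Longrightarrow> i = j"
    and P_generated: "carrier P \<subseteq> generate P ((\<Union>v. A v) \<union> range \<tau> \<union> Q)"
begin

section \<open>The presentation of the whole group\<close>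

abbreviation base_collection :: "'v \<Rightarrow> 'p set set" where
  "base_collection v \<equiv> \<H> v \<union> K ` {j. vertex j = v}"

abbreviation base_alphabet :: "'v \<Rightarrow> 'p rel_letter set" where
  "base_alphabet v \<equiv> rel_alphabet (S v) (base_collection v)"

abbreviation base_rels :: "'v \<Rightarrow> ('p rel_letter list \<times> 'p rel_letter list) set" where
  "base_rels v \<equiv> rel_free_rels P (S v) (base_collection v)"

lemma
  shows base_group_pair: "group_pair P (base_collection v)"
    and \<H>_subset: "H \<in> \<H> v \<Longrightarrow> H \<subseteq> A v"
    and S_subset: "S v \<subseteq> A v" and S_finite: "finite (S v)" and T_finite: "finite (T v)"
    and T_words: "T v \<subseteq> {w \<in> lists (base_alphabet v). word_value P w = \<one>}"
    and A_words: "A v \<subseteq> word_value P ` lists (base_alphabet v)"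
    and A_area: "area_bound P (base_collection v) (S v) (T v) (f v)"
  using base_presentation[of v] by (auto simp: subgroup_presentation_def)

lemma \<H>_subgroup: "H \<in> \<H> v \<Longrightarrow> subgroup H P" and \<H>_finite: "finite (\<H> v)"
  using base_group_pair[of v] by (auto simp: group_pair_def)

text \<open>Letters of \<open>Q\<close> must not be mistaken for letters of a base group. As a
  peripheral subgroup there, \<open>Q\<close> would equal the edge group of the root edge, which is
  excluded from \<open>\<H>\<close>.\<close>

lemma Q_notin: "Q \<notin> \<H> v"
proof
  assume Q: "Q \<in> \<H> v"
  then have "Q \<subseteq> K (root v)" using Q_inter_A \<H>_subset by blast
  then have "Q = K (root v)" using K_root_Q by blast
  then show False using Q K_notin[of "root v"] by (simp add: vertex_root)
qed

lemma \<tau>_notin: "j \<noteq> root (vertex j) \<Longrightarrow> \<tau> j \<notin> S v"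
  using \<tau>_notin_A S_subset by blast

definition gens :: "'p set" where
  "gens = (\<Union>v. S v) \<union> \<tau> ` {j. j \<noteq> root (vertex j)}"

definition collection :: "'p set set" where
  "collection = (\<Union>v. \<H> v) \<union> {Q}"

abbreviation alphabet :: "'p rel_letter set" where
  "alphabet \<equiv> rel_alphabet gens collection"

abbreviation rels :: "('p rel_letter list \<times> 'p rel_letter list) set" where
  "rels \<equiv> rel_free_rels P gens collection"

definition up :: "'j \<Rightarrow> 'p rel_letter list" where
  "up j = (if j = root (vertex j) then [] else [Gen (\<tau> j)])"

definition down :: "'j \<Rightarrow> 'p rel_letter list" where
  "down j = (if j = root (vertex j) then [] else [GenInv (\<tau> j)])"

definition edge_of :: "'v \<Rightarrow> 'p set \<Rightarrow> 'j" where
  "edge_of v X = (THE j. vertex j = v \<and> K j = X)"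

text \<open>A letter k of \<open>K j\<close> becomes (\<tau> j)^-1 q \<tau> j with q = \<tau> j k
  (\<tau> j)^-1 a single letter of \<open>Q\<close>; all other letters are kept.\<close>

fun emb :: "'v \<Rightarrow> 'p rel_letter \<Rightarrow> 'p rel_letter list" where
  "emb v (Per X x) = (if X \<in> \<H> v then [Per X x] else
     (let j = edge_of v X in down j @ [Per Q (\<tau> j \<otimes> x \<otimes> inv (\<tau> j))] @ up j))"
| "emb v l = [l]"

text \<open>The relators of the base groups suffice: relations inside \<open>Q\<close> already hold
  in the free product, and the gluing of \<open>K j\<close> to its conjugate in \<open>Q\<close> is
  built into \<open>emb\<close>.\<close>

definition relators :: "'p rel_letter list set" where
  "relators = (\<Union>v. subst (emb v) ` T v)"

lemma edge_of: "edge_of (vertex j) (K j) = j"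
  unfolding edge_of_def using K_inj by (intro the_equality) auto

lemma emb_K:
  "emb (vertex j) (Per (K j) k) = down j @ [Per Q (\<tau> j \<otimes> k \<otimes> inv (\<tau> j))] @ up j"
  by (simp add: K_notin edge_of)

lemma base_letter_cases:
  assumes "l \<in> base_alphabet v"
  obtains s where "s \<in> S v" "l = Gen s" | s where "s \<in> S v" "l = GenInv s"
  | H h where "H \<in> \<H> v" "h \<in> H" "l = Per H h"
  | j k where "vertex j = v" "k \<in> K j" "l = Per (K j) k"
  using assms unfolding rel_alphabet_def by blast

lemma group_pair: "group_pair P collection"
  using \<H>_subgroup \<H>_finite subgroup_Q is_group by (auto simp: group_pair_def collection_def)

lemma S_closed: "S v \<subseteq> carrier P"
  using S_subset[of v] A_closed[of _ v] by blast

lemma gens_closed: "gens \<subseteq> carrier P"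
  using S_closed \<tau>_closed by (auto simp: gens_def)

lemma gens_finite: "finite gens"
  using S_finite by (auto simp: gens_def)

lemma relators_finite: "finite relators"
  using T_finite by (auto simp: relators_def)

lemma up_down: "word_eq rels (up j @ down j) []" "word_eq rels (down j @ up j) []"
  by (auto simp: up_def down_def gens_def rel_free_rels_def intro!: word_eq.refl word_eq_base)

lemma table_in_rels: "H \<in> collection \<Longrightarrow> table_rels P H (Per H) \<subseteq> rels"
  by (auto simp: rel_free_rels_def)

lemma Q_collection: "Q \<in> collection" and \<H>_collection: "H \<in> \<H> v \<Longrightarrow> H \<in> collection"
  by (auto simp: collection_def)

lemma Q_letters:
  "word_eq rels [Per Q \<one>] []"
  "x \<in> Q \<Longrightarrow> y \<in> Q \<Longrightarrow> word_eq rels [Per Q x, Per Q y] [Per Q (x \<otimes> y)]"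
  using word_eq_table[OF table_in_rels[OF Q_collection]] by auto

lemma up_lists: "up j \<in> lists alphabet" "down j \<in> lists alphabet"
  by (auto simp: up_def down_def gens_def rel_alphabet_iff)

lemma up_value: "word_value P (up j) = \<tau> j" "word_value P (down j) = inv (\<tau> j)"
  using \<tau>_root[of "vertex j"] \<tau>_closed[of j] by (auto simp: up_def down_def)

lemma value_append:
  "u \<in> lists alphabet \<Longrightarrow> v \<in> lists alphabet \<Longrightarrow> word_value P (u @ v) = word_value P u \<otimes> word_value P v"
  by (rule word_value_append[OF group_pair gens_closed])

lemma value_closed: "u \<in> lists alphabet \<Longrightarrow> word_value P u \<in> carrier P"
  by (rule word_value_closed[OF group_pair gens_closed])

lemma base_value_append:
  "x \<in> lists (base_alphabet v) \<Longrightarrow> y \<in> lists (base_alphabet v) \<Longrightarrow>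
    word_value P (x @ y) = word_value P x \<otimes> word_value P y"
  by (rule word_value_append[OF base_group_pair S_closed])

lemma emb_lists:
  assumes "l \<in> base_alphabet v"
  shows "emb v l \<in> lists alphabet"
  using assms
proof (cases rule: base_letter_cases)
  case (4 j k)
  have "down j @ [Per Q (\<tau> j \<otimes> k \<otimes> inv (\<tau> j))] @ up j \<in> lists alphabet"
    using up_lists[of j] conj_K_Q[OF 4(2)] by (simp add: rel_alphabet_iff Q_collection)
  then show ?thesis unfolding 4(3) 4(1)[symmetric] emb_K .
qed (auto simp: rel_alphabet_iff gens_def \<H>_collection)

lemma conj_inverse:
  "t \<in> carrier P \<Longrightarrow> k \<in> carrier P \<Longrightarrow> inv t \<otimes> (t \<otimes> k \<otimes> inv t) \<otimes> t = k"
  by (simp add: m_assoc inv_solve_left')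

lemma conj_mult:
  "t \<in> carrier P \<Longrightarrow> x \<in> carrier P \<Longrightarrow> y \<in> carrier P \<Longrightarrow>
    (t \<otimes> x \<otimes> inv t) \<otimes> (t \<otimes> y \<otimes> inv t) = t \<otimes> (x \<otimes> y) \<otimes> inv t"
  by (simp add: m_assoc inv_solve_left')

lemma emb_value:
  assumes "l \<in> base_alphabet v"
  shows "word_value P (emb v l) = letter_value P l"
  using assms
proof (cases rule: base_letter_cases)
  case (4 j k)
  have "word_value P (emb v l) = inv (\<tau> j) \<otimes> ((\<tau> j \<otimes> k \<otimes> inv (\<tau> j)) \<otimes> \<tau> j)"
    unfolding 4(3) 4(1)[symmetric] emb_K
    using up_lists conj_K_Q[OF 4(2)] Q_closed
    by (subst value_append; (subst value_append)?)
      (auto simp: rel_alphabet_iff Q_collection up_value)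
  then show ?thesis
    using conj_inverse[OF \<tau>_closed K_closed[OF 4(2)], of j] K_closed[OF 4(2)] \<tau>_closed[of j] 4(3)
    by (simp add: m_assoc)
qed (use S_closed[of v] subgroup.mem_carrier[OF \<H>_subgroup] in auto)

lemma emb_word_value: "w \<in> lists (base_alphabet v) \<Longrightarrow> word_value P (subst (emb v) w) = word_value P w"
  by (rule subst_value[OF group_pair gens_closed emb_lists emb_value])

lemma emb_word_lists: "w \<in> lists (base_alphabet v) \<Longrightarrow> subst (emb v) w \<in> lists alphabet"
  by (rule subst_lists[OF emb_lists])

lemma relators_words: "relators \<subseteq> {w \<in> lists alphabet. word_value P w = \<one>}"
  using emb_word_lists emb_word_value T_words by (fastforce simp: relators_def)

lemma base_word_value_A: "w \<in> lists (base_alphabet v) \<Longrightarrow> word_value P w \<in> A v"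
proof (induction w)
  case (Cons l w)
  then have "l \<in> base_alphabet v" by simp
  then have "letter_value P l \<in> A v"
    using S_subset[of v] \<H>_subset[of _ v] K_subset subgroup.m_inv_closed[OF subgroup_A]
    by (cases rule: base_letter_cases) auto
  then show ?case using Cons subgroup.m_closed[OF subgroup_A] by simp
qed (simp add: subgroup.one_closed[OF subgroup_A])

text \<open>Conjugation by \<tau> j carries the multiplication table of \<open>K j\<close> into that
  of \<open>Q\<close>, so the rewriting respects free equality and costs no relators.\<close>

lemma emb_rels:
  assumes "(u, w) \<in> base_rels v"
  shows "word_eq rels (subst (emb v) u) (subst (emb v) w)"
proof -
  consider s where "s \<in> S v" "(u, w) \<in> {([Gen s, GenInv s], []), ([GenInv s, Gen s], [])}"
    | H where "H \<in> \<H> v" "(u, w) \<in> table_rels P H (Per H)"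
    | j where "vertex j = v" "(u, w) \<in> table_rels P (K j) (Per (K j))"
    using assms unfolding rel_free_rels_def by blast
  then show ?thesis
  proof cases
    case 1
    then show ?thesis by (auto intro!: word_eq_base simp: rel_free_rels_def gens_def)
  next
    case 2
    then have "subst (emb v) u = u" "subst (emb v) w = w" by (auto simp: table_rels_def)
    moreover have "(u, w) \<in> rels" using 2 table_in_rels[OF \<H>_collection] by blast
    ultimately show ?thesis by (simp add: word_eq_base)
  next
    case 3
    let ?c = "\<lambda>k. \<tau> j \<otimes> k \<otimes> inv (\<tau> j)"
    from 3(2) consider "u = [Per (K j) \<one>]" "w = []"
      | x y where "x \<in> K j" "y \<in> K j" "u = [Per (K j) x, Per (K j) y]" "w = [Per (K j) (x \<otimes> y)]"
      by (auto simp: table_rels_def)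
    then show ?thesis
    proof cases
      case 1
      have "word_eq rels (down j @ [Per Q \<one>] @ up j) (down j @ [] @ up j)"
        by (rule word_eq_context[OF Q_letters(1)])
      then have "word_eq rels (down j @ [Per Q \<one>] @ up j) []"
        using up_down(2)[of j] word_eq.trans by auto
      then show ?thesis using 1 3(1) \<tau>_closed[of j] by (auto simp: emb_K simp del: emb.simps(1))
    next
      case 2
      have "word_eq rels ((down j @ [Per Q (?c x)]) @ (up j @ down j) @ ([Per Q (?c y)] @ up j))
          ((down j @ [Per Q (?c x)]) @ [] @ ([Per Q (?c y)] @ up j))"
        by (rule word_eq_context[OF up_down(1)])
      moreover have "word_eq rels (down j @ [Per Q (?c x), Per Q (?c y)] @ up j)
          (down j @ [Per Q (?c x \<otimes> ?c y)] @ up j)"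
        by (intro word_eq_context Q_letters(2) conj_K_Q 2)
      ultimately have "word_eq rels
          (down j @ [Per Q (?c x)] @ up j @ down j @ [Per Q (?c y)] @ up j)
          (down j @ [Per Q (?c (x \<otimes> y))] @ up j)"
        using word_eq.trans conj_mult[OF \<tau>_closed K_closed K_closed, OF 2(1,2)] by auto
      then show ?thesis using 2(3,4) 3(1) by (auto simp: emb_K simp del: emb.simps(1))
    qed
  qed
qed

lemma emb_der:
  assumes "der (base_rels v) (T v) k u w"
  shows "der rels relators k (subst (emb v) u) (subst (emb v) w)"
proof -
  have "der rels relators (1 * k) (subst (emb v) u) (subst (emb v) w)"
  proof (rule der_map[OF emb_rels _ assms])
    fix r assume "r \<in> T v"
    then have "subst (emb v) r \<in> relators" by (auto simp: relators_def)
    from der.rel[OF this, of rels 0 "[]" "[]"]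
    show "der rels relators 1 (subst (emb v) r) []" by simp
  qed
  then show ?thesis by simp
qed

text \<open>Excursions hold words instead of elements of a base group, because the cost of closing
  an excursion depends on the length of its word.\<close>

fun flat :: "'p \<Rightarrow> ('p \<times> 'j \<times> 'p rel_letter list \<times> 'j) list \<Rightarrow> 'p rel_letter list" where
  "flat q [] = [Per Q q]"
| "flat q ((p, i, u, j) # st) = flat p st @ up i @ subst (emb (vertex i)) u @ down j @ [Per Q q]"

abbreviation vals :: "('p \<times> 'j \<times> 'p rel_letter list \<times> 'j) list \<Rightarrow> ('p \<times> 'j \<times> 'p \<times> 'j) list" where
  "vals \<equiv> map (\<lambda>(p, i, u, j). (p, i, word_value P u, j))"

definition reduced_stack :: "'p \<Rightarrow> ('p \<times> 'j \<times> 'p rel_letter list \<times> 'j) list \<Rightarrow> bool" where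
  "reduced_stack q st \<longleftrightarrow> reduced q (vals st) \<and>
     (\<forall>(p, i, u, j)\<in>set st. u \<in> lists (base_alphabet (vertex i)))"

text \<open>The additional unit of each excursion provides for one edge letter: the one inserted
  when it merges with the next excursion, or the one appended when it is closed.\<close>

abbreviation weight :: "('p \<times> 'j \<times> 'p rel_letter list \<times> 'j) list \<Rightarrow> nat" where
  "weight st \<equiv> sum_list (map (\<lambda>(p, i, u, j). Suc (length u)) st)"

lemma flat_value:
  "reduced_stack q st \<Longrightarrow> flat q st \<in> lists alphabet \<and> word_value P (flat q st) = stack_value q (vals st)"
proof (induction st arbitrary: q)
  case Nil
  then show ?case using Q_closed by (auto simp: reduced_stack_def rel_alphabet_iff Q_collection)
next
  case (Cons e st)
  obtain p i u j where e: "e = (p, i, u, j)" by (cases e)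
  have q: "q \<in> Q" and p: "reduced_stack p st" and u: "u \<in> lists (base_alphabet (vertex i))"
    using Cons.prems by (auto simp: reduced_stack_def e)
  note IH = Cons.IH[OF p]
  have m: "up i \<in> lists alphabet" "subst (emb (vertex i)) u \<in> lists alphabet"
    "down j \<in> lists alphabet" "[Per Q q] \<in> lists alphabet"
    using up_lists emb_word_lists[OF u] q by (auto simp: rel_alphabet_iff Q_collection)
  have m2: "down j @ [Per Q q] \<in> lists alphabet"
    "subst (emb (vertex i)) u @ down j @ [Per Q q] \<in> lists alphabet"
    "up i @ subst (emb (vertex i)) u @ down j @ [Per Q q] \<in> lists alphabet"
    using m by auto
  have "word_value P (flat q (e # st)) = word_value P (flat p st) \<otimes>
      (\<tau> i \<otimes> (word_value P u \<otimes> (inv (\<tau> j) \<otimes> q)))"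
    unfolding e flat.simps
    using value_append[OF _ m2(3)] value_append[OF m(1) m2(2)] value_append[OF m(2) m2(1)]
      value_append[OF m(3,4)] IH emb_word_value[OF u] up_value Q_closed[OF q] by simp
  then show ?case
    using IH m2 value_closed[of "flat p st"] base_word_value_A[OF u] A_closed \<tau>_closed Q_closed[OF q]
    by (auto simp: e m_assoc)
qed

lemma flat_snoc:
  assumes "reduced_stack q st" "p \<in> Q"
  shows "word_eq rels (flat q st @ [Per Q p]) (flat (q \<otimes> p) st)"
    and "reduced_stack (q \<otimes> p) st"
proof -
  have q: "q \<in> Q" using assms reduced_Q by (auto simp: reduced_stack_def)
  have e: "word_eq rels [Per Q q, Per Q p] [Per Q (q \<otimes> p)]" by (rule Q_letters(2)[OF q assms(2)])
  show "word_eq rels (flat q st @ [Per Q p]) (flat (q \<otimes> p) st)"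
  proof (cases st)
    case (Cons e' st')
    obtain p' i u j where "e' = (p', i, u, j)" by (cases e')
    then show ?thesis
      using word_eq_context[OF e, of "flat p' st' @ up i @ subst (emb (vertex i)) u @ down j" "[]"] Cons
      by simp
  qed (use e in simp)
  show "reduced_stack (q \<otimes> p) st"
    using assms reduced_change_top[of q "vals st" "q \<otimes> p"] subgroup.m_closed[OF subgroup_Q q assms(2)]
    by (auto simp: reduced_stack_def)
qed

lemma pop_excursion:
  assumes st: "reduced_stack p st" and u: "u \<in> lists (base_alphabet (vertex j))"
    and k: "word_value P u \<in> K j"
  obtains q where "reduced_stack q st"
    "der rels relators (f (vertex j) (Suc (length u)))
      (flat p st @ up j @ subst (emb (vertex j)) u @ down j) (flat q st)"
proof -
  let ?v = "vertex j" and ?k = "word_value P u"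
  let ?c = "\<lambda>k. \<tau> j \<otimes> k \<otimes> inv (\<tau> j)"
  let ?u = "subst (emb ?v) u" and ?F = "f ?v (Suc (length u))"
  have k': "inv ?k \<in> K j" using k subgroup.m_inv_closed[OF subgroup_K] by blast
  \<comment> \<open>Appended to \<open>u\<close>, the inverse of its value is a letter of
    \<open>K j\<close> and gives a trivial word of the base group. Its area is all that is paid; the
    remaining steps are free.\<close>
  let ?w = "u @ [Per (K j) (inv ?k)]"
  have w: "?w \<in> lists (base_alphabet ?v)" using u k' by (auto simp: rel_alphabet_iff)
  have l: "[Per (K j) (inv ?k)] \<in> lists (base_alphabet ?v)" using k' by (auto simp: rel_alphabet_iff)
  have "word_value P ?w = \<one>"
    using base_value_append[OF u l] K_closed[OF k] by simp
  then have "der (base_rels ?v) (T ?v) ?F ?w []"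
    using A_area[of ?v] w unfolding area_bound_def by simp
  from emb_der[OF this]
  have d: "der rels relators ?F (?u @ down j @ [Per Q (?c (inv ?k))] @ up j) []"
    using emb_K[of j "inv ?k"] by (simp del: emb.simps(1))
  have a: "der rels relators ?F
      (up j @ (?u @ down j @ [Per Q (?c (inv ?k))] @ up j) @ down j @ [Per Q (?c ?k)])
      (up j @ [] @ down j @ [Per Q (?c ?k)])"
    by (rule der_context[OF d])
  have b: "word_eq rels ((up j @ ?u @ down j @ [Per Q (?c (inv ?k))]) @ (up j @ down j) @ [Per Q (?c ?k)])
     ((up j @ ?u @ down j @ [Per Q (?c (inv ?k))]) @ [] @ [Per Q (?c ?k)])"
    by (rule word_eq_context[OF up_down(1)])
  have c: "word_eq rels ((up j @ ?u @ down j) @ [Per Q (?c (inv ?k)), Per Q (?c ?k)] @ [])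
     ((up j @ ?u @ down j) @ [] @ [])"
  proof (rule word_eq_context)
    have "?c (inv ?k) \<otimes> ?c ?k = \<one>"
      using conj_mult[OF \<tau>_closed[of j] K_closed[OF k'] K_closed[OF k]] K_closed[OF k] \<tau>_closed[of j] by simp
    then show "word_eq rels [Per Q (?c (inv ?k)), Per Q (?c ?k)] []"
      using Q_letters(2)[OF conj_K_Q[OF k'] conj_K_Q[OF k]] Q_letters(1) word_eq.trans by metis
  qed
  have d: "word_eq rels ((up j @ down j) @ [Per Q (?c ?k)]) ([] @ [Per Q (?c ?k)])"
    by (rule word_eq_append[OF up_down(1) word_eq.refl])
  note app = append_assoc append.simps append_Nil2
  have "der rels relators ?F (up j @ ?u @ down j) [Per Q (?c ?k)]"
    by (rule der_free_left[OF word_eq.sym[OF c[simplified app]]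
          der_free_left[OF word_eq.sym[OF b[simplified app]]
            der_free_right[OF a[simplified app] d[simplified app]]]])
  then have "der rels relators ?F (flat p st @ up j @ ?u @ down j) (flat p st @ [Per Q (?c ?k)])"
    using der_context[of rels relators ?F _ _ "flat p st" "[]"] by simp
  then have "der rels relators ?F (flat p st @ up j @ ?u @ down j) (flat (p \<otimes> ?c ?k) st)"
    using flat_snoc(1)[OF st conj_K_Q[OF k]] by (rule der_free_right)
  with flat_snoc(2)[OF st conj_K_Q[OF k]] that show ?thesis by blast
qed

text \<open>One merge and one closure suffice, because \<open>reduced\<close> only asks the top
  element to lie in \<open>Q\<close>: the element produced by a closure needs no further treatment.
  The constant 2 is one unit for the letter read and one for a new edge letter or a new
  excursion.\<close>

lemma push_excursion:
  assumes st: "reduced_stack q st" and ij: "vertex i = vertex j"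
    and u: "u \<in> lists (base_alphabet (vertex i))" and len: "length u \<le> 1"
    and D: "\<And>v n. f v n \<le> D n"
  obtains q' st' c where "reduced_stack q' st'" "c + weight st' \<le> weight st + 2"
    "der rels relators (D c) (flat q st @ up i @ subst (emb (vertex i)) u @ down j) (flat q' st')"
proof -
  obtain p i' w st' where st': "reduced_stack p st'" "vertex i' = vertex j"
      "w \<in> lists (base_alphabet (vertex i'))" "weight st' + length w \<le> weight st + 1"
    and eq: "flat q st @ up i @ subst (emb (vertex i)) u @ down j
      = flat p st' @ up i' @ subst (emb (vertex i')) w @ down j"
    and join: "case st' of [] \<Rightarrow> True | (_, _, _, l) # _ \<Rightarrow> \<not> (l = i' \<and> p \<in> conj_set P (K i') (\<tau> i'))"
  \<comment> \<open>If the last excursion left along \<open>i\<close> and \<open>q\<close> comes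
    from \<open>K i\<close>, then \<open>q\<close> is turned back into a letter of
    \<open>K i\<close> and the two words join into one excursion.\<close>
  proof (cases "\<exists>p i0 w st'. st = (p, i0, w, i) # st' \<and> q \<in> conj_set P (K i) (\<tau> i)")
    case True
    then obtain p i0 w st' k where s: "st = (p, i0, w, i) # st'" and k: "k \<in> K i"
      and q: "q = \<tau> i \<otimes> k \<otimes> inv (\<tau> i)" by (auto simp: conj_set_def)
    have r: "reduced_stack p st'" "vertex i0 = vertex i" "w \<in> lists (base_alphabet (vertex i))"
      and j: "case st' of [] \<Rightarrow> True | (_, _, _, l) # _ \<Rightarrow> \<not> (l = i0 \<and> p \<in> conj_set P (K i0) (\<tau> i0))"
      using st s by (auto simp: reduced_stack_def split: list.splits)
    show ?thesis
    proof (rule that[of p st' i0 "w @ [Per (K i) k] @ u"])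
      show "flat q st @ up i @ subst (emb (vertex i)) u @ down j
        = flat p st' @ up i0 @ subst (emb (vertex i0)) (w @ [Per (K i) k] @ u) @ down j"
        using emb_K[of i k] by (simp add: s q r(2) del: emb.simps(1))
    qed (use r j s k u ij len in \<open>auto simp: rel_alphabet_iff\<close>)
  next
    case False
    then show ?thesis
      by (intro that[of q st i u]) (use st ij u len in \<open>auto split: list.splits\<close>)
  qed
  show ?thesis
  proof (cases "i' = j \<and> word_value P w \<in> K j")
    case True
    then obtain q' where q': "reduced_stack q' st'"
      "der rels relators (f (vertex j) (Suc (length w)))
        (flat p st' @ up j @ subst (emb (vertex j)) w @ down j) (flat q' st')"
      using pop_excursion[OF st'(1), of w j] st'(3) by blast
    have "der rels relators (D (Suc (length w))) (flat q st @ up i @ subst (emb (vertex i)) u @ down j) (flat q' st')"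
      unfolding eq using der_mono[OF q'(2) D] True by simp
    then show ?thesis by (rule that[OF q'(1), rotated]) (use st'(4) in simp)
  next
    case False
    have "reduced \<one> (vals ((p, i', w, j) # st'))"
      using st' join False base_word_value_A[OF st'(3)] subgroup.one_closed[OF subgroup_Q]
      by (cases st') (auto simp: reduced_stack_def split: list.splits)
    then have "reduced_stack \<one> ((p, i', w, j) # st')"
      using st' by (auto simp: reduced_stack_def)
    moreover have "word_eq rels (flat q st @ up i @ subst (emb (vertex i)) u @ down j)
        (flat \<one> ((p, i', w, j) # st'))"
      unfolding eq
      using word_eq.sym[OF word_eq_context[OF Q_letters(1),
            of "flat p st' @ up i' @ subst (emb (vertex i')) w @ down j" "[]"]] by simp
    ultimately show ?thesis
      by (intro that[of \<one> "(p, i', w, j) # st'" 0] der.free) (use st'(4) in auto)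
  qed
qed

text \<open>Letters of a base group enter and leave along its root edge. For an edge
  \<open>j\<close> that is no root, \<tau> j is the excursion with the empty word that enters along
  \<open>j\<close> and leaves along the root edge; its inverse goes the other way.\<close>

lemma letter_cases:
  assumes "l \<in> alphabet"
  obtains q where "l = Per Q q" "q \<in> Q"
  | i j u where "vertex i = vertex j" "u \<in> lists (base_alphabet (vertex i))" "length u \<le> 1"
    "[l] = up i @ subst (emb (vertex i)) u @ down j"
proof -
  have root: "up (root v) = []" "down (root v) = []" for v
    by (auto simp: up_def down_def vertex_root)
  consider v s where "s \<in> S v" "l = Gen s" | v s where "s \<in> S v" "l = GenInv s"
    | v H h where "H \<in> \<H> v" "h \<in> H" "l = Per H h"
    | j where "j \<noteq> root (vertex j)" "l = Gen (\<tau> j)" | j where "j \<noteq> root (vertex j)" "l = GenInv (\<tau> j)"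
    | q where "q \<in> Q" "l = Per Q q"
    using assms unfolding rel_alphabet_def gens_def collection_def by blast
  then show ?thesis
  proof cases
    case (1 v s)
    then show ?thesis by (intro that(2)[of "root v" "root v" "[l]"]) (auto simp: root vertex_root rel_alphabet_iff)
  next
    case (2 v s)
    then show ?thesis by (intro that(2)[of "root v" "root v" "[l]"]) (auto simp: root vertex_root rel_alphabet_iff)
  next
    case (3 v H h)
    then show ?thesis by (intro that(2)[of "root v" "root v" "[l]"]) (auto simp: root vertex_root rel_alphabet_iff)
  next
    case (4 j)
    then show ?thesis by (intro that(2)[of j "root (vertex j)" "[]"]) (auto simp: root vertex_root up_def)
  next
    case (5 j)
    then show ?thesis by (intro that(2)[of "root (vertex j)" j "[]"]) (auto simp: root vertex_root down_def)
  qed (rule that(1))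
qed

text \<open>Here \<open>m\<close> is the total length paid for so far. Superadditivity lets the cost
  of the next closure be added inside the argument of \<open>D\<close>.\<close>

lemma reduce_word:
  assumes D: "superadditive D" "\<And>v n. f v n \<le> D n"
  shows "w \<in> lists alphabet \<Longrightarrow> \<exists>q st m. reduced_stack q st \<and> m + weight st \<le> 2 * length w \<and>
    der rels relators (D m) w (flat q st)"
proof (induction w rule: rev_induct)
  case Nil
  have "reduced_stack \<one> []" using subgroup.one_closed[OF subgroup_Q] by (simp add: reduced_stack_def)
  moreover have "der rels relators (D 0) [] (flat \<one> [])"
    using der.free[OF word_eq.sym[OF Q_letters(1)]] by simp
  ultimately show ?case by (intro exI[of _ \<one>] exI[of _ "[]"] exI[of _ 0]) simp
next
  case (snoc l w)
  then obtain q st m where st: "reduced_stack q st" "m + weight st \<le> 2 * length w"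
    "der rels relators (D m) w (flat q st)" by auto
  have d: "der rels relators (D m) (w @ [l]) (flat q st @ [l])"
    using der_context[OF st(3), of "[]" "[l]"] by simp
  have "l \<in> alphabet" using snoc.prems by simp
  then show ?case
  proof (cases rule: letter_cases)
    case (1 p)
    have "der rels relators (D m) (w @ [l]) (flat (q \<otimes> p) st)"
      using der_free_right[OF d] flat_snoc(1)[OF st(1) 1(2)] 1(1) by blast
    then show ?thesis
      using flat_snoc(2)[OF st(1) 1(2)] st(2)
      by (intro exI[of _ "q \<otimes> p"] exI[of _ st] exI[of _ m]) simp
  next
    case (2 i j u)
    obtain q' st' c where s: "reduced_stack q' st'" "c + weight st' \<le> weight st + 2"
      "der rels relators (D c) (flat q st @ up i @ subst (emb (vertex i)) u @ down j) (flat q' st')"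
      using push_excursion[OF st(1) 2(1-3), of D] D(2) by blast
    have "der rels relators (D m + D c) (w @ [l]) (flat q' st')"
      using der.trans[OF d] s(3) 2(4) by simp
    then have "der rels relators (D (m + c)) (w @ [l]) (flat q' st')"
      using der_mono D(1) unfolding superadditive_def by blast
    then show ?thesis using s(1,2) st(2) by (intro exI[of _ q'] exI[of _ st'] exI[of _ "m + c"]) simp
  qed
qed

theorem area_upper:
  assumes D: "superadditive D" "\<And>v n. f v n \<le> D n"
  shows "area_bound P collection gens relators (\<lambda>n. D (2 * n))"
  unfolding area_bound_def
proof (intro ballI impI allI)
  fix w n assume w: "w \<in> lists alphabet" "word_value P w = \<one>" "length w \<le> n"
  obtain q st m where st: "reduced_stack q st" "m + weight st \<le> 2 * length w"
    "der rels relators (D m) w (flat q st)" using reduce_word[OF D w(1)] by blast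
  have "stack_value q (vals st) = \<one>"
    using rel_pair.der_value[OF rel_pair.intro[OF group_pair gens_closed] relators_words st(3) w(1)] flat_value[OF st(1)] w(2) by simp
  moreover from this have "vals st = []"
    using stack_normal st(1) unfolding reduced_stack_def by blast
  ultimately have "st = []" "q = \<one>" by simp_all
  then have "der rels relators (D m) w []"
    using der_free_right[OF st(3)] Q_letters(1) by simp
  then show "der rels relators (D (2 * n)) w []"
    by (rule der_mono) (rule superadditive_mono[OF D(1)], use st(2) w(3) in simp)
qed

lemma presentation:
  assumes "area_bound P collection gens relators g"
  shows "word_presentation P collection gens relators"
proof -
  let ?V = "word_value P ` lists alphabet"
  have "subgroup ?V P"
  proof (rule subgroupI)
    show "?V \<subseteq> carrier P" using value_closed by blast
    show "?V \<noteq> {}" by blast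
  next
    fix a assume "a \<in> ?V"
    then obtain u where u: "u \<in> lists alphabet" "a = word_value P u" by blast
    obtain v where "v \<in> lists alphabet" "word_value P v = inv (word_value P u)"
      using inverse_word[OF group_pair gens_closed u(1)] by blast
    then show "inv a \<in> ?V" using u(2) by (intro image_eqI[of _ _ v]) auto
  next
    fix a b assume "a \<in> ?V" "b \<in> ?V"
    then obtain u v where "a = word_value P u" "u \<in> lists alphabet" "b = word_value P v" "v \<in> lists alphabet"
      by blast
    then show "a \<otimes> b \<in> ?V" using value_append[of u v] by (intro image_eqI[of _ _ "u @ v"]) auto
  qed
  moreover have "(\<Union>v. A v) \<union> range \<tau> \<union> Q \<subseteq> ?V"
  proof -
    have "a \<in> ?V" if a: "a \<in> A v" for a v
    proof -
      obtain w where w: "w \<in> lists (base_alphabet v)" "a = word_value P w"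
        using subsetD[OF A_words a] by blast
      show ?thesis
        by (rule image_eqI[OF _ emb_word_lists[OF w(1)]]) (simp add: w(2) emb_word_value[OF w(1)])
    qed
    moreover have "\<tau> j \<in> ?V" for j using up_lists(1) up_value(1) by (metis imageI)
    moreover have "q \<in> ?V" if "q \<in> Q" for q
      using that Q_closed by (intro image_eqI[of _ _ "[Per Q q]"]) (auto simp: rel_alphabet_iff Q_collection)
    ultimately show ?thesis by blast
  qed
  ultimately have "carrier P \<subseteq> ?V"
    using generate_subgroup_incl P_generated by (meson subset_trans)
  then show ?thesis
    using assms group_pair gens_closed gens_finite relators_finite relators_words
    unfolding word_presentation_def area_bound_def by (meson order_refl)
qed

end

section \<open>The lower bound\<close>

locale gluing_vertex = gluing_presented P Q vertex root A K \<tau> S \<H> T f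
  for P :: "'p monoid" (structure) and Q and vertex :: "'j::finite \<Rightarrow> 'v::finite" and root A K \<tau> S \<H> T f +
  fixes v\<^sub>0 :: 'v
begin

section \<open>The transducer for one base group\<close>

abbreviation j\<^sub>0 :: 'j where "j\<^sub>0 \<equiv> root v\<^sub>0"

abbreviation E\<^sub>0 :: "('p rel_letter list \<times> 'p rel_letter list) set" where "E\<^sub>0 \<equiv> base_rels v\<^sub>0"

text \<open>
  A transducer reads a word over the alphabet of \<open>P\<close> from right to left and writes a word over the
  alphabet of the base group at \<open>v\<^sub>0\<close>. In the state \<open>None\<close> it copies the letters of that base
  group. The state \<open>Some (j, d, n)\<close> stands for the coset \<open>d K j\<close>, of which there are countably many
  copies; reading \<open>p\<close> there moves to the coset of \<open>p d\<close> and writes the resulting element of \<open>K j\<close>.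
  The copies leave room for the shift below.
\<close>

definition moves :: "'p \<Rightarrow> 'j \<times> 'p \<times> nat \<Rightarrow> ('j \<times> 'p \<times> nat) \<times> 'p rel_letter list" where
  "moves p = (\<lambda>(j, d, n). ((j, coset_rep (K j) (p \<otimes> d), n),
     [Per (K j) (inv (coset_rep (K j) (p \<otimes> d)) \<otimes> (p \<otimes> d))]))"

definition cosets :: "('j \<times> 'p \<times> nat) set" where
  "cosets = {(j, d, n). vertex j = v\<^sub>0 \<and> d \<in> carrier P \<and> coset_rep (K j) d = d}"

definition states :: "('j \<times> 'p \<times> nat) option set" where
  "states = insert None (Some ` cosets)"

definition equiv_result where
  "equiv_result r r' \<longleftrightarrow> fst r = fst r' \<and> word_eq E\<^sub>0 (snd r) (snd r')"

lemma moves_closed: "p \<in> carrier P \<Longrightarrow> y \<in> cosets \<Longrightarrow> fst (moves p y) \<in> cosets"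
  using coset_rep[OF subgroup_K] coset_rep_rep[OF subgroup_K] by (auto simp: moves_def cosets_def)

lemma K_letters:
  assumes "vertex j = v\<^sub>0"
  shows "word_eq E\<^sub>0 [Per (K j) \<one>] []"
    and "x \<in> K j \<Longrightarrow> y \<in> K j \<Longrightarrow> word_eq E\<^sub>0 [Per (K j) x, Per (K j) y] [Per (K j) (x \<otimes> y)]"
proof -
  have "table_rels P (K j) (Per (K j)) \<subseteq> E\<^sub>0" using assms by (auto simp: rel_free_rels_def)
  from word_eq_table[OF this] show "word_eq E\<^sub>0 [Per (K j) \<one>] []"
    "x \<in> K j \<Longrightarrow> y \<in> K j \<Longrightarrow> word_eq E\<^sub>0 [Per (K j) x, Per (K j) y] [Per (K j) (x \<otimes> y)]" by auto
qed

lemma moves_one: "y \<in> cosets \<Longrightarrow> equiv_result (moves \<one> y) (y, [])"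
  using K_letters(1) by (auto simp: moves_def cosets_def equiv_result_def)

text \<open>The written letters form a cocycle: if r represents the coset of p' d and s that of p r,
  then (s^-1 p r) (r^-1 p' d) = s^-1 p p' d, and the product takes place in \<open>K j\<close>,
  where it is free.\<close>

lemma moves_mult:
  assumes "p \<in> carrier P" "p' \<in> carrier P" "y \<in> cosets"
  shows "equiv_result (fst (moves p (fst (moves p' y))), snd (moves p (fst (moves p' y))) @ snd (moves p' y))
    (moves (p \<otimes> p') y)"
proof -
  obtain j d n where y: "y = (j, d, n)" by (cases y)
  have j: "vertex j = v\<^sub>0" and d: "d \<in> carrier P" using assms(3) y by (auto simp: cosets_def)
  interpret K: subgroup "K j" P by (rule subgroup_K)
  let ?e = "p' \<otimes> d" and ?r = "coset_rep (K j) (p' \<otimes> d)"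
  have e: "?e \<in> carrier P" using assms d by simp
  note r = coset_rep[OF subgroup_K e, of j]
  let ?k = "inv ?r \<otimes> ?e"
  have "p \<otimes> ?r = (p \<otimes> ?e) \<otimes> inv ?k"
    using assms e r(1) by (simp add: inv_mult_group m_assoc[symmetric]) (simp add: m_assoc)
  then have eq: "coset_rep (K j) (p \<otimes> ?r) = coset_rep (K j) (p \<otimes> ?e)"
    using coset_rep_mult[OF subgroup_K, of "p \<otimes> ?e" "inv ?k" j] K.m_inv_closed[OF r(2)] assms e by simp
  let ?s = "coset_rep (K j) (p \<otimes> ?e)"
  have s: "?s \<in> carrier P" using coset_rep(1)[OF subgroup_K] assms e by simp
  have sk: "inv ?s \<otimes> (p \<otimes> ?r) \<in> K j" using coset_rep(2)[OF subgroup_K, of "p \<otimes> ?r" j] eq assms r(1) by simp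
  have "inv ?s \<otimes> (p \<otimes> ?r) \<otimes> ?k = inv ?s \<otimes> (p \<otimes> p' \<otimes> d)"
    using assms d e r(1) s by (simp add: m_assoc[symmetric]) (simp add: m_assoc inv_solve_left')
  then show ?thesis
    using K_letters(2)[OF j sk r(2)] assms d
    by (simp add: y moves_def equiv_result_def eq m_assoc)
qed

text \<open>A bijection from the states to the cosets as in Hilbert's hotel: \<open>None\<close>
  takes copy 0 of the trivial coset of \<open>K j\<close>, and the copies of that coset move up by
  one. Hence every element of \<open>P\<close> can act on \<open>None\<close> as well.\<close>

definition shift :: "'j \<Rightarrow> ('j \<times> 'p \<times> nat) option \<Rightarrow> 'j \<times> 'p \<times> nat" where
  "shift j x = (case x of None \<Rightarrow> (j, \<one>, 0)
     | Some (i, d, n) \<Rightarrow> if i = j \<and> d = \<one> then (j, \<one>, Suc n) else (i, d, n))"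

definition unshift :: "'j \<Rightarrow> 'j \<times> 'p \<times> nat \<Rightarrow> ('j \<times> 'p \<times> nat) option" where
  "unshift j = (\<lambda>(i, d, n). if i = j \<and> d = \<one>
     then (case n of 0 \<Rightarrow> None | Suc m \<Rightarrow> Some (j, \<one>, m)) else Some (i, d, n))"

lemma shift_unshift: "shift j (unshift j y) = y" "unshift j (shift j x) = x"
  by (auto simp: shift_def unshift_def split: prod.splits option.splits nat.splits)

lemma shift_closed: "vertex j = v\<^sub>0 \<Longrightarrow> x \<in> states \<Longrightarrow> shift j x \<in> cosets"
  by (auto simp: shift_def states_def cosets_def coset_rep_one[OF subgroup_K] split: option.splits)

lemma unshift_closed: "vertex j = v\<^sub>0 \<Longrightarrow> y \<in> cosets \<Longrightarrow> unshift j y \<in> states"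
  by (cases y, cases "fst y = j \<and> fst (snd y) = \<one>"; cases "snd (snd y)")
    (auto simp: unshift_def states_def cosets_def coset_rep_one[OF subgroup_K])

text \<open>The element \<open>p\<close> acts on cosets, and the states are identified with cosets
  through edge \<open>j\<close> on entering and through edge \<open>i\<close> on leaving. The two
  edges differ for the letters of \<tau>, which lead between an edge and the root edge.\<close>

definition shifted :: "'j \<Rightarrow> 'j \<Rightarrow> 'p \<Rightarrow> ('j \<times> 'p \<times> nat) option \<Rightarrow>
    ('j \<times> 'p \<times> nat) option \<times> 'p rel_letter list" where
  "shifted i j p x = (unshift i (fst (moves p (shift j x))), snd (moves p (shift j x)))"

text \<open>The action of the base group at \<open>v\<^sub>0\<close>: only at \<open>None\<close> is
  the word \<open>u\<close> written unchanged; elsewhere \<open>a\<close> acts on cosets.\<close>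

definition copied :: "'p \<Rightarrow> 'p rel_letter list \<Rightarrow> ('j \<times> 'p \<times> nat) option \<Rightarrow>
    ('j \<times> 'p \<times> nat) option \<times> 'p rel_letter list" where
  "copied a u x = (case x of None \<Rightarrow> (None, u) | Some y \<Rightarrow> (Some (fst (moves a y)), snd (moves a y)))"

definition idle :: "('j \<times> 'p \<times> nat) option \<Rightarrow> ('j \<times> 'p \<times> nat) option \<times> 'p rel_letter list" where
  "idle x = (x, [])"

definition serial where
  "serial F G x = (fst (F (fst (G x))), snd (F (fst (G x))) @ snd (G x))"

text \<open>Preservation of \<open>states\<close> is part of the relation, so reflexivity is a
  property to be proved for each transducer.\<close>

definition equiv :: "_ \<Rightarrow> _ \<Rightarrow> bool" where
  "equiv F G \<longleftrightarrow> (\<forall>x\<in>states. fst (F x) \<in> states \<and> equiv_result (F x) (G x))"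

lemma serial_assoc: "serial (serial F G) H = serial F (serial G H)"
  by (simp add: serial_def fun_eq_iff)

lemma serial_idle: "serial idle F = F" "serial F idle = F"
  by (simp_all add: serial_def idle_def fun_eq_iff)

lemma equiv_sym: "equiv F G \<Longrightarrow> equiv G F"
  by (auto simp: equiv_def equiv_result_def intro: word_eq.sym)

lemma equiv_trans: "equiv F G \<Longrightarrow> equiv G H \<Longrightarrow> equiv F H"
  by (auto simp: equiv_def equiv_result_def intro: word_eq.trans)

lemma equiv_serial:
  assumes "equiv F F'" "equiv G G'"
  shows "equiv (serial F G) (serial F' G')"
  unfolding equiv_def
proof
  fix x assume "x \<in> states"
  then have G: "fst (G x) \<in> states" "equiv_result (G x) (G' x)" using assms(2) by (auto simp: equiv_def)
  then have "fst (F (fst (G x))) \<in> states" "equiv_result (F (fst (G x))) (F' (fst (G x)))"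
    using assms(1) by (auto simp: equiv_def)
  then show "fst (serial F G x) \<in> states \<and> equiv_result (serial F G x) (serial F' G' x)"
    using G(2) by (simp add: equiv_result_def serial_def word_eq_append)
qed

lemma idle_equiv: "equiv idle idle"
  by (auto simp: equiv_def equiv_result_def idle_def intro: word_eq.refl)

lemma shifted_one: "vertex j = v\<^sub>0 \<Longrightarrow> equiv (shifted j j \<one>) idle"
  unfolding equiv_def
proof
  fix x assume j: "vertex j = v\<^sub>0" and x: "x \<in> states"
  show "fst (shifted j j \<one> x) \<in> states \<and> equiv_result (shifted j j \<one> x) (idle x)"
    using moves_one[OF shift_closed[OF j x]] x
    by (simp add: shifted_def equiv_result_def idle_def shift_unshift)
qed

lemma shifted_serial:
  assumes "vertex i = v\<^sub>0" "vertex j = v\<^sub>0" "vertex l = v\<^sub>0" "p \<in> carrier P" "p' \<in> carrier P"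
  shows "equiv (serial (shifted i j p) (shifted j l p')) (shifted i l (p \<otimes> p'))"
  unfolding equiv_def
proof
  fix x assume x: "x \<in> states"
  note m = moves_mult[OF assms(4,5) shift_closed[OF assms(3) x]]
  have "fst (moves p (fst (moves p' (shift l x)))) \<in> cosets"
    using moves_closed assms shift_closed x by blast
  then show "fst (serial (shifted i j p) (shifted j l p') x) \<in> states \<and>
      equiv_result (serial (shifted i j p) (shifted j l p') x) (shifted i l (p \<otimes> p') x)"
    using m unshift_closed[OF assms(1)] by (simp add: serial_def shifted_def shift_unshift equiv_result_def)
qed

lemma shifted_refl:
  "vertex i = v\<^sub>0 \<Longrightarrow> vertex j = v\<^sub>0 \<Longrightarrow> p \<in> carrier P \<Longrightarrow> equiv (shifted i j p) (shifted i j p)"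
  unfolding equiv_def equiv_result_def shifted_def
  using unshift_closed moves_closed shift_closed by (auto intro: word_eq.refl)

lemma copied_refl: "a \<in> carrier P \<Longrightarrow> equiv (copied a u) (copied a u)"
  unfolding equiv_def equiv_result_def copied_def states_def
  using moves_closed by (auto intro: word_eq.refl)

lemma copied_words: "a \<in> carrier P \<Longrightarrow> word_eq E\<^sub>0 u v \<Longrightarrow> equiv (copied a u) (copied a v)"
  unfolding equiv_def equiv_result_def copied_def states_def
  using moves_closed by (auto intro: word_eq.refl)

lemma copied_one: "equiv (copied \<one> []) idle"
  unfolding equiv_def copied_def idle_def states_def
  using moves_one by (auto simp: equiv_result_def intro: word_eq.refl)

lemma copied_serial:
  assumes "a \<in> carrier P" "b \<in> carrier P"
  shows "equiv (serial (copied a u) (copied b v)) (copied (a \<otimes> b) (u @ v))"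
  unfolding equiv_def
proof
  fix x assume x: "x \<in> states"
  show "fst (serial (copied a u) (copied b v) x) \<in> states \<and>
      equiv_result (serial (copied a u) (copied b v) x) (copied (a \<otimes> b) (u @ v) x)"
  proof (cases x)
    case None
    then show ?thesis by (simp add: serial_def copied_def states_def equiv_result_def word_eq.refl)
  next
    case (Some y)
    then have y: "y \<in> cosets" using x by (auto simp: states_def)
    have "fst (moves a (fst (moves b y))) \<in> cosets" using assms moves_closed y by blast
    then show ?thesis
      using moves_mult[OF assms y] by (simp add: serial_def copied_def states_def equiv_result_def Some)
  qed
qed

text \<open>The two actions agree on an edge group: as the trivial coset of \<open>K j\<close>, the
  state \<open>None\<close> is fixed by \<open>k\<close>, and the letter written is \<open>k\<close>
  itself. This makes the transducer respect the gluing.\<close>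

lemma shifted_K:
  assumes j: "vertex j = v\<^sub>0" and k: "k \<in> K j"
  shows "equiv (shifted j j k) (copied k [Per (K j) k])"
proof -
  interpret K: subgroup "K j" P by (rule subgroup_K)
  have "equiv_result (shifted j j k x) (copied k [Per (K j) k] x)" if x: "x \<in> states" for x
  proof (cases x)
    case None
    then show ?thesis
      using k K.mem_carrier[OF k]
      by (simp add: shifted_def copied_def equiv_result_def shift_def unshift_def moves_def coset_rep_K
          word_eq.refl)
  next
    case (Some y)
    obtain i d n where y: "y = (i, d, n)" by (cases y)
    have d: "d \<in> carrier P" "coset_rep (K i) d = d" using x Some y by (auto simp: states_def cosets_def)
    show ?thesis
    proof (cases "i = j \<and> d = \<one>")
      case True
      then show ?thesis
        using k K.mem_carrier[OF k]
        by (simp add: shifted_def copied_def equiv_result_def shift_def unshift_def moves_def coset_rep_K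
            word_eq.refl Some y)
    next
      case False
      \<comment> \<open>Left multiplication by \<open>k\<close> preserves the trivial coset of
        \<open>K j\<close> and thus its complement, so \<open>shift\<close> and
        \<open>unshift\<close> change nothing on the remaining states.\<close>
      have "coset_rep (K i) (k \<otimes> d) \<noteq> \<one>" if "i = j"
      proof
        assume "coset_rep (K i) (k \<otimes> d) = \<one>"
        then have "k \<otimes> d \<in> K j" using coset_rep_eq_one[OF subgroup_K, of "k \<otimes> d"] d K.mem_carrier[OF k] that by simp
        then have "inv k \<otimes> (k \<otimes> d) \<in> K j" using k K.m_closed K.m_inv_closed by blast
        then have "d \<in> K j" using d(1) K.mem_carrier[OF k] by (simp add: m_assoc[symmetric])
        then show False using False that d(2) coset_rep_K by simp
      qed
      then show ?thesis
        using False by (auto simp: shifted_def copied_def equiv_result_def shift_def unshift_def moves_def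
            word_eq.refl Some y)
    qed
  qed
  then show ?thesis
    using shifted_refl[OF j j K.mem_carrier[OF k]] by (simp add: equiv_def)
qed

text \<open>By the default \<open>j\<^sub>0\<close>, generators of other base groups, and \<tau> of
  edges at other vertices, act through the root edge on both sides.\<close>

definition gen_edge :: "'p \<Rightarrow> 'j" where
  "gen_edge s = (if \<exists>j. j \<noteq> root (vertex j) \<and> vertex j = v\<^sub>0 \<and> \<tau> j = s
     then (THE j. j \<noteq> root (vertex j) \<and> vertex j = v\<^sub>0 \<and> \<tau> j = s) else j\<^sub>0)"

text \<open>Derivations may pass through arbitrary contexts, hence through letters outside the
  alphabet; these are ignored, so that every word preserves the states.\<close>

definition step :: "'p rel_letter \<Rightarrow> ('j \<times> 'p \<times> nat) option \<Rightarrow>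
    ('j \<times> 'p \<times> nat) option \<times> 'p rel_letter list" where
  "step l = (if l \<notin> alphabet then idle else case l of
      Gen s \<Rightarrow> if s \<in> S v\<^sub>0 then copied s [l] else shifted j\<^sub>0 (gen_edge s) s
    | GenInv s \<Rightarrow> if s \<in> S v\<^sub>0 then copied (inv s) [l] else shifted (gen_edge s) j\<^sub>0 (inv s)
    | Per H h \<Rightarrow> if H \<in> \<H> v\<^sub>0 then copied h [l] else shifted j\<^sub>0 j\<^sub>0 h)"

fun run where
  "run [] = idle"
| "run (l # w) = serial (step l) (run w)"

lemma run_append: "run (u @ w) = serial (run u) (run w)"
  by (induction u) (simp_all add: serial_assoc serial_idle)

lemma gen_edge_vertex: "vertex (gen_edge s) = v\<^sub>0"
proof (cases "\<exists>j. j \<noteq> root (vertex j) \<and> vertex j = v\<^sub>0 \<and> \<tau> j = s")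
  case True
  then have "\<exists>!j. j \<noteq> root (vertex j) \<and> vertex j = v\<^sub>0 \<and> \<tau> j = s" using \<tau>_inj by blast
  from theI'[OF this] True show ?thesis by (simp add: gen_edge_def)
next
  case False
  then show ?thesis unfolding gen_edge_def if_not_P[OF False] by (simp add: vertex_root)
qed

lemma gen_edge_\<tau>:
  assumes "j \<noteq> root (vertex j)"
  shows "gen_edge (\<tau> j) = (if vertex j = v\<^sub>0 then j else j\<^sub>0)"
proof (cases "vertex j = v\<^sub>0")
  case True
  then have "(THE i. i \<noteq> root (vertex i) \<and> vertex i = v\<^sub>0 \<and> \<tau> i = \<tau> j) = j"
    using assms \<tau>_inj by (intro the_equality) auto
  then show ?thesis using True assms by (auto simp: gen_edge_def)
next
  case False
  then have n: "\<not> (\<exists>i. i \<noteq> root (vertex i) \<and> vertex i = v\<^sub>0 \<and> \<tau> i = \<tau> j)" using assms \<tau>_inj by blast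
  show ?thesis unfolding gen_edge_def if_not_P[OF n] using False by simp
qed

lemma gen_edge_S: "s \<in> S v \<Longrightarrow> gen_edge s = j\<^sub>0"
  using \<tau>_notin by (auto simp: gen_edge_def)

lemma gens_mem_closed: "s \<in> gens \<Longrightarrow> s \<in> carrier P"
  using gens_closed by blast

lemma collection_mem_closed: "H \<in> collection \<Longrightarrow> h \<in> H \<Longrightarrow> h \<in> carrier P"
  using group_pair subgroup.mem_carrier by (fastforce simp: group_pair_def)

lemma step_refl: "equiv (step l) (step l)"
proof (cases "l \<in> alphabet")
  case True
  then show ?thesis
    using gens_mem_closed collection_mem_closed gen_edge_vertex vertex_root
    by (cases l) (auto simp: step_def rel_alphabet_iff intro!: copied_refl shifted_refl)
qed (simp add: step_def idle_equiv)

lemma run_refl: "equiv (run w) (run w)"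
  by (induction w) (auto intro: idle_equiv equiv_serial step_refl)

lemma run_single: "run [l] = step l"
  by (simp add: serial_idle)

lemma step_table:
  assumes H: "H \<in> collection" and uw: "(u, w) \<in> table_rels P H (Per H)"
  shows "equiv (run u) (run w)"
proof -
  have sub: "subgroup H P" using H group_pair by (simp add: group_pair_def)
  interpret H: subgroup H P by (rule sub)
  consider "u = [Per H \<one>]" "w = []"
    | x y where "x \<in> H" "y \<in> H" "u = [Per H x, Per H y]" "w = [Per H (x \<otimes> y)]"
    using uw by (auto simp: table_rels_def)
  then show ?thesis
  proof cases
    case 1
    show ?thesis
    proof (cases "H \<in> \<H> v\<^sub>0")
      case True
      then have "word_eq E\<^sub>0 [Per H \<one>] []" by (intro word_eq_base) (auto simp: rel_free_rels_def table_rels_def)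
      then show ?thesis
        using equiv_trans[OF copied_words copied_one] 1 True H H.one_closed
        by (simp add: step_def rel_alphabet_iff serial_idle)
    next
      case False
      then show ?thesis using shifted_one[of j\<^sub>0] vertex_root 1 H H.one_closed
        by (simp add: step_def rel_alphabet_iff serial_idle)
    qed
  next
    case 2
    have xy: "x \<in> carrier P" "y \<in> carrier P" "x \<otimes> y \<in> H" using 2 by auto
    show ?thesis
    proof (cases "H \<in> \<H> v\<^sub>0")
      case True
      then have "word_eq E\<^sub>0 [Per H x, Per H y] [Per H (x \<otimes> y)]"
        using 2 by (intro word_eq_base) (auto simp: rel_free_rels_def table_rels_def)
      then show ?thesis
        using equiv_trans[OF copied_serial copied_words, OF xy(1,2)] xy 2 True H
        by (simp add: step_def rel_alphabet_iff serial_idle)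
    next
      case False
      then show ?thesis
        using shifted_serial[OF vertex_root vertex_root vertex_root xy(1,2)] 2 H xy(3)
        by (simp add: step_def rel_alphabet_iff serial_idle)
    qed
  qed
qed

lemma run_rels:
  assumes "(u, w) \<in> rels"
  shows "equiv (run u) (run w)"
proof -
  consider s where "s \<in> gens" "u = [Gen s, GenInv s] \<or> u = [GenInv s, Gen s]" "w = []"
    | H where "H \<in> collection" "(u, w) \<in> table_rels P H (Per H)"
    using assms unfolding rel_free_rels_def by blast
  then show ?thesis
  proof cases
    case 1
    have s: "s \<in> carrier P" using gens_mem_closed 1(1) .
    have "equiv (serial (step (Gen s)) (step (GenInv s))) idle \<and>
        equiv (serial (step (GenInv s)) (step (Gen s))) idle"
    proof (cases "s \<in> S v\<^sub>0")
      case True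
      then have "word_eq E\<^sub>0 [Gen s, GenInv s] []" "word_eq E\<^sub>0 [GenInv s, Gen s] []"
        by (auto intro!: word_eq_base simp: rel_free_rels_def)
      from this[THEN copied_words[OF one_closed]]
      have "equiv (copied \<one> [Gen s, GenInv s]) idle" "equiv (copied \<one> [GenInv s, Gen s]) idle"
        using equiv_trans[OF _ copied_one] by auto
      moreover have "step (Gen s) = copied s [Gen s]" "step (GenInv s) = copied (inv s) [GenInv s]"
        using True 1(1) by (auto simp: step_def rel_alphabet_iff)
      ultimately show ?thesis
        using equiv_trans[OF copied_serial[OF s inv_closed[OF s], of "[Gen s]" "[GenInv s]"]]
          equiv_trans[OF copied_serial[OF inv_closed[OF s] s, of "[GenInv s]" "[Gen s]"]] s by simp
    next
      case False
      then have "step (Gen s) = shifted j\<^sub>0 (gen_edge s) s" "step (GenInv s) = shifted (gen_edge s) j\<^sub>0 (inv s)"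
        using 1(1) by (auto simp: step_def rel_alphabet_iff)
      then show ?thesis
        using equiv_trans[OF shifted_serial[OF vertex_root gen_edge_vertex vertex_root s inv_closed[OF s]]]
          equiv_trans[OF shifted_serial[OF gen_edge_vertex vertex_root gen_edge_vertex inv_closed[OF s] s]]
          shifted_one[OF vertex_root] shifted_one[OF gen_edge_vertex] s by simp
    qed
    then show ?thesis using 1(2,3) by (auto simp: serial_idle)
  qed (rule step_table)
qed

lemma run_word_eq: "word_eq rels u w \<Longrightarrow> equiv (run u) (run w)"
proof (induction rule: word_eq.induct)
  case (rel u w x y)
  then show ?case by (auto simp: run_append intro!: equiv_serial run_refl run_rels)
qed (blast intro: equiv_sym equiv_trans run_refl)+

text \<open>The three pieces of the rewritten letter compose to (\<tau> j)^-1 q \<tau> j = k,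
  passing from edge \<open>j\<close> to the root edge and back. An edge at another vertex is treated
  as \<open>j\<^sub>0\<close> throughout.\<close>

lemma run_edge:
  assumes k: "k \<in> K j"
  shows "equiv (run (emb (vertex j) (Per (K j) k)))
    (if vertex j = v\<^sub>0 then shifted j j k else shifted j\<^sub>0 j\<^sub>0 k)"
proof -
  let ?q = "\<tau> j \<otimes> k \<otimes> inv (\<tau> j)" and ?i = "if vertex j = v\<^sub>0 then j else j\<^sub>0"
  have i: "vertex ?i = v\<^sub>0" using vertex_root by simp
  have q: "?q \<in> Q" by (rule conj_K_Q[OF k])
  have qQ: "run [Per Q ?q] = shifted j\<^sub>0 j\<^sub>0 ?q"
    unfolding run_single using q Q_notin by (simp add: step_def rel_alphabet_iff Q_collection)
  have t: "\<tau> j \<in> carrier P" "k \<in> carrier P" using \<tau>_closed K_closed[OF k] by auto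
  have "equiv (run (up j)) (shifted j\<^sub>0 ?i (\<tau> j)) \<and> equiv (run (down j)) (shifted ?i j\<^sub>0 (inv (\<tau> j)))"
  proof (cases "j = root (vertex j)")
    case True
    then have "?i = j\<^sub>0" "\<tau> j = \<one>" using \<tau>_root by metis+
    then show ?thesis using True equiv_sym[OF shifted_one[OF vertex_root]] by (simp add: up_def down_def)
  next
    case False
    then have "\<tau> j \<in> gens" by (auto simp: gens_def)
    then show ?thesis
      using shifted_refl[OF vertex_root i t(1)] shifted_refl[OF i vertex_root inv_closed[OF t(1)]]
        gen_edge_\<tau>[OF False] \<tau>_notin[OF False] False
      by (simp add: up_def down_def step_def rel_alphabet_iff serial_idle)
  qed
  then have u: "equiv (run (up j)) (shifted j\<^sub>0 ?i (\<tau> j))"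
    and d: "equiv (run (down j)) (shifted ?i j\<^sub>0 (inv (\<tau> j)))" by auto
  have "equiv (serial (shifted j\<^sub>0 j\<^sub>0 ?q) (run (up j))) (shifted j\<^sub>0 ?i (?q \<otimes> \<tau> j))"
    by (rule equiv_trans[OF equiv_serial[OF shifted_refl u] shifted_serial])
      (use vertex_root i q Q_closed t in auto)
  then have "equiv (serial (run (down j)) (serial (shifted j\<^sub>0 j\<^sub>0 ?q) (run (up j))))
      (shifted ?i ?i (inv (\<tau> j) \<otimes> (?q \<otimes> \<tau> j)))"
    by (intro equiv_trans[OF equiv_serial[OF d] shifted_serial])
      (use vertex_root i q Q_closed t in auto)
  moreover have "inv (\<tau> j) \<otimes> (?q \<otimes> \<tau> j) = k"
    using conj_inverse[OF t] t by (simp add: m_assoc)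
  ultimately show ?thesis
    unfolding emb_K run_append qQ by (auto split: if_splits)
qed

lemma run_emb:
  assumes "l \<in> base_alphabet v"
  shows "equiv (run (emb v l)) (if v = v\<^sub>0 then copied (letter_value P l) [l] else shifted j\<^sub>0 j\<^sub>0 (letter_value P l))"
  using assms
proof (cases rule: base_letter_cases)
  case (1 s)
  then have "s \<in> gens" "s \<in> carrier P" "v \<noteq> v\<^sub>0 \<Longrightarrow> s \<notin> S v\<^sub>0"
    using S_closed S_disjoint by (auto simp: gens_def)
  then show ?thesis
    using 1 gen_edge_S[OF 1(1)] vertex_root
    by (auto simp: serial_idle step_def rel_alphabet_iff intro!: copied_refl shifted_refl)
next
  case (2 s)
  then have "s \<in> gens" "s \<in> carrier P" "v \<noteq> v\<^sub>0 \<Longrightarrow> s \<notin> S v\<^sub>0"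
    using S_closed S_disjoint by (auto simp: gens_def)
  then show ?thesis
    using 2 gen_edge_S[OF 2(1)] vertex_root
    by (auto simp: serial_idle step_def rel_alphabet_iff intro!: copied_refl shifted_refl)
next
  case (3 H h)
  then have "H \<in> collection" "h \<in> carrier P" "v \<noteq> v\<^sub>0 \<Longrightarrow> H \<notin> \<H> v\<^sub>0"
    using \<H>_disjoint \<H>_collection collection_mem_closed[OF \<H>_collection] by auto
  then show ?thesis
    using 3 vertex_root
    by (auto simp: serial_idle step_def rel_alphabet_iff intro!: copied_refl shifted_refl)
next
  case (4 j k)
  have "equiv (run (emb v l)) (if v = v\<^sub>0 then shifted j j k else shifted j\<^sub>0 j\<^sub>0 k)"
    using run_edge[OF 4(2)] unfolding 4(1) 4(3) .
  then show ?thesis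
    using equiv_trans[OF _ shifted_K[OF _ 4(2)]] 4(1,3) by (simp del: emb.simps split: if_splits)
qed

lemma base_value_closed: "w \<in> lists (base_alphabet v) \<Longrightarrow> word_value P w \<in> carrier P"
  by (rule word_value_closed[OF base_group_pair S_closed])

lemma run_emb_word:
  assumes "w \<in> lists (base_alphabet v)"
  shows "equiv (run (subst (emb v) w))
    (if v = v\<^sub>0 then copied (word_value P w) w else shifted j\<^sub>0 j\<^sub>0 (word_value P w))"
  using assms
proof (induction w)
  case Nil
  then show ?case using equiv_sym[OF copied_one] equiv_sym[OF shifted_one[OF vertex_root]] by simp
next
  case (Cons l w)
  then have l: "l \<in> base_alphabet v" and w: "w \<in> lists (base_alphabet v)" by auto
  have c: "letter_value P l \<in> carrier P" "word_value P w \<in> carrier P"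
    using base_value_closed[of "[l]" v] base_value_closed[OF w] l
      emb_value[OF l] value_closed[OF emb_lists[OF l]] by auto
  note s = equiv_serial[OF run_emb[OF l] Cons.IH]
  show ?case
  proof (cases "v = v\<^sub>0")
    case True
    then show ?thesis using equiv_trans[OF _ copied_serial[OF c, of "[l]" w]] s by (simp add: run_append)
  next
    case False
    then show ?thesis
      using equiv_trans[OF _ shifted_serial[OF vertex_root vertex_root vertex_root c]] s by (simp add: run_append)
  qed
qed

text \<open>At \<open>None\<close>, a relator of the base group at \<open>v\<^sub>0\<close> is
  copied up to free equality and costs one step. In all other cases it acts on cosets through its
  value \<one>, and what it writes is freely trivial.\<close>

lemma run_relator:
  assumes t: "t \<in> T v" and x: "x \<in> states"
  shows "fst (run (subst (emb v) t) x) = x"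
    and "der E\<^sub>0 (T v\<^sub>0) (Suc k) (snd (run (subst (emb v) t) x)) []"
proof -
  have t': "t \<in> lists (base_alphabet v)" "word_value P t = \<one>" using T_words t by auto
  let ?r = "run (subst (emb v) t) x"
  have "fst ?r = x \<and> der E\<^sub>0 (T v\<^sub>0) (Suc k) (snd ?r) []"
  proof (cases "v = v\<^sub>0 \<and> x = None")
    case True
    have e: "equiv_result ?r (None, t)"
      using run_emb_word[OF t'(1)] x True t'(2) by (auto simp: equiv_def copied_def)
    have "der E\<^sub>0 (T v\<^sub>0) (Suc k) t []" using der.rel[of t "T v\<^sub>0" E\<^sub>0 k "[]" "[]"] t True by simp
    then show ?thesis using e True by (auto simp: equiv_result_def intro: der_free_left)
  next
    case False
    have "equiv_result ?r (x, [])"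
    proof (cases "v = v\<^sub>0")
      case True
      then obtain y where y: "x = Some y" "y \<in> cosets" using False x by (auto simp: states_def)
      have "equiv_result ?r (copied \<one> t x)"
        using run_emb_word[OF t'(1)] x True t'(2) by (simp add: equiv_def)
      then show ?thesis
        using moves_one[OF y(2)] by (auto simp: y(1) copied_def equiv_result_def intro: word_eq.trans)
    next
      case False
      then show ?thesis
        using equiv_trans[OF _ shifted_one[OF vertex_root]] run_emb_word[OF t'(1)] x t'(2)
        by (auto simp: equiv_def idle_def)
    qed
    then show ?thesis by (auto simp: equiv_result_def intro: der.free)
  qed
  then show "fst ?r = x" "der E\<^sub>0 (T v\<^sub>0) (Suc k) (snd ?r) []" by auto
qed

lemma run_states: "x \<in> states \<Longrightarrow> fst (run w x) \<in> states"
  using run_refl[of w] by (simp add: equiv_def)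

text \<open>A relator returns to the state in which it is read, so the prefix to its left is read as
  if the relator were absent.\<close>

lemma run_der:
  assumes "der rels relators k u w"
  shows "\<forall>x\<in>states. fst (run u x) = fst (run w x) \<and>
    der E\<^sub>0 (T v\<^sub>0) k (snd (run u x)) (snd (run w x))"
  using assms
proof (induction rule: der.induct)
  case (free u w k)
  then show ?case using run_word_eq by (auto simp: equiv_def equiv_result_def intro: der.free)
next
  case (rel r k x y)
  then obtain v t where t: "t \<in> T v" "r = subst (emb v) t" by (auto simp: relators_def)
  show ?case
  proof
    fix z assume "z \<in> states"
    then have z: "fst (run y z) \<in> states" by (rule run_states)
    note r = run_relator(1)[OF t(1) z, folded t(2)] run_relator(2)[OF t(1) z, of k, folded t(2)]
    have "der E\<^sub>0 (T v\<^sub>0) (Suc k) (snd (run x (fst (run y z))) @ snd (run r (fst (run y z))) @ snd (run y z))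
        (snd (run x (fst (run y z))) @ [] @ snd (run y z))"
      by (rule der_context[OF r(2)])
    then show "fst (run (x @ r @ y) z) = fst (run (x @ y) z) \<and>
        der E\<^sub>0 (T v\<^sub>0) (Suc k) (snd (run (x @ r @ y) z)) (snd (run (x @ y) z))"
      by (simp add: run_append serial_def r(1))
  qed
next
  case (sym k u v)
  then show ?case by (auto intro: der.sym)
next
  case (trans j u v k w)
  show ?case
  proof
    fix x assume "x \<in> states"
    then show "fst (run u x) = fst (run w x) \<and> der E\<^sub>0 (T v\<^sub>0) (j + k) (snd (run u x)) (snd (run w x))"
      using bspec[OF trans.IH(1)] bspec[OF trans.IH(2)] der.trans[of E\<^sub>0 "T v\<^sub>0" j "snd (run u x)" "snd (run v x)" k "snd (run w x)"]
      by simp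
  qed
qed

lemma emb_length: "length (emb v l) \<le> 3"
  by (cases "(v, l)" rule: emb.cases) (auto simp: Let_def up_def down_def)

text \<open>From \<open>None\<close>, a rewritten word of the base group is translated back to
  itself up to free equality. The factor 3 is the maximal length of a rewritten letter.\<close>

theorem area_lower:
  assumes "area_bound P collection gens relators g"
  shows "area_bound P (base_collection v\<^sub>0) (S v\<^sub>0) (T v\<^sub>0) (\<lambda>n. g (3 * n))"
  unfolding area_bound_def
proof (intro ballI impI allI)
  fix w n assume w: "w \<in> lists (base_alphabet v\<^sub>0)" "word_value P w = \<one>" "length w \<le> n"
  let ?w = "subst (emb v\<^sub>0) w"
  have "length ?w \<le> 3 * length w" by (rule subst_length[OF _ w(1)]) (rule emb_length)
  then have "der rels relators (g (3 * n)) ?w []"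
    using assms emb_word_lists[OF w(1)] emb_word_value[OF w(1)] w(2,3) unfolding area_bound_def by simp
  from run_der[OF this] have "der E\<^sub>0 (T v\<^sub>0) (g (3 * n)) (snd (run ?w None)) []"
    by (simp add: states_def idle_def)
  moreover have "word_eq E\<^sub>0 (snd (run ?w None)) w"
    using run_emb_word[OF w(1)] w(2) by (auto simp: equiv_def equiv_result_def states_def copied_def)
  ultimately show "der E\<^sub>0 (T v\<^sub>0) (g (3 * n)) w []" by (blast intro: der_free_left word_eq.sym)
qed

end

section \<open>Comparison with an arbitrary Dehn function of the whole group\<close>

context gluing_presented
begin

text \<open>\<open>\<Delta>\<close> belongs to an arbitrary finite presentation, the estimates to
  \<open>gens\<close> and \<open>relators\<close>. Changing the presentation, in one direction for
  each estimate, only affects the constants.\<close>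

lemma dehn:
  assumes D: "superadditive D" "\<And>v n. f v n \<le> D n"
    and \<Delta>: "rel_dehn_function P collection \<Delta>"
  shows "\<Delta> \<preceq> D"
    and "\<exists>C M N. area_bound P (base_collection v) (S v) (T v) (\<lambda>n. C * \<Delta> (M * n) + N * n)"
proof -
  note a = area_upper[OF D]
  obtain S' T' where wp: "word_presentation P collection S' T'" and ab: "area_bound P collection S' T' \<Delta>"
    and min: "\<And>g. area_bound P collection S' T' g \<Longrightarrow> \<Delta> \<le> g"
    using rel_dehn_function_words[OF \<Delta>] by blast
  obtain C M N where "area_bound P collection S' T' (\<lambda>n. C * D (2 * (M * n)) + N * n)"
    using change_presentation[OF presentation[OF a] wp a] by blast
  from min[OF this] have "\<forall>n. \<Delta> n \<le> C * D ((2 * M) * n) + N * n"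
    by (simp add: le_fun_def mult.assoc)
  then show "\<Delta> \<preceq> D" unfolding asymp_le_def by blast
  interpret gluing_vertex P Q vertex root A K \<tau> S \<H> T f v by unfold_locales
  obtain C M N where "area_bound P collection gens relators (\<lambda>n. C * \<Delta> (M * n) + N * n)"
    using change_presentation[OF wp presentation[OF a] ab] .
  from area_lower[OF this]
  have "area_bound P (base_collection v) (S v) (T v) (\<lambda>n. C * \<Delta> ((M * 3) * n) + (N * 3) * n)"
    by (simp add: mult.assoc)
  then show "\<exists>C M N. area_bound P (base_collection v) (S v) (T v) (\<lambda>n. C * \<Delta> (M * n) + N * n)"
    by blast
qed

end

section \<open>Presentations of embedded groups\<close>

text \<open>
  The presentation of \<open>G\<close> is transported along an embedding \<open>\<iota>\<close>. On the way, generators in \<open>B\<close> and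
  peripheral subgroups in \<open>X\<close> are dropped, their letters being rewritten as letters of the
  peripheral subgroup \<open>K\<close>.
\<close>

locale presentation_transport = group_hom G P \<iota>
  for G :: "'a monoid" and P :: "'p monoid" and \<iota> :: "'a \<Rightarrow> 'p" +
  fixes \<H> :: "'a set set" and S :: "'a set" and T :: "'a rel_letter list set" and f :: "nat \<Rightarrow> nat"
    and B :: "'p set" and X :: "'p set set" and K :: "'a set"
  assumes inj: "inj_on \<iota> (carrier G)"
    and wp: "word_presentation G \<H> S T" and f: "area_bound G \<H> S T f"
    and K: "K \<in> \<H>" and KX: "\<iota> ` K \<notin> X"
    and B: "\<And>s. s \<in> S \<Longrightarrow> \<iota> s \<in> B \<Longrightarrow> s \<in> K"
    and X: "\<And>H. H \<in> \<H> \<Longrightarrow> \<iota> ` H \<in> X \<Longrightarrow> H \<subseteq> K"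
begin

definition new_gens :: "'p set" where "new_gens = \<iota> ` S - B"

definition new_collection :: "'p set set" where "new_collection = image \<iota> ` \<H> - X"

fun push :: "'a rel_letter \<Rightarrow> 'p rel_letter list" where
  "push (Gen s) = [if \<iota> s \<in> B then Per (\<iota> ` K) (\<iota> s) else Gen (\<iota> s)]"
| "push (GenInv s) = [if \<iota> s \<in> B then Per (\<iota> ` K) (\<iota> (inv\<^bsub>G\<^esub> s)) else GenInv (\<iota> s)]"
| "push (Per H h) = [if \<iota> ` H \<in> X then Per (\<iota> ` K) (\<iota> h) else Per (\<iota> ` H) (\<iota> h)]"

abbreviation \<kappa> :: "'p \<Rightarrow> 'a" where "\<kappa> \<equiv> inv_into (carrier G) \<iota>"

text \<open>A section of \<open>push\<close>: applying \<open>push\<close> after \<open>pull\<close>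
  gives back the word, so only the composition in the other order can cost relators.\<close>

fun pull :: "'p rel_letter \<Rightarrow> 'a rel_letter list" where
  "pull (Gen x) = [Gen (\<kappa> x)]"
| "pull (GenInv x) = [GenInv (\<kappa> x)]"
| "pull (Per Y y) = [Per (\<kappa> ` Y) (\<kappa> y)]"

definition new_relators :: "'p rel_letter list set" where "new_relators = subst push ` T"

abbreviation "E \<equiv> rel_free_rels G S \<H>"
abbreviation "E' \<equiv> rel_free_rels P new_gens new_collection"
abbreviation "L \<equiv> rel_alphabet S \<H>"
abbreviation "L' \<equiv> rel_alphabet new_gens new_collection"

lemmas wpD = word_presentationD[OF wp]

lemma sub: "H \<in> \<H> \<Longrightarrow> subgroup H G"
  using wpD(1) by (simp add: group_pair_def)

lemma \<H>_closed: "H \<in> \<H> \<Longrightarrow> h \<in> H \<Longrightarrow> h \<in> carrier G"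
  by (rule subgroup.mem_carrier[OF sub])

lemma S_closed: "s \<in> S \<Longrightarrow> s \<in> carrier G"
  using wpD(3) by blast

lemma \<kappa>: "g \<in> carrier G \<Longrightarrow> \<kappa> (\<iota> g) = g"
  by (rule inv_into_f_f[OF inj])

lemma \<kappa>_image:
  assumes "H \<in> \<H>"
  shows "\<kappa> ` \<iota> ` H = H"
proof -
  have "\<kappa> ` \<iota> ` H = id ` H"
    unfolding image_image by (rule image_cong) (use \<kappa> \<H>_closed[OF assms] in auto)
  then show ?thesis by simp
qed

lemma new_group_pair: "group_pair P new_collection"
  using wpD(1) subgroup_img_is_subgroup[OF sub] H.is_group
  by (auto simp: group_pair_def new_collection_def)

lemma new_gens_closed: "new_gens \<subseteq> carrier P"
  using S_closed by (auto simp: new_gens_def)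

lemma K_new: "\<iota> ` K \<in> new_collection"
  using K KX by (auto simp: new_collection_def)

lemma push_letter: "l \<in> L \<Longrightarrow> push l \<in> lists L'"
  using B X K_new subgroup.m_inv_closed[OF sub[OF K]]
  by (cases l) (auto simp: rel_alphabet_iff new_gens_def new_collection_def)

lemma letter_closed: "l \<in> L \<Longrightarrow> letter_value G l \<in> carrier G"
  using S_closed \<H>_closed by (cases l) (auto simp: rel_alphabet_iff)

lemma push_value: "l \<in> L \<Longrightarrow> word_value P (push l) = \<iota> (letter_value G l)"
  using S_closed \<H>_closed by (cases l) (auto simp: rel_alphabet_iff)

lemma push_word_value:
  "w \<in> lists L \<Longrightarrow> word_value P (subst push w) = \<iota> (word_value G w)"
proof (induction w)
  case (Cons l w)
  then have l: "l \<in> L" and w: "w \<in> lists L" by auto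
  have "subst push w \<in> lists L'" by (rule subst_lists[OF push_letter w])
  then show ?case
    using word_value_append[OF new_group_pair new_gens_closed push_letter[OF l], of "subst push w"]
      push_value[OF l] letter_closed[OF l] word_value_closed[OF wpD(1,3) w] Cons.IH[OF w] by simp
qed simp

lemma push_rels:
  assumes "(u, v) \<in> E"
  shows "word_eq E' (subst push u) (subst push v)"
proof -
  have KE: "table_rels P Y (Per Y) \<subseteq> E'" if "Y \<in> new_collection" for Y
    using that by (auto simp: rel_free_rels_def)
  note Kw = word_eq_table[OF KE[OF K_new]]
  consider s where "s \<in> S" "u = [Gen s, GenInv s] \<or> u = [GenInv s, Gen s]" "v = []"
    | H where "H \<in> \<H>" "(u, v) \<in> table_rels G H (Per H)"
    using assms unfolding rel_free_rels_def by blast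
  then show ?thesis
  proof cases
    case 1
    show ?thesis
    proof (cases "\<iota> s \<in> B")
      case True
      have s: "s \<in> K" "inv\<^bsub>G\<^esub> s \<in> K" "s \<in> carrier G"
        using B[OF 1(1) True] subgroup.m_inv_closed[OF sub[OF K]] S_closed[OF 1(1)] by auto
      have "word_eq E' [Per (\<iota> ` K) (\<iota> x), Per (\<iota> ` K) (\<iota> y)] []"
        if "x \<in> K" "y \<in> K" "\<iota> x \<otimes>\<^bsub>P\<^esub> \<iota> y = \<one>\<^bsub>P\<^esub>" for x y
        using Kw(2)[of "\<iota> x" "\<iota> y"] Kw(1) that word_eq.trans by auto
      from this[OF s(1,2)] this[OF s(2,1)] show ?thesis using 1 True s(3) by auto
    next
      case False
      then have "\<iota> s \<in> new_gens" using 1(1) by (auto simp: new_gens_def)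
      then show ?thesis using 1 False by (auto simp: rel_free_rels_def intro!: word_eq_base)
    qed
  next
    case 2
    define Y where "Y = (if \<iota> ` H \<in> X then \<iota> ` K else \<iota> ` H)"
    have Y: "Y \<in> new_collection" using K_new 2(1) by (auto simp: Y_def new_collection_def)
    have HY: "\<iota> h \<in> Y" if "h \<in> H" for h using X[OF 2(1)] that by (auto simp: Y_def)
    have push: "push (Per H h) = [Per Y (\<iota> h)]" for h by (simp add: Y_def)
    from 2(2) consider "u = [Per H \<one>\<^bsub>G\<^esub>]" "v = []"
      | x y where "x \<in> H" "y \<in> H" "u = [Per H x, Per H y]" "v = [Per H (x \<otimes>\<^bsub>G\<^esub> y)]"
      by (auto simp: table_rels_def)
    then show ?thesis
    proof cases
      case 1
      then show ?thesis using word_eq_table(1)[OF KE[OF Y]] by (simp add: push del: push.simps(3))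
    next
      case (2 x y)
      then have "x \<in> carrier G" "y \<in> carrier G" using \<H>_closed \<open>H \<in> \<H>\<close> by auto
      then show ?thesis
        using word_eq_table(2)[OF KE[OF Y] HY HY, OF 2(1,2)] 2(3,4) by (simp add: push del: push.simps(3))
    qed
  qed
qed

lemma pull_letter: "l \<in> L' \<Longrightarrow> pull l \<in> lists L"
  by (cases l) (auto simp: rel_alphabet_iff new_gens_def new_collection_def \<kappa> S_closed \<H>_closed \<kappa>_image)

lemma push_pull: "l \<in> L' \<Longrightarrow> subst push (pull l) = [l]"
  by (cases l) (auto simp: rel_alphabet_iff new_gens_def new_collection_def \<kappa> S_closed \<H>_closed \<kappa>_image)

lemma push_pull_word: "w \<in> lists L' \<Longrightarrow> subst push (subst pull w) = w"
  by (induction w) (auto simp: push_pull)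

lemma pull_word_value:
  assumes w: "w \<in> lists L'" "word_value P w = \<one>\<^bsub>P\<^esub>"
  shows "word_value G (subst pull w) = \<one>\<^bsub>G\<^esub>"
proof -
  have p: "subst pull w \<in> lists L" by (rule subst_lists[OF pull_letter w(1)])
  have "\<iota> (word_value G (subst pull w)) = \<iota> \<one>\<^bsub>G\<^esub>"
    using push_word_value[OF p] push_pull_word[OF w(1)] w(2) by simp
  then show ?thesis
    using inj_onD[OF inj] word_value_closed[OF wpD(1,3) p] by simp
qed

lemma pull_rels:
  assumes "(u, v) \<in> E'"
  shows "word_eq E (subst pull u) (subst pull v)"
proof -
  consider x where "x \<in> new_gens" "u = [Gen x, GenInv x] \<or> u = [GenInv x, Gen x]" "v = []"
    | Y where "Y \<in> new_collection" "(u, v) \<in> table_rels P Y (Per Y)"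
    using assms unfolding rel_free_rels_def by blast
  then show ?thesis
  proof cases
    case 1
    then have "\<kappa> x \<in> S" using \<kappa> S_closed by (auto simp: new_gens_def)
    then show ?thesis using 1 by (auto simp: rel_free_rels_def intro!: word_eq_base)
  next
    case 2
    then obtain H where H: "H \<in> \<H>" "Y = \<iota> ` H" by (auto simp: new_collection_def)
    have HE: "table_rels G H (Per H) \<subseteq> E" using H(1) by (auto simp: rel_free_rels_def)
    from 2(2) consider "u = [Per Y \<one>\<^bsub>P\<^esub>]" "v = []"
      | x y where "x \<in> H" "y \<in> H" "u = [Per Y (\<iota> x), Per Y (\<iota> y)]" "v = [Per Y (\<iota> x \<otimes>\<^bsub>P\<^esub> \<iota> y)]"
      by (auto simp: table_rels_def H(2))
    then show ?thesis
    proof cases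
      case 1
      then show ?thesis
        using word_eq_table(1)[OF HE] \<kappa>[of "\<one>\<^bsub>G\<^esub>"] \<kappa>_image[OF H(1)] by (simp add: H(2))
    next
      case (2 x y)
      then have c: "x \<in> carrier G" "y \<in> carrier G" using \<H>_closed H(1) by auto
      then have "\<kappa> (\<iota> x \<otimes>\<^bsub>P\<^esub> \<iota> y) = x \<otimes>\<^bsub>G\<^esub> y" using \<kappa>[of "x \<otimes>\<^bsub>G\<^esub> y"] by simp
      then show ?thesis
        using word_eq_table(2)[OF HE 2(1,2)] 2(3,4) \<kappa>_image[OF H(1)] c \<kappa> by (simp add: H(2))
    qed
  qed
qed

text \<open>A dropped letter and its replacement in \<open>K\<close> have the same value, so the
  dropped letter followed by the inverse letter of \<open>K\<close> is a trivial word of length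
  2.\<close>

lemma pull_push_der:
  assumes l: "l \<in> L"
  shows "der E T (f 2) [l] (subst pull (push l))"
proof -
  have triv: "\<And>s. s \<in> S \<Longrightarrow> \<kappa> (\<iota> s) = s" "\<And>H h. H \<in> \<H> \<Longrightarrow> h \<in> H \<Longrightarrow> \<kappa> (\<iota> h) = h"
    using \<kappa> S_closed \<H>_closed by auto
  let ?k = "letter_value G l"
  show ?thesis
  proof (cases "subst pull (push l) = [l]")
    case False
    have "?k \<in> K \<and> subst pull (push l) = [Per K ?k]"
    proof (cases l)
      case (Gen s)
      then have s: "s \<in> S" using l by (simp add: rel_alphabet_iff)
      then have "\<iota> s \<in> B" using False triv(1) by (auto simp: Gen split: if_splits)
      then show ?thesis using B[OF s] triv(1)[OF s] \<kappa>_image[OF K] by (simp add: Gen)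
    next
      case (GenInv s)
      then have s: "s \<in> S" using l by (simp add: rel_alphabet_iff)
      then have "\<iota> s \<in> B" using False triv(1) by (auto simp: GenInv split: if_splits)
      then show ?thesis
        using B[OF s] \<kappa>[OF G.inv_closed[OF S_closed[OF s]]] \<kappa>_image[OF K] subgroup.m_inv_closed[OF sub[OF K]]
          S_closed[OF s] by (simp add: GenInv del: hom_inv)
    next
      case (Per H h)
      then have h: "H \<in> \<H>" "h \<in> H" using l by (auto simp: rel_alphabet_iff)
      then have "\<iota> ` H \<in> X" using False triv(2)[OF h] \<kappa>_image[OF h(1)] by (auto simp: Per split: if_splits)
      then show ?thesis using X[OF h(1)] h(2) triv(2)[OF h] \<kappa>_image[OF K] by (auto simp: Per)
    qed
    then have k: "?k \<in> K" and eq: "subst pull (push l) = [Per K ?k]" by auto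
    have kc: "?k \<in> carrier G" by (rule \<H>_closed[OF K k])
    have ik: "inv\<^bsub>G\<^esub> ?k \<in> K" using k subgroup.m_inv_closed[OF sub[OF K]] by blast
    let ?w = "[l, Per K (inv\<^bsub>G\<^esub> ?k)]"
    have "?w \<in> lists L" "word_value G ?w = \<one>\<^bsub>G\<^esub>" "length ?w \<le> 2"
      using l ik K kc by (auto simp: rel_alphabet_iff)
    then have d: "der E T (f 2) ?w []" using f unfolding area_bound_def by blast
    have KE: "table_rels G K (Per K) \<subseteq> E" using K by (auto simp: rel_free_rels_def)
    have "word_eq E [Per K (inv\<^bsub>G\<^esub> ?k), Per K ?k] []"
      using word_eq_table(2)[OF KE ik k] word_eq_table(1)[OF KE] kc word_eq.trans by simp
    from word_eq_context[OF this, of "[l]" "[]"]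
    have "word_eq E [l] (?w @ [Per K ?k])" using word_eq.sym by simp
    moreover have "der E T (f 2) (?w @ [Per K ?k]) [Per K ?k]"
      using der_context[OF d, of "[]" "[Per K ?k]"] by simp
    ultimately show ?thesis unfolding eq by (rule der_free_left)
  qed (simp add: der_refl)
qed

lemma new_relators_words:
  "new_relators \<subseteq> {w \<in> lists L'. word_value P w = \<one>\<^bsub>P\<^esub>}" "finite new_relators"
proof -
  show "finite new_relators" using wpD(5) by (simp add: new_relators_def)
  show "new_relators \<subseteq> {w \<in> lists L'. word_value P w = \<one>\<^bsub>P\<^esub>}"
  proof
    fix r assume "r \<in> new_relators"
    then obtain t where t: "t \<in> T" "r = subst push t" by (auto simp: new_relators_def)
    then have "t \<in> lists L" "word_value G t = \<one>\<^bsub>G\<^esub>" using wpD(6) by auto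
    then show "r \<in> {w \<in> lists L'. word_value P w = \<one>\<^bsub>P\<^esub>}"
      using subst_lists[OF push_letter] push_word_value t(2) by simp
  qed
qed

lemma new_words: "\<iota> ` carrier G \<subseteq> word_value P ` lists L'"
proof
  fix x assume "x \<in> \<iota> ` carrier G"
  then obtain w where w: "w \<in> lists L" "x = \<iota> (word_value G w)" using wpD(7) by blast
  show "x \<in> word_value P ` lists L'"
    unfolding w(2) push_word_value[OF w(1), symmetric] by (intro imageI subst_lists[OF push_letter w(1)])
qed

text \<open>The function \<open>f\<close> is kept without constants, because \<open>pull\<close>
  does not lengthen words and \<open>push\<close> takes relators to relators.\<close>

lemma new_area: "area_bound P new_collection new_gens new_relators f"
proof -
  have "area_bound P new_collection new_gens new_relators (\<lambda>n. 1 * f (1 * n) + 0 * n)"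
  proof (rule area_bound_transfer[OF f pull_letter _ pull_word_value push_rels])
    fix l :: "'p rel_letter"
    show "length (pull l) \<le> 1" by (cases l) auto
    assume "l \<in> L'"
    then show "der E' new_relators 0 [l] (subst push (pull l))" by (simp add: push_pull der_refl)
  next
    fix r assume "r \<in> T"
    then have "subst push r \<in> new_relators" by (simp add: new_relators_def)
    from der.rel[OF this, of E' 0 "[]" "[]"] show "der E' new_relators 1 (subst push r) []" by simp
  qed
  then show ?thesis by simp
qed

lemma new_presentation:
  "subgroup_presentation P (\<iota> ` carrier G) new_collection new_gens new_relators f"
proof -
  have "H \<subseteq> \<iota> ` carrier G" if "H \<in> new_collection" for H
    using that subgroup.subset[OF sub] by (auto simp: new_collection_def)
  then show ?thesis
    using new_group_pair S_closed wpD(4) new_relators_words new_words new_area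
    by (auto simp: subgroup_presentation_def new_gens_def)
qed

lemma old_area:
  assumes "area_bound P new_collection new_gens new_relators g"
  obtains C L where "area_bound G \<H> S T (\<lambda>n. C * g n + L * n)"
proof -
  have "\<exists>k. der E T k (subst pull r) []" if "r \<in> new_relators" for r
  proof -
    have r: "r \<in> lists L'" "word_value P r = \<one>\<^bsub>P\<^esub>" using that new_relators_words(1) by auto
    show ?thesis by (rule wpD(8)[OF subst_lists[OF pull_letter r(1)] pull_word_value[OF r]])
  qed
  then obtain C where C: "\<And>r. r \<in> new_relators \<Longrightarrow> der E T C (subst pull r) []"
    using der_uniform[OF new_relators_words(2), of E T "subst pull" "\<lambda>_. []"] by blast
  have "area_bound G \<H> S T (\<lambda>n. C * g (1 * n) + f 2 * n)"
  proof (rule area_bound_transfer[OF assms push_letter _ _ pull_rels C pull_push_der])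
    fix l :: "'a rel_letter"
    show "length (push l) \<le> 1" by (cases l) auto
  next
    fix w assume "w \<in> lists L" "word_value G w = \<one>\<^bsub>G\<^esub>"
    then show "word_value P (subst push w) = \<one>\<^bsub>P\<^esub>" by (simp add: push_word_value)
  qed
  then show ?thesis using that by simp
qed

lemma dehn_old:
  assumes "area_bound P new_collection new_gens new_relators (\<lambda>n. C * \<Delta> (M * n) + N * n)"
    and min: "\<And>g. area_bound G \<H> S T g \<Longrightarrow> \<Delta>' \<le> g"
  shows "\<Delta>' \<preceq> \<Delta>"
proof -
  obtain C' N' where "area_bound G \<H> S T (\<lambda>n. C' * (C * \<Delta> (M * n) + N * n) + N' * n)"
    using old_area[OF assms(1)] by blast
  from min[OF this] have "\<forall>n. \<Delta>' n \<le> (C' * C) * \<Delta> (M * n) + (C' * N + N') * n"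
    by (simp add: le_fun_def algebra_simps)
  then show ?thesis unfolding asymp_le_def by blast
qed

end

section \<open>Actions of presented groups\<close>

lemma foldr_closed: "(\<And>l x. x \<in> X \<Longrightarrow> act l x \<in> X) \<Longrightarrow> x \<in> X \<Longrightarrow> foldr act w x \<in> X"
  by (induction w) auto

lemma word_eq_act:
  assumes closed: "\<And>l x. x \<in> X \<Longrightarrow> act l x \<in> X"
    and R: "\<And>u v x. (u, v) \<in> R \<Longrightarrow> x \<in> X \<Longrightarrow> foldr act u x = foldr act v x"
    and "word_eq R u v"
  shows "\<forall>x\<in>X. foldr act u x = foldr act v x"
  using assms(3)
proof (induction rule: word_eq.induct)
  case (rel u v x y)
  then show ?case using R[OF rel] foldr_closed[of X act, OF closed] by simp
qed auto

text \<open>An element acts through a chosen word; by \<open>word_eq_act\<close> the choice is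
  immaterial on a set where the letters respect the relations.\<close>

definition word_action :: "('l \<Rightarrow> 'x \<Rightarrow> 'x) \<Rightarrow> 'l list set \<Rightarrow> 'x \<Rightarrow> 'x" where
  "word_action act p = foldr act (SOME w. w \<in> p)"

lemma word_action:
  assumes closed: "\<And>l x. x \<in> X \<Longrightarrow> act l x \<in> X"
    and R: "\<And>u v x. (u, v) \<in> R \<Longrightarrow> x \<in> X \<Longrightarrow> foldr act u x = foldr act v x" and x: "x \<in> X"
  shows "p \<in> carrier (presented L R) \<Longrightarrow> p' \<in> carrier (presented L R) \<Longrightarrow>
      word_action act (p \<otimes>\<^bsub>presented L R\<^esub> p') x = word_action act p (word_action act p' x)"
    and "word_action act \<one>\<^bsub>presented L R\<^esub> x = x"
    and "word_action act (word_class R w) x = foldr act w x"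
proof -
  have eq: "word_action act (word_class R w) x = foldr act w x" if "x \<in> X" for w x
  proof -
    have "(SOME v. v \<in> word_class R w) \<in> word_class R w"
      by (rule someI[of _ w]) (simp add: word_class_def word_eq.refl)
    then have "word_eq R w (SOME v. v \<in> word_class R w)" by (simp add: word_class_def)
    then show ?thesis using word_eq_act[of X act R, OF closed R] that unfolding word_action_def by auto
  qed
  show "word_action act (word_class R w) x = foldr act w x" by (rule eq[OF x])
  show "word_action act \<one>\<^bsub>presented L R\<^esub> x = x" using eq[OF x] by (simp add: presented_one)
  assume "p \<in> carrier (presented L R)" "p' \<in> carrier (presented L R)"
  then obtain u v where "p = word_class R u" "p' = word_class R v" by (auto simp: presented_carrier)
  then show "word_action act (p \<otimes>\<^bsub>presented L R\<^esub> p') x = word_action act p (word_action act p' x)"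
    using x foldr_closed[of X act x v, OF closed] by (simp add: presented_mult eq)
qed

lemma word_class_generated:
  assumes "group (presented L R)"
    and "\<And>l. l \<in> L \<Longrightarrow> word_class R [l] \<in> generate (presented L R) X"
  shows "carrier (presented L R) \<subseteq> generate (presented L R) X"
proof
  interpret group "presented L R" by fact
  fix p assume "p \<in> carrier (presented L R)"
  then obtain w where w: "w \<in> lists L" "p = word_class R w" by (auto simp: presented_carrier)
  have "word_class R w \<in> generate (presented L R) X"
    using w(1)
  proof (induction w)
    case Nil
    then show ?case using generate.one[of "presented L R" X] by (simp add: presented_one)
  next
    case (Cons l w)
    then show ?case
      using generate.eng[OF assms(2), of l "word_class R w"] by (simp add: presented_mult)
  qed
  then show "p \<in> generate (presented L R) X" by (simp add: w(2))
qed

lemma (in group) subgroup_carrier_update: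
  fixes K :: "'a set"
  assumes "subgroup K G" "subgroup C (G\<lparr>carrier := K\<rparr>)"
  shows "subgroup C G"
  using incl_subgroup assms by blast

text \<open>\<open>G\<close> is a free left \<open>C\<close>-set through \<delta>, with right coset
  representatives as orbit representatives. That \<one> is among them provides base points
  later.\<close>

lemma coset_bijection:
  fixes G :: "'a monoid" and C :: "'c monoid"
  assumes "group G" "group C" "\<delta> \<in> hom C G" and inj: "inj_on \<delta> (carrier C)"
  obtains R where "\<one>\<^bsub>G\<^esub> \<in> R" "R \<subseteq> carrier G"
    "bij_betw (\<lambda>(c, r). \<delta> c \<otimes>\<^bsub>G\<^esub> r) (carrier C \<times> R) (carrier G)"
proof -
  interpret G: group G by fact
  interpret C: group C by fact
  interpret d: group_hom C G \<delta> by unfold_locales fact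
  let ?H = "\<delta> ` carrier C"
  have H: "subgroup ?H G" by (rule d.img_is_subgroup)
  let ?rep = "G.right_rep ?H"
  define R where "R = {r \<in> carrier G. ?rep r = r}"
  have "inj_on (\<lambda>(c, r). \<delta> c \<otimes>\<^bsub>G\<^esub> r) (carrier C \<times> R)"
  proof (rule inj_onI, clarify)
    fix c r d s assume c: "c \<in> carrier C" "r \<in> R" and d: "d \<in> carrier C" "s \<in> R"
      and eq: "\<delta> c \<otimes>\<^bsub>G\<^esub> r = \<delta> d \<otimes>\<^bsub>G\<^esub> s"
    have "?rep (\<delta> c \<otimes>\<^bsub>G\<^esub> r) = r" "?rep (\<delta> d \<otimes>\<^bsub>G\<^esub> s) = s"
      using G.right_rep_mult[OF H] c d by (auto simp: R_def)
    then have "r = s" using eq by simp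
    then show "c = d \<and> r = s" using eq c d inj_onD[OF inj] by (simp add: R_def)
  qed
  moreover have "carrier G \<subseteq> (\<lambda>(c, r). \<delta> c \<otimes>\<^bsub>G\<^esub> r) ` (carrier C \<times> R)"
  proof
    fix g assume g: "g \<in> carrier G"
    note r = G.right_rep[OF H g]
    obtain c where c: "c \<in> carrier C" "g \<otimes>\<^bsub>G\<^esub> inv\<^bsub>G\<^esub> ?rep g = \<delta> c" using r(2) by blast
    have "g = \<delta> c \<otimes>\<^bsub>G\<^esub> ?rep g" unfolding c(2)[symmetric] using g r(1) by (simp add: G.m_assoc)
    then show "g \<in> (\<lambda>(c, r). \<delta> c \<otimes>\<^bsub>G\<^esub> r) ` (carrier C \<times> R)"
      using c(1) r(1) G.right_rep_rep[OF H g] by (intro image_eqI[of _ _ "(c, ?rep g)"]) (auto simp: R_def)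
  qed
  ultimately have "bij_betw (\<lambda>(c, r). \<delta> c \<otimes>\<^bsub>G\<^esub> r) (carrier C \<times> R) (carrier G)"
    by (auto simp: bij_betw_def R_def)
  then show ?thesis
    using that[of R] G.right_rep_H[OF H subgroup.one_closed[OF H]] by (simp add: R_def)
qed

text \<open>
  Both sides are free \<open>C\<close>-sets over the set of pairs of coset representatives, so injectivity
  of the base groups follows by letting the amalgam or the stable letter act through \<open>\<theta>\<close>.
\<close>

lemma equivariant_bijection:
  fixes G :: "'a monoid" and H :: "'b monoid" and C :: "'c monoid"
  assumes "group G" "group H" "group C" and \<delta>: "\<delta> \<in> hom C G" "inj_on \<delta> (carrier C)"
    and \<epsilon>: "\<epsilon> \<in> hom C H" "inj_on \<epsilon> (carrier C)"
  obtains Y Z \<theta> where "\<one>\<^bsub>H\<^esub> \<in> Y" "\<one>\<^bsub>G\<^esub> \<in> Z" "bij_betw \<theta> (carrier G \<times> Y) (carrier H \<times> Z)"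
    "\<And>c x. c \<in> carrier C \<Longrightarrow> x \<in> carrier G \<times> Y \<Longrightarrow>
      \<theta> (apfst ((\<otimes>\<^bsub>G\<^esub>) (\<delta> c)) x) = apfst ((\<otimes>\<^bsub>H\<^esub>) (\<epsilon> c)) (\<theta> x)"
proof -
  interpret G: group G by fact
  interpret H: group H by fact
  interpret C: group C by fact
  interpret d: group_hom C G \<delta> by unfold_locales fact
  interpret e: group_hom C H \<epsilon> by unfold_locales fact
  obtain R where R: "\<one>\<^bsub>G\<^esub> \<in> R" "R \<subseteq> carrier G"
    "bij_betw (\<lambda>(c, r). \<delta> c \<otimes>\<^bsub>G\<^esub> r) (carrier C \<times> R) (carrier G)"
    using coset_bijection[OF G.is_group C.is_group \<delta>] .
  obtain Y where Y: "\<one>\<^bsub>H\<^esub> \<in> Y" "Y \<subseteq> carrier H"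
    "bij_betw (\<lambda>(c, y). \<epsilon> c \<otimes>\<^bsub>H\<^esub> y) (carrier C \<times> Y) (carrier H)"
    using coset_bijection[OF H.is_group C.is_group \<epsilon>] .
  let ?X = "carrier C \<times> R \<times> Y"
  \<comment> \<open>From C \<times> R \<times> Y, the factor in \<open>C\<close> is absorbed either
    by \<open>R\<close>, giving G \<times> Y, or by \<open>Y\<close>, giving H \<times> R. The
    bijection \<theta> passes from one description to the other.\<close>
  define p where "p = (\<lambda>(c, r, y). (\<delta> c \<otimes>\<^bsub>G\<^esub> r, y :: 'b))"
  define q where "q = (\<lambda>(c, r :: 'a, y). (\<epsilon> c \<otimes>\<^bsub>H\<^esub> y, r))"
  have p: "bij_betw p ?X (carrier G \<times> Y)"
  proof (rule bij_betw_imageI)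
    show "inj_on p ?X" using bij_betw_imp_inj_on[OF R(3)] by (auto simp: inj_on_def p_def)
    have "p ` ?X = (\<lambda>(c, r). \<delta> c \<otimes>\<^bsub>G\<^esub> r) ` (carrier C \<times> R) \<times> Y" by (force simp: p_def)
    then show "p ` ?X = carrier G \<times> Y" unfolding bij_betw_imp_surj_on[OF R(3)] .
  qed
  have q: "bij_betw q ?X (carrier H \<times> R)"
  proof (rule bij_betw_imageI)
    show "inj_on q ?X" using bij_betw_imp_inj_on[OF Y(3)] by (auto simp: inj_on_def q_def)
    have "q ` ?X = (\<lambda>(c, y). \<epsilon> c \<otimes>\<^bsub>H\<^esub> y) ` (carrier C \<times> Y) \<times> R" by (force simp: q_def)
    then show "q ` ?X = carrier H \<times> R" unfolding bij_betw_imp_surj_on[OF Y(3)] .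
  qed
  let ?\<theta> = "\<lambda>x. q (inv_into ?X p x)"
  have \<theta>: "?\<theta> (p x) = q x" if "x \<in> ?X" for x
    using bij_betw_inv_into_left[OF p that] by simp
  show ?thesis
  proof (rule that[OF Y(1) R(1)])
    show "bij_betw ?\<theta> (carrier G \<times> Y) (carrier H \<times> R)"
      using bij_betw_trans[OF bij_betw_inv_into[OF p] q] by (simp add: comp_def)
    fix c x assume c: "c \<in> carrier C" and "x \<in> carrier G \<times> Y"
    then obtain d r y where x: "x = p (d, r, y)" and d: "d \<in> carrier C" "r \<in> R" "y \<in> Y"
      using bij_betw_imp_surj_on[OF p] by force
    have "r \<in> carrier G" "y \<in> carrier H" using d R(2) Y(2) by auto
    then have "apfst ((\<otimes>\<^bsub>G\<^esub>) (\<delta> c)) x = p (c \<otimes>\<^bsub>C\<^esub> d, r, y)"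
      and "apfst ((\<otimes>\<^bsub>H\<^esub>) (\<epsilon> c)) (q (d, r, y)) = q (c \<otimes>\<^bsub>C\<^esub> d, r, y)"
      using c d(1) by (simp_all add: x p_def q_def G.m_assoc H.m_assoc)
    then show "?\<theta> (apfst ((\<otimes>\<^bsub>G\<^esub>) (\<delta> c)) x) = apfst ((\<otimes>\<^bsub>H\<^esub>) (\<epsilon> c)) (?\<theta> x)"
      using \<theta>[of "(c \<otimes>\<^bsub>C\<^esub> d, r, y)"] \<theta>[of "(d, r, y)"] c d x by simp
  qed
qed

section \<open>Amalgamated products\<close>

lemma rel_dehn_function_pair: "rel_dehn_function G \<H> \<Delta> \<Longrightarrow> H \<in> \<H> \<Longrightarrow> subgroup H G"
  unfolding rel_dehn_function_def group_pair_def by blast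

text \<open>Monotonicity of \<open>h\<close> allows both scaling factors to be replaced by their
  sum.\<close>

lemma asymp_le_max: "f \<preceq> h \<Longrightarrow> g \<preceq> h \<Longrightarrow> (\<lambda>n. max (f n) (g n)) \<preceq> (h :: nat \<Rightarrow> nat)" if "mono h" for h
proof -
  assume "f \<preceq> h" "g \<preceq> h"
  then obtain C K L C' K' L' where f: "\<And>n. f n \<le> C * h (K * n) + L * n" and g: "\<And>n. g n \<le> C' * h (K' * n) + L' * n"
    unfolding asymp_le_def by blast
  have "max (f n) (g n) \<le> (C + C') * h ((K + K') * n) + (L + L') * n" for n
  proof -
    have "h (K * n) \<le> h ((K + K') * n)" "h (K' * n) \<le> h ((K + K') * n)"
      by (rule monoD[OF that], simp)+
    then have "C * h (K * n) \<le> C * h ((K + K') * n)" "C' * h (K' * n) \<le> C' * h ((K + K') * n)" by auto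
    then have "f n \<le> C * h ((K + K') * n) + L * n" "g n \<le> C' * h ((K + K') * n) + L' * n"
      using f[of n] g[of n] by linarith+
    then show ?thesis by (simp add: add_mult_distrib)
  qed
  then show ?thesis unfolding asymp_le_def by blast
qed

lemma asymp_le_trans_double:
  fixes g :: "nat \<Rightarrow> nat"
  assumes "f \<preceq> g" "\<And>n. g n \<le> 2 * h n"
  shows "f \<preceq> h"
proof -
  obtain C K L where "\<And>n. f n \<le> C * g (K * n) + L * n" using assms(1) unfolding asymp_le_def by blast
  moreover have "C * g (K * n) \<le> C * (2 * h (K * n))" for n using assms(2) by simp
  ultimately have "\<And>n. f n \<le> (C * 2) * h (K * n) + L * n"
    unfolding mult.assoc by (meson add_le_mono1 le_trans)
  then show ?thesis unfolding asymp_le_def by blast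
qed

text \<open>The bound at \<open>n\<close> also covers words of length at most \<open>m\<close>, so
  minimality at \<open>m\<close> gives the inequality.\<close>

lemma rel_dehn_function_mono:
  assumes "rel_dehn_function G \<H> \<Delta>"
  shows "mono \<Delta>"
proof (rule monoI)
  fix m n :: nat assume mn: "m \<le> n"
  obtain S T where ab: "area_bound G \<H> S T \<Delta>" and min: "\<And>g. area_bound G \<H> S T g \<Longrightarrow> \<Delta> \<le> g"
    using rel_dehn_function_words[OF assms] by blast
  have "area_bound G \<H> S T (\<Delta>(m := \<Delta> n))"
    using ab mn unfolding area_bound_def by (metis fun_upd_apply le_trans)
  from le_funD[OF min[OF this], of m] show "\<Delta> m \<le> \<Delta> n" by simp
qed

lemma superadditive_add: "superadditive f \<Longrightarrow> superadditive g \<Longrightarrow> superadditive (\<lambda>n. f n + g n)"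
  unfolding superadditive_def by (auto intro: add_mono simp: algebra_simps) (metis add.assoc add.left_commute add_mono)

section \<open>Amalgamated products as gluings with two base groups\<close>

locale amalg_setting =
  G1: group G1 + G2: group G2 + C: group C
  for G1 :: "'a monoid" and G2 :: "'b monoid" and C :: "'c monoid" +
  fixes \<delta>1 \<delta>2 K1 K2
  assumes K1: "subgroup K1 G1" and K2: "subgroup K2 G2"
    and \<delta>1: "\<delta>1 \<in> mon C (G1\<lparr>carrier := K1\<rparr>)" and \<delta>2: "\<delta>2 \<in> mon C (G2\<lparr>carrier := K2\<rparr>)"
begin

definition P :: "('a + 'b) list set monoid" where "P = amalg G1 G2 C \<delta>1 \<delta>2"
definition \<iota>1 :: "'a \<Rightarrow> ('a + 'b) list set" where "\<iota>1 = amalg_inl G1 G2 C \<delta>1 \<delta>2"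
definition \<iota>2 :: "'b \<Rightarrow> ('a + 'b) list set" where "\<iota>2 = amalg_inr G1 G2 C \<delta>1 \<delta>2"
definition Q :: "('a + 'b) list set set" where "Q = generate P (\<iota>1 ` K1 \<union> \<iota>2 ` K2)"
definition A :: "bool \<Rightarrow> ('a + 'b) list set set" where
  "A v = (if v then \<iota>1 ` carrier G1 else \<iota>2 ` carrier G2)"
definition K :: "bool \<Rightarrow> ('a + 'b) list set set" where
  "K v = (if v then \<iota>1 ` K1 else \<iota>2 ` K2)"

sublocale P: group P
  unfolding P_def by (rule group_amalg) unfold_locales

sublocale h1: group_hom G1 P \<iota>1
  by unfold_locales (auto simp: P_def \<iota>1_def amalg_inl_hom)

sublocale h2: group_hom G2 P \<iota>2
  by unfold_locales (auto simp: P_def \<iota>2_def amalg_inr_hom)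

lemma K1_closed: "k \<in> K1 \<Longrightarrow> k \<in> carrier G1" and K2_closed: "l \<in> K2 \<Longrightarrow> l \<in> carrier G2"
  using subgroup.mem_carrier[OF K1] subgroup.mem_carrier[OF K2] by auto

lemma \<delta>_K: "c \<in> carrier C \<Longrightarrow> \<delta>1 c \<in> K1" "c \<in> carrier C \<Longrightarrow> \<delta>2 c \<in> K2"
  using \<delta>1 \<delta>2 by (auto simp: mon_def hom_def)

lemma \<delta>_hom: "\<delta>1 \<in> hom C G1" "\<delta>2 \<in> hom C G2" and \<delta>_inj: "inj_on \<delta>1 (carrier C)" "inj_on \<delta>2 (carrier C)"
  using \<delta>1 \<delta>2 K1_closed K2_closed by (auto simp: mon_def hom_def)

abbreviation R where "R \<equiv> amalg_rels G1 G2 C \<delta>1 \<delta>2"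

lemma P_presented: "P = presented (Inl ` carrier G1 \<union> Inr ` carrier G2) R"
  by (simp add: P_def amalg_def)

lemma letters: "word_class R [Inl g] = \<iota>1 g" "word_class R [Inr h] = \<iota>2 h"
  by (simp_all add: \<iota>1_def \<iota>2_def amalg_inl_def amalg_inr_def)

lemma generated: "carrier P \<subseteq> generate P (\<iota>1 ` carrier G1 \<union> \<iota>2 ` carrier G2)"
proof -
  have "word_class R [l] \<in> generate P (\<iota>1 ` carrier G1 \<union> \<iota>2 ` carrier G2)"
    if "l \<in> Inl ` carrier G1 \<union> Inr ` carrier G2" for l
    using that letters by (auto intro: generate.incl)
  then show ?thesis
    using word_class_generated[of "Inl ` carrier G1 \<union> Inr ` carrier G2" R] P.is_group
    unfolding P_presented by blast
qed

text \<open>The universal property in the form of actions on a set \<open>X\<close>. It is applied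
  to free \<open>C\<close>-sets for injectivity and to normal forms.\<close>

lemma action:
  assumes closed: "\<And>g x. g \<in> carrier G1 \<Longrightarrow> x \<in> X \<Longrightarrow> a g x \<in> X" "\<And>h x. h \<in> carrier G2 \<Longrightarrow> x \<in> X \<Longrightarrow> b h x \<in> X"
    and one: "\<And>x. x \<in> X \<Longrightarrow> a \<one>\<^bsub>G1\<^esub> x = x" "\<And>x. x \<in> X \<Longrightarrow> b \<one>\<^bsub>G2\<^esub> x = x"
    and mult: "\<And>g g' x. g \<in> carrier G1 \<Longrightarrow> g' \<in> carrier G1 \<Longrightarrow> x \<in> X \<Longrightarrow> a (g \<otimes>\<^bsub>G1\<^esub> g') x = a g (a g' x)"
      "\<And>h h' x. h \<in> carrier G2 \<Longrightarrow> h' \<in> carrier G2 \<Longrightarrow> x \<in> X \<Longrightarrow> b (h \<otimes>\<^bsub>G2\<^esub> h') x = b h (b h' x)"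
    and glue: "\<And>c x. c \<in> carrier C \<Longrightarrow> x \<in> X \<Longrightarrow> a (\<delta>1 c) x = b (\<delta>2 c) x"
  obtains \<alpha> where
    "\<And>p p' x. p \<in> carrier P \<Longrightarrow> p' \<in> carrier P \<Longrightarrow> x \<in> X \<Longrightarrow> \<alpha> (p \<otimes>\<^bsub>P\<^esub> p') x = \<alpha> p (\<alpha> p' x)"
    "\<And>x. x \<in> X \<Longrightarrow> \<alpha> \<one>\<^bsub>P\<^esub> x = x"
    "\<And>g x. g \<in> carrier G1 \<Longrightarrow> x \<in> X \<Longrightarrow> \<alpha> (\<iota>1 g) x = a g x"
    "\<And>h x. h \<in> carrier G2 \<Longrightarrow> x \<in> X \<Longrightarrow> \<alpha> (\<iota>2 h) x = b h x"
proof -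
  define act where "act = (\<lambda>l x. case l of Inl g \<Rightarrow> if g \<in> carrier G1 then a g x else x
    | Inr h \<Rightarrow> if h \<in> carrier G2 then b h x else x)"
  have act_closed: "act l x \<in> X" if "x \<in> X" for l x
    using that closed by (cases l) (auto simp: act_def)
  have rels: "foldr act u x = foldr act v x" if "(u, v) \<in> R" and x: "x \<in> X" for u v x
    using that one mult glue \<delta>_hom by (auto simp: amalg_rels_def table_rels_def act_def hom_def)
  note act_word = word_action(3)[of X act R, OF act_closed rels]
  note action = word_action(1,2)[of X act R, OF act_closed rels, where L = "Inl ` carrier G1 \<union> Inr ` carrier G2",
      folded P_presented]
  show ?thesis
  proof (rule that[of "word_action act"])
    show "word_action act (\<iota>1 g) x = a g x" if "g \<in> carrier G1" "x \<in> X" for g x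
      using act_word[of x "[Inl g]"] that by (simp add: letters act_def)
    show "word_action act (\<iota>2 h) x = b h x" if "h \<in> carrier G2" "x \<in> X" for h x
      using act_word[of x "[Inr h]"] that by (simp add: letters act_def)
  qed (use action in auto)
qed

text \<open>\<open>G2\<close> acts on G1 \<times> Y by transport along \<theta>, and equivariance
  makes both actions agree on \<open>C\<close>. Both base groups act by left translation, seen on
  one side of \<theta> or the other, so the point with both coordinates \<one> separates their
  elements.\<close>

lemma inj: "inj_on \<iota>1 (carrier G1)" "inj_on \<iota>2 (carrier G2)"
proof -
  obtain Y Z \<theta> where one: "\<one>\<^bsub>G2\<^esub> \<in> Y" "\<one>\<^bsub>G1\<^esub> \<in> Z"
    and \<theta>: "bij_betw \<theta> (carrier G1 \<times> Y) (carrier G2 \<times> Z)"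
    and equi: "\<And>c x. c \<in> carrier C \<Longrightarrow> x \<in> carrier G1 \<times> Y \<Longrightarrow>
      \<theta> (apfst ((\<otimes>\<^bsub>G1\<^esub>) (\<delta>1 c)) x) = apfst ((\<otimes>\<^bsub>G2\<^esub>) (\<delta>2 c)) (\<theta> x)"
    using equivariant_bijection[OF G1.is_group G2.is_group C.is_group \<delta>_hom(1) \<delta>_inj(1) \<delta>_hom(2) \<delta>_inj(2)]
    by blast
  let ?X = "carrier G1 \<times> Y" and ?X' = "carrier G2 \<times> Z"
  let ?\<theta>' = "inv_into ?X \<theta>"
  have \<theta>_mem: "\<theta> x \<in> ?X'" "?\<theta>' (\<theta> x) = x" if "x \<in> ?X" for x
    using that bij_betwE[OF \<theta>] bij_betw_inv_into_left[OF \<theta>] by auto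
  have \<theta>'_mem: "?\<theta>' y \<in> ?X" "\<theta> (?\<theta>' y) = y" if "y \<in> ?X'" for y
    using that bij_betwE[OF bij_betw_inv_into[OF \<theta>]] bij_betw_inv_into_right[OF \<theta>] by auto
  have sh: "apfst ((\<otimes>\<^bsub>G2\<^esub>) h) y \<in> ?X'" if "h \<in> carrier G2" "y \<in> ?X'" for h y using that by auto
  let ?a = "\<lambda>g. apfst ((\<otimes>\<^bsub>G1\<^esub>) g)" and ?b = "\<lambda>h x. ?\<theta>' (apfst ((\<otimes>\<^bsub>G2\<^esub>) h) (\<theta> x))"
  obtain \<alpha> where \<alpha>: "\<And>g x. g \<in> carrier G1 \<Longrightarrow> x \<in> ?X \<Longrightarrow> \<alpha> (\<iota>1 g) x = ?a g x"
    "\<And>h x. h \<in> carrier G2 \<Longrightarrow> x \<in> ?X \<Longrightarrow> \<alpha> (\<iota>2 h) x = ?b h x"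
  proof (rule action[of ?X ?a ?b])
    fix h h' x assume h: "h \<in> carrier G2" "h' \<in> carrier G2" and x: "x \<in> ?X"
    have "apfst ((\<otimes>\<^bsub>G2\<^esub>) (h \<otimes>\<^bsub>G2\<^esub> h')) (\<theta> x) = apfst ((\<otimes>\<^bsub>G2\<^esub>) h) (apfst ((\<otimes>\<^bsub>G2\<^esub>) h') (\<theta> x))"
      using h \<theta>_mem(1)[OF x] by (auto simp: G2.m_assoc)
    then show "?b (h \<otimes>\<^bsub>G2\<^esub> h') x = ?b h (?b h' x)"
      using \<theta>'_mem(2)[OF sh[OF h(2) \<theta>_mem(1)[OF x]]] by simp
  next
    fix x assume x: "x \<in> ?X"
    have "apfst ((\<otimes>\<^bsub>G2\<^esub>) \<one>\<^bsub>G2\<^esub>) (\<theta> x) = \<theta> x" using \<theta>_mem(1)[OF x] by auto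
    then show "?b \<one>\<^bsub>G2\<^esub> x = x" using \<theta>_mem(2)[OF x] by simp
  next
    fix c x assume c: "c \<in> carrier C" and x: "x \<in> ?X"
    have "?a (\<delta>1 c) x \<in> ?X" using hom_in_carrier[OF \<delta>_hom(1) c] x by auto
    then show "?a (\<delta>1 c) x = ?b (\<delta>2 c) x" using \<theta>_mem(2) equi[OF c x] by metis
  qed (use \<theta>'_mem(1)[OF sh[OF _ \<theta>_mem(1)]] G1.m_assoc in auto)
  show "inj_on \<iota>1 (carrier G1)"
  proof (rule inj_onI)
    fix g h assume g: "g \<in> carrier G1" "h \<in> carrier G1" "\<iota>1 g = \<iota>1 h"
    then have "?a g (\<one>\<^bsub>G1\<^esub>, \<one>\<^bsub>G2\<^esub>) = ?a h (\<one>\<^bsub>G1\<^esub>, \<one>\<^bsub>G2\<^esub>)"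
      using \<alpha>(1)[of _ "(\<one>\<^bsub>G1\<^esub>, \<one>\<^bsub>G2\<^esub>)"] one by (metis G1.one_closed mem_Sigma_iff)
    then show "g = h" using g by simp
  qed
  show "inj_on \<iota>2 (carrier G2)"
  proof (rule inj_onI)
    fix g h assume g: "g \<in> carrier G2" "h \<in> carrier G2" "\<iota>2 g = \<iota>2 h"
    have y: "(\<one>\<^bsub>G2\<^esub>, \<one>\<^bsub>G1\<^esub>) \<in> ?X'" using one by simp
    have "\<theta> (?b k (?\<theta>' (\<one>\<^bsub>G2\<^esub>, \<one>\<^bsub>G1\<^esub>))) = (k, \<one>\<^bsub>G1\<^esub>)" if "k \<in> carrier G2" for k
      using \<theta>'_mem(2)[OF y] \<theta>'_mem(2)[OF sh[OF that y]] that by simp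
    then show "g = h" using \<alpha>(2)[OF _ \<theta>'_mem(1)[OF y]] g by (metis Pair_inject)
  qed
qed

lemma Q_incl: "k \<in> K1 \<Longrightarrow> \<iota>1 k \<in> Q" "l \<in> K2 \<Longrightarrow> \<iota>2 l \<in> Q"
  unfolding Q_def by (auto intro!: generate.incl)

sublocale gluing P Q "\<lambda>v :: bool. v" "\<lambda>v. v" A K "\<lambda>_. \<one>\<^bsub>P\<^esub>"
proof (intro gluing.intro gluing_axioms.intro P.is_group)
  show "subgroup Q P" unfolding Q_def
    by (rule P.generate_is_subgroup) (use K1_closed K2_closed in auto)
  fix v :: bool
  show "subgroup (A v) P" unfolding A_def using h1.img_is_subgroup h2.img_is_subgroup by simp
  show "subgroup (K v) P" unfolding K_def
    using h1.subgroup_img_is_subgroup[OF K1] h2.subgroup_img_is_subgroup[OF K2] by simp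
  show "K v \<subseteq> A v" using K1_closed K2_closed by (auto simp: A_def K_def)
  show "conj_set P (K v) \<one>\<^bsub>P\<^esub> \<subseteq> Q"
    using K1_closed K2_closed Q_incl by (auto simp: conj_set_def K_def)
qed auto

sublocale gluing_normal P Q "\<lambda>v :: bool. v" "\<lambda>v. v" A K "\<lambda>_. \<one>\<^bsub>P\<^esub>"
proof
  \<comment> \<open>The common image lies in both edge groups, so both sides are translation by the
    same element of \<open>Q\<close>.\<close>
  have glue: "excursion True (\<iota>1 (\<delta>1 c)) True x = excursion False (\<iota>2 (\<delta>2 c)) False x"
    if c: "c \<in> carrier C" and x: "x \<in> forms None" for c x
  proof -
    have "\<iota>1 (\<delta>1 c) = \<iota>2 (\<delta>2 c)" using amalg_glue[OF c] by (simp add: \<iota>1_def \<iota>2_def)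
    moreover have "\<iota>1 (\<delta>1 c) \<in> K True" "\<iota>2 (\<delta>2 c) \<in> K False" using \<delta>_K[OF c] by (auto simp: K_def)
    ultimately show ?thesis using excursion_K[OF x] by simp
  qed
  obtain \<alpha> where
    mult: "\<And>p p' x. p \<in> carrier P \<Longrightarrow> p' \<in> carrier P \<Longrightarrow> x \<in> forms None \<Longrightarrow> \<alpha> (p \<otimes>\<^bsub>P\<^esub> p') x = \<alpha> p (\<alpha> p' x)"
    and one: "\<And>x. x \<in> forms None \<Longrightarrow> \<alpha> \<one>\<^bsub>P\<^esub> x = x"
    and base: "\<And>g x. g \<in> carrier G1 \<Longrightarrow> x \<in> forms None \<Longrightarrow> \<alpha> (\<iota>1 g) x = excursion True (\<iota>1 g) True x"
      "\<And>h x. h \<in> carrier G2 \<Longrightarrow> x \<in> forms None \<Longrightarrow> \<alpha> (\<iota>2 h) x = excursion False (\<iota>2 h) False x"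
    by (rule action[of "forms None" "\<lambda>g. excursion True (\<iota>1 g) True" "\<lambda>h. excursion False (\<iota>2 h) False"])
      (auto simp: A_def excursion_one excursion_mult glue intro!: excursion_closed)
  show has_normal_forms
  proof (rule normal_form[OF mult])
    fix q x assume q: "q \<in> Q" and x: "x \<in> forms None"
    show "\<alpha> q x = translate q x"
    proof (rule generated_translate[OF mult one Q_def _ q x])
      fix h x assume h: "h \<in> \<iota>1 ` K1 \<union> \<iota>2 ` K2" and x: "x \<in> forms None"
      show "\<alpha> h x = translate h x"
        using h base[OF _ x] excursion_K[OF x, of h True] excursion_K[OF x, of h False]
          K1_closed K2_closed by (auto simp: K_def)
    qed
  next
    fix i j :: bool and a x assume ij: "i = j" and a: "a \<in> A i" and x: "x \<in> forms None"
    have "a \<in> carrier P" using a A_closed by blast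
    then show "\<alpha> (\<one>\<^bsub>P\<^esub> \<otimes>\<^bsub>P\<^esub> a \<otimes>\<^bsub>P\<^esub> inv\<^bsub>P\<^esub> \<one>\<^bsub>P\<^esub>) x = excursion i a j x"
      using a ij base[OF _ x] by (auto simp: A_def split: if_splits)
  qed
qed

end

theorem (in amalg_setting) dehn:
  assumes notin: "K1 \<notin> \<H>1" "K2 \<notin> \<H>2"
    and \<Delta>: "rel_dehn_function P ((image \<iota>1 ` \<H>1 \<union> image \<iota>2 ` \<H>2) \<union> {Q}) \<Delta>"
    and \<Delta>1: "rel_dehn_function G1 (\<H>1 \<union> {K1}) \<Delta>1"
    and \<Delta>2: "rel_dehn_function G2 (\<H>2 \<union> {K2}) \<Delta>2"
  shows "(\<lambda>n. max (\<Delta>1 n) (\<Delta>2 n)) \<preceq> \<Delta> \<and>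
    \<Delta> \<preceq> (\<lambda>n. max (superadd_closure \<Delta>1 n) (superadd_closure \<Delta>2 n))"
proof -
  obtain S1 T1 where 1: "word_presentation G1 (\<H>1 \<union> {K1}) S1 T1" "area_bound G1 (\<H>1 \<union> {K1}) S1 T1 \<Delta>1"
    "\<And>f. area_bound G1 (\<H>1 \<union> {K1}) S1 T1 f \<Longrightarrow> \<Delta>1 \<le> f"
    using rel_dehn_function_words[OF \<Delta>1] by blast
  obtain S2 T2 where 2: "word_presentation G2 (\<H>2 \<union> {K2}) S2 T2" "area_bound G2 (\<H>2 \<union> {K2}) S2 T2 \<Delta>2"
    "\<And>f. area_bound G2 (\<H>2 \<union> {K2}) S2 T2 f \<Longrightarrow> \<Delta>2 \<le> f"
    using rel_dehn_function_words[OF \<Delta>2] by blast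
  let ?\<H> = "(image \<iota>1 ` \<H>1 \<union> image \<iota>2 ` \<H>2) \<union> {Q}"
  have sub1: "\<And>H. H \<in> \<H>1 \<union> {K1} \<Longrightarrow> subgroup H G1" and sub2: "\<And>H. H \<in> \<H>2 \<union> {K2} \<Longrightarrow> subgroup H G2"
    using rel_dehn_function_pair \<Delta>1 \<Delta>2 by blast+
  have img1: "H = H'" if "\<iota>1 ` H = \<iota>1 ` H'" "subgroup H G1" "subgroup H' G1" for H H'
    using that subgroup.subset inj_on_image_eq_iff[OF inj(1)] by metis
  have img2: "H = H'" if "\<iota>2 ` H = \<iota>2 ` H'" "subgroup H G2" "subgroup H' G2" for H H'
    using that subgroup.subset inj_on_image_eq_iff[OF inj(2)] by metis
  \<comment> \<open>An element common to both base groups lies in the edge group, so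
    \<open>K2\<close> can express whatever is dropped from the second presentation.\<close>
  have AK2: "h \<in> K2" if "h \<in> carrier G2" "\<iota>2 h \<in> A True" for h
  proof -
    have "\<iota>2 h \<in> \<iota>2 ` K2" using A_inter_A[of False True "\<iota>2 h"] that by (simp add: A_def K_def)
    then show ?thesis
      using inj_on_image_mem_iff[OF inj(2) that(1)] subgroup.subset[OF K2] by blast
  qed
  \<comment> \<open>The image of \<open>K2\<close> is kept even if it coincides with a peripheral
    subgroup from the first group, because the dropped letters are rewritten in it.\<close>
  define X where "X = image \<iota>1 ` \<H>1 - {\<iota>2 ` K2}"
  have X: "H \<subseteq> K2" if H: "H \<in> \<H>2 \<union> {K2}" "\<iota>2 ` H \<in> X" for H
  proof
    fix h assume h: "h \<in> H"
    obtain H1 where "H1 \<in> \<H>1" "\<iota>2 ` H = \<iota>1 ` H1" using H(2) by (auto simp: X_def)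
    then have "\<iota>2 h \<in> \<iota>1 ` H1" "H1 \<subseteq> carrier G1" using h subgroup.subset[OF sub1] by auto
    then have "\<iota>2 h \<in> A True" by (auto simp: A_def)
    then show "h \<in> K2" using AK2[OF subgroup.mem_carrier[OF sub2[OF H(1)] h]] by blast
  qed
  interpret t1: presentation_transport G1 P \<iota>1 "\<H>1 \<union> {K1}" S1 T1 \<Delta>1 "{}" "{}" K1
    by unfold_locales (use 1 inj in auto)
  interpret t2: presentation_transport G2 P \<iota>2 "\<H>2 \<union> {K2}" S2 T2 \<Delta>2 "A True" X K2
  proof -
    have "s \<in> K2" if "s \<in> S2" "\<iota>2 s \<in> A True" for s
      using AK2 that word_presentationD(3)[OF 2(1)] by blast
    moreover have "\<iota>2 ` K2 \<notin> X" by (simp add: X_def)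
    ultimately show "presentation_transport G2 P \<iota>2 (\<H>2 \<union> {K2}) S2 T2 \<Delta>2 (A True) X K2"
      using h2.group_hom_axioms inj(2) 2 X
      by (auto simp: presentation_transport_def presentation_transport_axioms_def)
  qed
  define gen where "gen = (\<lambda>v. if v then t1.new_gens else t2.new_gens)"
  define coll where "coll = (\<lambda>v. if v then image \<iota>1 ` \<H>1 else image \<iota>2 ` \<H>2 - X)"
  define relator where "relator = (\<lambda>v. if v then t1.new_relators else t2.new_relators)"
  define dehn where "dehn = (\<lambda>v. if v then \<Delta>1 else \<Delta>2)"
  have c1: "coll True \<union> K ` {j. j = True} = t1.new_collection"
    unfolding t1.new_collection_def by (auto simp: coll_def K_def)
  have c2: "coll False \<union> K ` {j. j = False} = t2.new_collection"
    unfolding t2.new_collection_def by (auto simp: coll_def K_def X_def)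
  interpret gp: gluing_presented P Q "\<lambda>v :: bool. v" "\<lambda>v. v" A K "\<lambda>_. \<one>\<^bsub>P\<^esub>" gen coll relator dehn
  proof (rule gluing_presented.intro[OF gluing_normal_axioms gluing_presented_axioms.intro], goal_cases)
    case (1 v)
    then show ?case
      using t1.new_presentation t2.new_presentation c1 c2
      by (cases v) (simp_all add: A_def gen_def relator_def dehn_def)
  next
    case (2 i j)
    then show ?case by simp
  next
    case (3 j)
    then show ?case
      using img1[of K1] img2[of K2] sub1 sub2 notin by (cases j) (auto simp: coll_def K_def)
  next
    case (4 H u v)
    show ?case
    proof (rule ccontr)
      assume "u \<noteq> v"
      then have "H \<in> image \<iota>1 ` \<H>1" "H \<in> image \<iota>2 ` \<H>2 - X" using 4 by (auto simp: coll_def split: if_splits)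
      then show False using img2[of K2] sub2 notin(2) by (auto simp: X_def)
    qed
  next
    case (5 s u v)
    have "t1.new_gens \<inter> t2.new_gens = {}"
      using t1.S_closed unfolding t1.new_gens_def t2.new_gens_def by (auto simp: A_def)
    then show ?case using 5 by (auto simp: gen_def split: if_splits)
  next
    case 7
    show ?case
      using generated P.mono_generate[of "\<iota>1 ` carrier G1 \<union> \<iota>2 ` carrier G2" "(\<Union>v. A v) \<union> range (\<lambda>_. \<one>\<^bsub>P\<^esub>) \<union> Q"]
      by (auto simp: A_def UNIV_bool)
  qed auto
  have coll: "gp.collection = ?\<H>"
    unfolding gp.collection_def by (auto simp: coll_def X_def)
  have z: "\<Delta>1 0 = 0" "\<Delta>2 0 = 0" using rel_dehn_function_0 \<Delta>1 \<Delta>2 by blast+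
  \<comment> \<open>A maximum of superadditive functions need not be superadditive. The sum is, and
    it is at most twice the maximum.\<close>
  let ?D = "\<lambda>n. superadd_closure \<Delta>1 n + superadd_closure \<Delta>2 n"
  have D: "superadditive ?D" "\<And>v n. dehn v n \<le> ?D n"
    using superadditive_add[OF superadditive_closure superadditive_closure, of \<Delta>1 \<Delta>2] z
      le_superadd_closure[of \<Delta>1] le_superadd_closure[of \<Delta>2]
    by (auto simp: dehn_def intro: trans_le_add1 trans_le_add2)
  note gp = gp.dehn[OF D \<Delta>[folded coll]]
  have "\<Delta> \<preceq> (\<lambda>n. max (superadd_closure \<Delta>1 n) (superadd_closure \<Delta>2 n))"
    by (rule asymp_le_trans_double[OF gp(1)]) (simp add: max_def)
  moreover have "\<Delta>1 \<preceq> \<Delta>"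
    using gp(2)[of True] t1.dehn_old[OF _ 1(3)] unfolding c1 by (auto simp: gen_def relator_def)
  moreover have "\<Delta>2 \<preceq> \<Delta>"
    using gp(2)[of False] t2.dehn_old[OF _ 2(3)] unfolding c2 by (auto simp: gen_def relator_def)
  ultimately show ?thesis using asymp_le_max[OF rel_dehn_function_mono[OF \<Delta>]] by blast
qed

section \<open>HNN-extensions\<close>

text \<open>The common conclusion for both HNN-extensions, which differ in their edges and in
  \<open>Q\<close>. With a single base group no letters can clash, so nothing is dropped.\<close>

lemma gluing_one_vertex:
  fixes P :: "'p monoid" and G :: "'a monoid" and M :: "'j::finite \<Rightarrow> 'a set"
  assumes gluing: "gluing_normal P Q (\<lambda>_. ()) (\<lambda>_. j\<^sub>0) (\<lambda>_. \<iota> ` carrier G) (\<lambda>j. \<iota> ` M j) \<tau>"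
    and hom: "group_hom G P \<iota>" and inj: "inj_on \<iota> (carrier G)"
    and notin: "\<And>j. M j \<notin> \<H>" and M_inj: "inj M" and \<tau>_inj: "inj_on \<tau> (- {j\<^sub>0})"
    and generated: "carrier P \<subseteq> generate P (\<iota> ` carrier G \<union> range \<tau> \<union> Q)"
    and \<Delta>: "rel_dehn_function P (image \<iota> ` \<H> \<union> {Q}) \<Delta>"
    and \<Delta>0: "rel_dehn_function G (\<H> \<union> range M) \<Delta>0"
  shows "\<Delta>0 \<preceq> \<Delta> \<and> \<Delta> \<preceq> superadd_closure \<Delta>0"
proof -
  interpret gluing_normal P Q "\<lambda>_. ()" "\<lambda>_. j\<^sub>0" "\<lambda>_. \<iota> ` carrier G" "\<lambda>j. \<iota> ` M j" \<tau> by (rule gluing)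
  obtain S T where ST: "word_presentation G (\<H> \<union> range M) S T" "area_bound G (\<H> \<union> range M) S T \<Delta>0"
    "\<And>f. area_bound G (\<H> \<union> range M) S T f \<Longrightarrow> \<Delta>0 \<le> f"
    using rel_dehn_function_words[OF \<Delta>0] by blast
  have img: "H = H'" if "\<iota> ` H = \<iota> ` H'" "H \<in> \<H> \<union> range M" "H' \<in> \<H> \<union> range M" for H H'
    using that subgroup.subset[OF rel_dehn_function_pair[OF \<Delta>0]] inj_on_image_eq_iff[OF inj] by metis
  interpret t: presentation_transport G P \<iota> "\<H> \<union> range M" S T \<Delta>0 "{}" "{}" "M j\<^sub>0"
    by (intro presentation_transport.intro presentation_transport_axioms.intro hom inj ST) auto
  have c: "t.new_collection = image \<iota> ` \<H> \<union> range (\<lambda>j. \<iota> ` M j)"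
    unfolding t.new_collection_def by auto
  interpret gp: gluing_presented P Q "\<lambda>_. ()" "\<lambda>_. j\<^sub>0" "\<lambda>_. \<iota> ` carrier G" "\<lambda>j. \<iota> ` M j" \<tau>
    "\<lambda>_. t.new_gens" "\<lambda>_. image \<iota> ` \<H>" "\<lambda>_. t.new_relators" "\<lambda>_. \<Delta>0"
  proof (rule gluing_presented.intro[OF gluing_normal_axioms gluing_presented_axioms.intro], goal_cases)
    case (1 v)
    then show ?case using t.new_presentation unfolding c by simp
  next
    case (2 i j)
    then show ?case using img[of "M i" "M j"] injD[OF M_inj] by blast
  next
    case (3 j)
    then show ?case
    proof
      assume "\<iota> ` M j \<in> image \<iota> ` \<H>"
      then obtain H where "\<iota> ` M j = \<iota> ` H" "H \<in> \<H>" by blast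
      then show False using img[of "M j" H] notin[of j] by simp
    qed
  next
    case (6 i j)
    then show ?case using inj_onD[OF \<tau>_inj] by blast
  qed (use generated in auto)
  have coll: "gp.collection = image \<iota> ` \<H> \<union> {Q}" by (simp add: gp.collection_def)
  note gp = gp.dehn[OF superadditive_closure le_superadd_closure \<Delta>[folded coll], OF rel_dehn_function_0[OF \<Delta>0]
      rel_dehn_function_0[OF \<Delta>0]]
  have "\<Delta>0 \<preceq> \<Delta>" using gp(2) t.dehn_old[OF _ ST(3)] unfolding c by auto
  then show ?thesis using gp(1) by blast
qed

locale hnn_setting = group G for G :: "'a monoid" +
  fixes C :: "'a set" and \<phi> :: "'a \<Rightarrow> 'a"
  assumes C: "subgroup C G" and \<phi>C: "subgroup (\<phi> ` C) G"
    and \<phi>_mult: "\<And>x y. x \<in> C \<Longrightarrow> y \<in> C \<Longrightarrow> \<phi> (x \<otimes>\<^bsub>G\<^esub> y) = \<phi> x \<otimes>\<^bsub>G\<^esub> \<phi> y"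
    and \<phi>_inj: "inj_on \<phi> C"
begin

definition P :: "'a hnn_letter list set monoid" where "P = hnn G C \<phi>"
definition \<iota> :: "'a \<Rightarrow> 'a hnn_letter list set" where "\<iota> = hnn_base G C \<phi>"
definition t :: "'a hnn_letter list set" where "t = hnn_stable G C \<phi>"

sublocale P: group P
  unfolding P_def by (rule group_hnn) (rule is_group)

sublocale h: group_hom G P \<iota>
  by unfold_locales (auto simp: P_def \<iota>_def hnn_base_hom)

lemma base_m_closed: "x \<in> carrier G \<Longrightarrow> y \<in> carrier G \<Longrightarrow> x \<otimes>\<^bsub>G\<^esub> y \<in> carrier G"
  by (rule m_closed)

lemma t_closed: "t \<in> carrier P"
  by (simp add: t_def P_def hnn_stable_closed)

lemma t_conj: "c \<in> C \<Longrightarrow> t \<otimes>\<^bsub>P\<^esub> \<iota> c \<otimes>\<^bsub>P\<^esub> inv\<^bsub>P\<^esub> t = \<iota> (\<phi> c)"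
  unfolding t_def P_def \<iota>_def by (rule hnn_stable_conj[OF is_group]) (use subgroup.subset[OF C] in auto)

lemma C_closed: "c \<in> C \<Longrightarrow> c \<in> carrier G" and \<phi>_closed: "c \<in> C \<Longrightarrow> \<phi> c \<in> carrier G"
  using subgroup.mem_carrier[OF C] subgroup.mem_carrier[OF \<phi>C] by auto

abbreviation R where "R \<equiv> hnn_rels G C \<phi>"

lemma P_presented: "P = presented (Base ` carrier G \<union> {Stable, StableInv}) R"
  by (simp add: P_def hnn_def)

lemma letters: "word_class R [Base g] = \<iota> g" "word_class R [Stable] = t" "word_class R [StableInv] = inv\<^bsub>P\<^esub> t"
proof -
  show "word_class R [Base g] = \<iota> g" "word_class R [Stable] = t"
    by (simp_all add: \<iota>_def t_def hnn_base_def hnn_stable_def)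
  have "word_class R [StableInv] \<otimes>\<^bsub>P\<^esub> t = \<one>\<^bsub>P\<^esub>"
    unfolding P_presented t_def hnn_stable_def
    by (auto simp: presented_mult presented_one word_class_eq_iff hnn_rels_def intro!: word_eq_base)
  moreover have "word_class R [StableInv] \<in> carrier P" by (auto simp: P_presented presented_carrier)
  ultimately show "word_class R [StableInv] = inv\<^bsub>P\<^esub> t"
    using P.inv_equality t_closed by metis
qed

lemma generated: "carrier P \<subseteq> generate P (\<iota> ` carrier G \<union> {t})"
proof -
  have "word_class R [l] \<in> generate P (\<iota> ` carrier G \<union> {t})"
    if "l \<in> Base ` carrier G \<union> {Stable, StableInv}" for l
    using that letters generate.incl[of _ "\<iota> ` carrier G \<union> {t}" P] generate.inv[of t "\<iota> ` carrier G \<union> {t}" P]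
    by auto
  then show ?thesis
    unfolding P_presented
    using word_class_generated[of "Base ` carrier G \<union> {Stable, StableInv}" R] P.is_group
    unfolding P_presented by blast
qed

lemma action:
  assumes closed: "\<And>g x. g \<in> carrier G \<Longrightarrow> x \<in> X \<Longrightarrow> a g x \<in> X" "\<And>x. x \<in> X \<Longrightarrow> b x \<in> X"
      "\<And>x. x \<in> X \<Longrightarrow> b' x \<in> X"
    and one: "\<And>x. x \<in> X \<Longrightarrow> a \<one>\<^bsub>G\<^esub> x = x"
    and mult: "\<And>g h x. g \<in> carrier G \<Longrightarrow> h \<in> carrier G \<Longrightarrow> x \<in> X \<Longrightarrow> a (g \<otimes>\<^bsub>G\<^esub> h) x = a g (a h x)"
    and bb': "\<And>x. x \<in> X \<Longrightarrow> b (b' x) = x" "\<And>x. x \<in> X \<Longrightarrow> b' (b x) = x"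
    and conj: "\<And>c x. c \<in> C \<Longrightarrow> x \<in> X \<Longrightarrow> b (a c (b' x)) = a (\<phi> c) x"
  obtains \<alpha> where
    "\<And>p p' x. p \<in> carrier P \<Longrightarrow> p' \<in> carrier P \<Longrightarrow> x \<in> X \<Longrightarrow> \<alpha> (p \<otimes>\<^bsub>P\<^esub> p') x = \<alpha> p (\<alpha> p' x)"
    "\<And>x. x \<in> X \<Longrightarrow> \<alpha> \<one>\<^bsub>P\<^esub> x = x"
    "\<And>g x. g \<in> carrier G \<Longrightarrow> x \<in> X \<Longrightarrow> \<alpha> (\<iota> g) x = a g x"
    "\<And>x. x \<in> X \<Longrightarrow> \<alpha> t x = b x" "\<And>x. x \<in> X \<Longrightarrow> \<alpha> (inv\<^bsub>P\<^esub> t) x = b' x"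
proof -
  define act where "act = (\<lambda>l x. case l of Base g \<Rightarrow> if g \<in> carrier G then a g x else x
    | Stable \<Rightarrow> b x | StableInv \<Rightarrow> b' x)"
  have act_closed: "act l x \<in> X" if "x \<in> X" for l x
    using that closed by (cases l) (auto simp: act_def)
  have rels: "foldr act u x = foldr act v x" if uv: "(u, v) \<in> R" and x: "x \<in> X" for u v x
  proof -
    from uv consider "u = [Base \<one>\<^bsub>G\<^esub>]" "v = []"
      | g k where "g \<in> carrier G" "k \<in> carrier G" "u = [Base g, Base k]" "v = [Base (g \<otimes>\<^bsub>G\<^esub> k)]"
      | "u = [Stable, StableInv]" "v = []" | "u = [StableInv, Stable]" "v = []"
      | c where "c \<in> C" "u = [Stable, Base c, StableInv]" "v = [Base (\<phi> c)]"
      by (auto simp: hnn_rels_def table_rels_def)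
    then show ?thesis
      by cases (use x one mult bb' conj C_closed \<phi>_closed in \<open>auto simp: act_def\<close>)
  qed
  note act_word = word_action(3)[of X act R, OF act_closed rels]
  note action = word_action(1,2)[of X act R, OF act_closed rels,
      where L = "Base ` carrier G \<union> {Stable, StableInv}", folded P_presented]
  show ?thesis
  proof (rule that[of "word_action act"])
    show "word_action act (\<iota> g) x = a g x" if "g \<in> carrier G" "x \<in> X" for g x
      using act_word[of x "[Base g]"] that by (simp add: letters act_def)
    show "word_action act t x = b x" "word_action act (inv\<^bsub>P\<^esub> t) x = b' x" if "x \<in> X" for x
      using act_word[of x "[Stable]"] act_word[of x "[StableInv]"] that by (simp_all add: letters act_def)
  qed (use action in auto)
qed

text \<open>The stable letter must act as a permutation that turns translation by c into translation
  by \<phi> c. The bijection \<theta> does so but leads from G \<times> Y to G \<times> Z; a further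
  factor of lists makes \<open>Y\<close> and \<open>Z\<close> interchangeable.\<close>

lemma inj: "inj_on \<iota> (carrier G)"
proof -
  interpret C: subgroup C G by (rule C)
  have hom: "(\<lambda>c. c) \<in> hom (G\<lparr>carrier := C\<rparr>) G" "\<phi> \<in> hom (G\<lparr>carrier := C\<rparr>) G"
    using \<phi>_mult \<phi>_closed C.subset by (auto simp: hom_def)
  obtain Y Z \<theta> where one: "\<one>\<^bsub>G\<^esub> \<in> Y" "\<one>\<^bsub>G\<^esub> \<in> Z"
    and \<theta>: "bij_betw \<theta> (carrier G \<times> Y) (carrier G \<times> Z)"
    and equi: "\<And>c x. c \<in> C \<Longrightarrow> x \<in> carrier G \<times> Y \<Longrightarrow>
      \<theta> (apfst ((\<otimes>\<^bsub>G\<^esub>) c) x) = apfst ((\<otimes>\<^bsub>G\<^esub>) (\<phi> c)) (\<theta> x)"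
    using equivariant_bijection[OF is_group is_group C.subgroup_is_group[OF is_group] hom(1) _ hom(2)] \<phi>_inj
    by auto
  \<comment> \<open>Moving the representative to the front of the list and leaving \<one> in its
    place is injective in both directions.\<close>
  have "\<exists>h. bij_betw h (Z \<times> (UNIV :: 'a list set)) (Y \<times> (UNIV :: 'a list set))"
    by (rule Schroeder_Bernstein[where f = "\<lambda>(r, z). (\<one>\<^bsub>G\<^esub>, r # z)" and g = "\<lambda>(r, z). (\<one>\<^bsub>G\<^esub>, r # z)"])
      (use one in \<open>auto simp: inj_on_def\<close>)
  then obtain h where h: "bij_betw h (Z \<times> (UNIV :: 'a list set)) (Y \<times> (UNIV :: 'a list set))" by blast
  let ?X = "(carrier G \<times> Y) \<times> (UNIV :: 'a list set)"
  define p where "p = (\<lambda>(a, b, c). ((a, b), c)) \<circ> map_prod id h \<circ> (\<lambda>((a, b), c). (a, b, c)) \<circ> map_prod \<theta> id"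
  have p: "bij_betw p ?X ?X"
    unfolding p_def
  proof (intro bij_betw_trans)
    show "bij_betw (map_prod \<theta> id) ?X ((carrier G \<times> Z) \<times> UNIV)" by (rule bij_betw_map_prod[OF \<theta> bij_betw_id])
    show "bij_betw (\<lambda>((a, b), c). (a, b, c)) ((carrier G \<times> Z) \<times> (UNIV :: 'a list set)) (carrier G \<times> Z \<times> UNIV)"
      by (rule bij_betw_byWitness[where f' = "\<lambda>(a, b, c). ((a, b), c)"]) auto
    show "bij_betw (map_prod id h) (carrier G \<times> Z \<times> UNIV) (carrier G \<times> Y \<times> UNIV)"
      by (rule bij_betw_map_prod[OF bij_betw_id h])
    show "bij_betw (\<lambda>(a, b, c). ((a, b), c)) (carrier G \<times> Y \<times> UNIV) ?X"
      by (rule bij_betw_byWitness[where f' = "\<lambda>((a, b), c). (a, b, c)"]) auto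
  qed
  let ?p' = "inv_into ?X p" and ?a = "\<lambda>g. apfst (apfst ((\<otimes>\<^bsub>G\<^esub>) g))"
  have p_mem: "p x \<in> ?X" "?p' (p x) = x" "?p' x \<in> ?X" "p (?p' x) = x" if "x \<in> ?X" for x
    using that bij_betwE[OF p] bij_betwE[OF bij_betw_inv_into[OF p]] bij_betw_inv_into_left[OF p]
      bij_betw_inv_into_right[OF p] by blast+
  have p_equi: "p (?a c x) = ?a (\<phi> c) (p x)" if c: "c \<in> C" and x: "x \<in> ?X" for c x
  proof -
    obtain g y l where "x = ((g, y), l)" "g \<in> carrier G" "y \<in> Y" using x by auto
    then show ?thesis using equi[OF c, of "(g, y)"] by (auto simp: p_def split: prod.splits)
  qed
  obtain \<alpha> where \<alpha>: "\<And>g x. g \<in> carrier G \<Longrightarrow> x \<in> ?X \<Longrightarrow> \<alpha> (\<iota> g) x = ?a g x"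
  proof (rule action[of ?X ?a p ?p'])
    fix c x assume c: "c \<in> C" and x: "x \<in> ?X"
    show "p (?a c (?p' x)) = ?a (\<phi> c) x" using p_equi[OF c p_mem(3)[OF x]] p_mem(4)[OF x] by simp
  qed (use p_mem m_assoc in auto)
  show ?thesis
  proof (rule inj_onI)
    fix g k assume g: "g \<in> carrier G" "k \<in> carrier G" "\<iota> g = \<iota> k"
    have "?a g x = ?a k x" if "x \<in> ?X" for x
      using \<alpha>[OF g(1) that] \<alpha>[OF g(2) that] g(3) by simp
    from this[of "((\<one>\<^bsub>G\<^esub>, \<one>\<^bsub>G\<^esub>), [])"] show "g = k" using g one by simp
  qed
qed

end

section \<open>HNN-extensions with two edge subgroups\<close>

locale hnn_two = hnn_setting G C \<phi>
  for G :: "'a monoid" and C \<phi> +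
  fixes K L :: "'a set"
  assumes K: "subgroup K G" and L: "subgroup L G" and CK: "C \<subseteq> K" and \<phi>L: "\<phi> ` C \<subseteq> L"
begin

definition Q where "Q = generate P (conj_set P (\<iota> ` K) t \<union> \<iota> ` L)"
definition A :: "unit \<Rightarrow> 'a hnn_letter list set set" where "A u = \<iota> ` carrier G"
definition E :: "bool \<Rightarrow> 'a hnn_letter list set set" where "E j = \<iota> ` (if j then K else L)"
definition \<tau> :: "bool \<Rightarrow> 'a hnn_letter list set" where "\<tau> j = (if j then t else \<one>\<^bsub>P\<^esub>)"

lemma K_mem: "k \<in> K \<Longrightarrow> k \<in> carrier G" and L_mem: "l \<in> L \<Longrightarrow> l \<in> carrier G"
  using subgroup.mem_carrier[OF K] subgroup.mem_carrier[OF L] by auto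

lemma Q_incl: "k \<in> K \<Longrightarrow> t \<otimes>\<^bsub>P\<^esub> \<iota> k \<otimes>\<^bsub>P\<^esub> inv\<^bsub>P\<^esub> t \<in> Q" "l \<in> L \<Longrightarrow> \<iota> l \<in> Q"
  unfolding Q_def conj_set_def by (auto intro!: generate.incl)

lemma conj_set_closed: "conj_set P (\<iota> ` K) t \<union> \<iota> ` L \<subseteq> carrier P"
  using K_mem L_mem t_closed by (auto simp: conj_set_def)

sublocale gluing P Q "\<lambda>_ :: bool. ()" "\<lambda>_. False" A E \<tau>
proof (intro gluing.intro gluing_axioms.intro P.is_group)
  show "subgroup Q P" unfolding Q_def by (rule P.generate_is_subgroup[OF conj_set_closed])
  show "subgroup (A v) P" for v unfolding A_def by (rule h.img_is_subgroup)
  fix j :: bool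
  show "subgroup (E j) P" unfolding E_def
    using h.subgroup_img_is_subgroup[OF K] h.subgroup_img_is_subgroup[OF L] by simp
  show "E j \<subseteq> A ()" using K_mem L_mem by (auto simp: A_def E_def)
  show "conj_set P (E j) (\<tau> j) \<subseteq> Q"
    using K_mem L_mem Q_incl by (auto simp: conj_set_def E_def \<tau>_def)
qed (auto simp: \<tau>_def t_closed)

lemma normal_forms: has_normal_forms
proof -
  have one: "\<one>\<^bsub>P\<^esub> \<in> A u" for u by (rule subgroup.one_closed[OF subgroup_A])
  have A: "\<iota> g \<in> A u" if "g \<in> carrier G" for g u using that by (simp add: A_def)
  have em: "excursion i a j (excursion j b l x) = excursion i (a \<otimes>\<^bsub>P\<^esub> b) l x"
    if "a \<in> A ()" "b \<in> A ()" "x \<in> forms None" for i j l a b x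
    using excursion_mult that by blast
  \<comment> \<open>\<open>t\<close> acts as the excursion through \<one> that enters along the edge
    of \<open>K\<close> and leaves along that of \<open>L\<close>. Conjugating c by it gives the
    excursion of c along \<open>K\<close>, which is translation by t c t^-1 and so equals the
    excursion of \<phi> c along \<open>L\<close>.\<close>
  have conj: "excursion True \<one>\<^bsub>P\<^esub> False (excursion False (\<iota> c) False (excursion False \<one>\<^bsub>P\<^esub> True x))
      = excursion False (\<iota> (\<phi> c)) False x" if c: "c \<in> C" and x: "x \<in> forms None" for c x
  proof -
    have ic: "\<iota> c \<in> A ()" "\<iota> c \<in> carrier P" using C_closed[OF c] by (auto simp: A_def)
    have "excursion True \<one>\<^bsub>P\<^esub> False (excursion False (\<iota> c) False (excursion False \<one>\<^bsub>P\<^esub> True x))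
        = excursion True (\<iota> c) True x"
      using ic one x by (simp add: em)
    also have "\<dots> = translate (t \<otimes>\<^bsub>P\<^esub> \<iota> c \<otimes>\<^bsub>P\<^esub> inv\<^bsub>P\<^esub> t) x"
      using excursion_K[OF x, of "\<iota> c" True] CK c by (auto simp: E_def \<tau>_def)
    also have "\<dots> = excursion False (\<iota> (\<phi> c)) False x"
      using excursion_K[OF x, of "\<iota> (\<phi> c)" False] \<phi>L c t_conj[OF c] \<phi>_closed[OF c]
      by (auto simp: E_def \<tau>_def)
    finally show ?thesis .
  qed
  obtain \<alpha> where
    mult: "\<And>p p' x. p \<in> carrier P \<Longrightarrow> p' \<in> carrier P \<Longrightarrow> x \<in> forms None \<Longrightarrow> \<alpha> (p \<otimes>\<^bsub>P\<^esub> p') x = \<alpha> p (\<alpha> p' x)"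
    and unit: "\<And>x. x \<in> forms None \<Longrightarrow> \<alpha> \<one>\<^bsub>P\<^esub> x = x"
    and base: "\<And>g x. g \<in> carrier G \<Longrightarrow> x \<in> forms None \<Longrightarrow> \<alpha> (\<iota> g) x = excursion False (\<iota> g) False x"
    and t: "\<And>x. x \<in> forms None \<Longrightarrow> \<alpha> t x = excursion True \<one>\<^bsub>P\<^esub> False x"
      "\<And>x. x \<in> forms None \<Longrightarrow> \<alpha> (inv\<^bsub>P\<^esub> t) x = excursion False \<one>\<^bsub>P\<^esub> True x"
  proof (rule action[of "forms None" "\<lambda>g. excursion False (\<iota> g) False" "excursion True \<one>\<^bsub>P\<^esub> False"
        "excursion False \<one>\<^bsub>P\<^esub> True"])
    fix g h x assume "g \<in> carrier G" "h \<in> carrier G" "x \<in> forms None"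
    then show "excursion False (\<iota> (g \<otimes>\<^bsub>G\<^esub> h)) False x
        = excursion False (\<iota> g) False (excursion False (\<iota> h) False x)"
      by (simp add: A em)
  next
    fix x assume "x \<in> forms None"
    then show "excursion True \<one>\<^bsub>P\<^esub> False (excursion False \<one>\<^bsub>P\<^esub> True x) = x"
      "excursion False \<one>\<^bsub>P\<^esub> True (excursion True \<one>\<^bsub>P\<^esub> False x) = x"
      by (simp_all add: em one excursion_one)
  qed (use A one conj excursion_closed excursion_one in auto)
  have \<tau>: "\<alpha> (\<tau> i) x = excursion i \<one>\<^bsub>P\<^esub> False x" "\<alpha> (inv\<^bsub>P\<^esub> \<tau> i) x = excursion False \<one>\<^bsub>P\<^esub> i x"
    if "x \<in> forms None" for i x
    using that unit t excursion_one by (cases i; simp add: \<tau>_def)+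
  have exc: "\<alpha> (\<tau> i \<otimes>\<^bsub>P\<^esub> a \<otimes>\<^bsub>P\<^esub> inv\<^bsub>P\<^esub> \<tau> j) x = excursion i a j x"
    if a: "a \<in> A ()" and x: "x \<in> forms None" for i j a x
  proof -
    have c: "\<tau> i \<in> carrier P" "a \<in> carrier P" "inv\<^bsub>P\<^esub> \<tau> j \<in> carrier P"
      using \<tau>_closed A_closed[OF a] by auto
    have y: "excursion False \<one>\<^bsub>P\<^esub> j x \<in> forms None" "excursion False a j x \<in> forms None"
      using excursion_closed one a x by auto
    obtain g where g: "g \<in> carrier G" "a = \<iota> g" using a by (auto simp: A_def)
    have \<alpha>a: "\<alpha> a z = excursion False a False z" if "z \<in> forms None" for z
      unfolding g(2) by (rule base[OF g(1) that])
    have "\<alpha> (\<tau> i \<otimes>\<^bsub>P\<^esub> a \<otimes>\<^bsub>P\<^esub> inv\<^bsub>P\<^esub> \<tau> j) x = \<alpha> (\<tau> i) (\<alpha> a (\<alpha> (inv\<^bsub>P\<^esub> \<tau> j) x))"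
      using c mult[OF P.m_closed[OF c(1,2)] c(3) x] mult[OF c(1,2)] y(1) \<tau>(2)[OF x] by simp
    also have "\<dots> = excursion i \<one>\<^bsub>P\<^esub> False (excursion False a j x)"
      using \<tau>(2)[OF x] \<alpha>a[OF y(1)] em[OF a one x, of False False j] \<tau>(1)[OF y(2)] c(2) by simp
    also have "\<dots> = excursion i a j x"
      using em[OF one a x, of i False j] c(2) by simp
    finally show ?thesis .
  qed
  show ?thesis
  proof (rule normal_form[OF mult])
    fix q x assume q: "q \<in> Q" and x: "x \<in> forms None"
    show "\<alpha> q x = translate q x"
    proof (rule generated_translate[OF mult unit Q_def _ q x])
      fix h x assume h: "h \<in> conj_set P (\<iota> ` K) t \<union> \<iota> ` L" and x: "x \<in> forms None"
      have "\<exists>j k. k \<in> E j \<and> h = \<tau> j \<otimes>\<^bsub>P\<^esub> k \<otimes>\<^bsub>P\<^esub> inv\<^bsub>P\<^esub> (\<tau> j)"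
      proof (cases "h \<in> \<iota> ` L")
        case True
        then show ?thesis using L_mem by (intro exI[of _ False] exI[of _ h]) (auto simp: E_def \<tau>_def)
      next
        case False
        then show ?thesis using h by (intro exI[of _ True]) (auto simp: conj_set_def E_def \<tau>_def)
      qed
      then obtain j k where k: "k \<in> E j" "h = \<tau> j \<otimes>\<^bsub>P\<^esub> k \<otimes>\<^bsub>P\<^esub> inv\<^bsub>P\<^esub> (\<tau> j)" by blast
      then show "\<alpha> h x = translate h x"
        using exc[OF _ x, of k j j] excursion_K[OF x k(1)] K_subset[of j] by auto
    qed
  qed (use exc in auto)
qed

sublocale gluing_normal P Q "\<lambda>_ :: bool. ()" "\<lambda>_. False" A E \<tau>
  by unfold_locales (rule normal_forms)

theorem dehn:
  assumes "K \<notin> \<H>" "L \<notin> \<H>" "K \<noteq> L"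
    and \<Delta>: "rel_dehn_function P (image \<iota> ` \<H> \<union> {Q}) \<Delta>"
    and \<Delta>0: "rel_dehn_function G (\<H> \<union> {K, L}) \<Delta>0"
  shows "\<Delta>0 \<preceq> \<Delta> \<and> \<Delta> \<preceq> superadd_closure \<Delta>0"
proof (rule gluing_one_vertex[OF gluing_normal_axioms[unfolded A_def E_def] h.group_hom_axioms inj])
  let ?M = "\<lambda>j. if j then K else L"
  have "\<iota> ` carrier G \<union> {t} \<subseteq> \<iota> ` carrier G \<union> range \<tau> \<union> Q" by (auto simp: \<tau>_def)
  from P.mono_generate[OF this]
  show "carrier P \<subseteq> generate P (\<iota> ` carrier G \<union> range \<tau> \<union> Q)" using generated by blast
  show "rel_dehn_function G (\<H> \<union> range ?M) \<Delta>0" using \<Delta>0 by (simp add: UNIV_bool insert_commute)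
qed (use assms in \<open>auto simp: inj_on_def\<close>)

end

text \<open>With u = s^-1 t in place of \<open>t\<close>, the stable letter carries \<open>C\<close>
  into \<open>K\<close> itself. Thus \<open>u\<close> can be put into \<open>Q\<close>, and a single
  edge with trivial \<tau> remains.\<close>

locale hnn_one = hnn_setting G C \<phi>
  for G :: "'a monoid" and C \<phi> +
  fixes K :: "'a set" and s :: 'a
  assumes K: "subgroup K G" and CK: "C \<subseteq> K" and s: "s \<in> carrier G" and \<phi>K: "\<phi> ` C \<subseteq> conj_set G K s"
begin

definition u where "u = inv\<^bsub>P\<^esub> (\<iota> s) \<otimes>\<^bsub>P\<^esub> t"
definition Q where "Q = generate P (\<iota> ` K \<union> {u})"
definition A :: "unit \<Rightarrow> 'a hnn_letter list set set" where "A v = \<iota> ` carrier G"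
definition E :: "unit \<Rightarrow> 'a hnn_letter list set set" where "E j = \<iota> ` K"

lemma K_mem: "k \<in> K \<Longrightarrow> k \<in> carrier G"
  using subgroup.mem_carrier[OF K] by auto

lemma u_closed: "u \<in> carrier P"
  using s t_closed by (simp add: u_def)

lemma Q_incl: "k \<in> K \<Longrightarrow> \<iota> k \<in> Q" and u_Q: "u \<in> Q"
  unfolding Q_def by (auto intro!: generate.incl)

sublocale gluing P Q "\<lambda>_ :: unit. ()" "\<lambda>_. ()" A E "\<lambda>_. \<one>\<^bsub>P\<^esub>"
proof (intro gluing.intro gluing_axioms.intro P.is_group)
  show "subgroup Q P" unfolding Q_def
    by (rule P.generate_is_subgroup) (use K_mem u_closed in auto)
  show "subgroup (A v) P" for v unfolding A_def by (rule h.img_is_subgroup)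
  fix j :: unit
  show "subgroup (E j) P" unfolding E_def using h.subgroup_img_is_subgroup[OF K] by simp
  show "E j \<subseteq> A ()" using K_mem by (auto simp: A_def E_def)
  show "conj_set P (E j) \<one>\<^bsub>P\<^esub> \<subseteq> Q" using K_mem Q_incl by (auto simp: conj_set_def E_def)
qed auto

lemma normal_forms: has_normal_forms
proof -
  let ?a = "\<lambda>g. excursion () (\<iota> g) ()"
  \<comment> \<open>These mirror t = s u and its inverse: \<open>u\<close> lies in \<open>Q\<close>
    and translates, while s acts as an excursion.\<close>
  let ?b = "\<lambda>x. ?a s (translate u x)" and ?b' = "\<lambda>x. translate (inv\<^bsub>P\<^esub> u) (?a (inv\<^bsub>G\<^esub> s) x)"
  have A: "\<iota> g \<in> A ()" if "g \<in> carrier G" for g using that by (simp add: A_def)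
  have closed: "?a g x \<in> forms None" if "g \<in> carrier G" "x \<in> forms None" for g x
    using that A excursion_closed by simp
  have tr: "translate q x \<in> forms None" if "q \<in> Q" "x \<in> forms None" for q x
    using that by (intro translate_closed) auto
  have tr_mult: "translate (p \<otimes>\<^bsub>P\<^esub> q) x = translate p (translate q x)"
    if "p \<in> Q" "q \<in> Q" "x \<in> forms None" for p q x
    using translate_mult[OF Q_closed Q_closed] that by blast
  have iu: "inv\<^bsub>P\<^esub> u \<in> Q" using u_Q subgroup.m_inv_closed[OF subgroup_Q] by blast
  have amult: "?a (g \<otimes>\<^bsub>G\<^esub> h) x = ?a g (?a h x)" if "g \<in> carrier G" "h \<in> carrier G" "x \<in> forms None" for g h x
    using excursion_mult that by (simp add: A)
  have aone: "?a \<one>\<^bsub>G\<^esub> x = x" if "x \<in> forms None" for x using excursion_one[OF that] by simp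
  have iS: "inv\<^bsub>G\<^esub> s \<in> carrier G" using s by simp
  have aK: "?a k x = translate (\<iota> k) x" if "k \<in> K" "x \<in> forms None" for k x
    using excursion_K[OF that(2), of "\<iota> k" "()"] that(1) K_mem by (simp add: E_def)
  have bb': "?b (?b' x) = x" "?b' (?b x) = x" if x: "x \<in> forms None" for x
  proof -
    have "translate u (?b' x) = ?a (inv\<^bsub>G\<^esub> s) x"
      using tr_mult[OF u_Q iu closed[OF iS x]] translate_one[OF closed[OF iS x]] u_closed by simp
    then show "?b (?b' x) = x" using amult[OF s iS x] aone[OF x] s by simp
    have "?a (inv\<^bsub>G\<^esub> s) (?b x) = translate u x"
      using amult[OF iS s tr[OF u_Q x]] aone[OF tr[OF u_Q x]] s by simp
    then show "?b' (?b x) = x" using tr_mult[OF iu u_Q x] translate_one[OF x] u_closed by simp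
  qed
  have conj: "?b (?a c (?b' x)) = ?a (\<phi> c) x" if c: "c \<in> C" and x: "x \<in> forms None" for c x
  proof -
    obtain k where k: "k \<in> K" "\<phi> c = s \<otimes>\<^bsub>G\<^esub> k \<otimes>\<^bsub>G\<^esub> inv\<^bsub>G\<^esub> s" using \<phi>K c by (auto simp: conj_set_def)
    have cK: "c \<in> K" and ic: "\<iota> c \<in> Q" and kc: "k \<in> carrier G" using CK c Q_incl k(1) K_mem by auto
    let ?y = "?a (inv\<^bsub>G\<^esub> s) x"
    have y: "?y \<in> forms None" by (rule closed[OF iS x])
    \<comment> \<open>Removing the conjugation by s turns the relation for \<open>t\<close> into u c
      u^-1 = k, a relation between elements of \<open>Q\<close>.\<close>
    have "u \<otimes>\<^bsub>P\<^esub> \<iota> c \<otimes>\<^bsub>P\<^esub> inv\<^bsub>P\<^esub> u = inv\<^bsub>P\<^esub> (\<iota> s) \<otimes>\<^bsub>P\<^esub> (t \<otimes>\<^bsub>P\<^esub> \<iota> c \<otimes>\<^bsub>P\<^esub> inv\<^bsub>P\<^esub> t) \<otimes>\<^bsub>P\<^esub> \<iota> s"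
      using s t_closed C_closed[OF c] by (simp add: u_def P.inv_mult_group P.m_assoc)
    also have "\<dots> = inv\<^bsub>P\<^esub> (\<iota> s) \<otimes>\<^bsub>P\<^esub> (\<iota> s \<otimes>\<^bsub>P\<^esub> \<iota> k \<otimes>\<^bsub>P\<^esub> inv\<^bsub>P\<^esub> (\<iota> s)) \<otimes>\<^bsub>P\<^esub> \<iota> s"
      using t_conj[OF c] k(2) s kc by simp
    also have "\<dots> = \<iota> k" using conj_cancel(1)[of "\<iota> s" "\<iota> k"] s kc by simp
    finally have uc: "u \<otimes>\<^bsub>P\<^esub> \<iota> c \<otimes>\<^bsub>P\<^esub> inv\<^bsub>P\<^esub> u = \<iota> k" .
    have "translate u (?a c (?b' x)) = translate u (translate (\<iota> c) (translate (inv\<^bsub>P\<^esub> u) ?y))"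
      using aK[OF cK tr[OF iu y]] by simp
    also have "\<dots> = translate (u \<otimes>\<^bsub>P\<^esub> \<iota> c \<otimes>\<^bsub>P\<^esub> inv\<^bsub>P\<^esub> u) ?y"
      using tr_mult[OF u_Q ic tr[OF iu y]] tr_mult[OF subgroup.m_closed[OF subgroup_Q u_Q ic] iu y] by simp
    also have "\<dots> = ?a k ?y" unfolding uc using aK[OF k(1) y] by simp
    finally have "?b (?a c (?b' x)) = ?a s (?a k ?y)" by simp
    also have "\<dots> = ?a (\<phi> c) x"
      using amult[OF s kc y] amult[OF base_m_closed[OF s kc] iS x] k(2) by simp
    finally show ?thesis .
  qed
  have cb: "?b x \<in> forms None" "?b' x \<in> forms None" if "x \<in> forms None" for x
    using closed[OF s tr[OF u_Q that]] tr[OF iu closed[OF iS that]] by blast+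
  obtain \<alpha> where
    mult: "\<And>p p' x. p \<in> carrier P \<Longrightarrow> p' \<in> carrier P \<Longrightarrow> x \<in> forms None \<Longrightarrow> \<alpha> (p \<otimes>\<^bsub>P\<^esub> p') x = \<alpha> p (\<alpha> p' x)"
    and unit: "\<And>x. x \<in> forms None \<Longrightarrow> \<alpha> \<one>\<^bsub>P\<^esub> x = x"
    and base: "\<And>g x. g \<in> carrier G \<Longrightarrow> x \<in> forms None \<Longrightarrow> \<alpha> (\<iota> g) x = ?a g x"
    and t: "\<And>x. x \<in> forms None \<Longrightarrow> \<alpha> t x = ?b x"
      "\<And>x. x \<in> forms None \<Longrightarrow> \<alpha> (inv\<^bsub>P\<^esub> t) x = ?b' x"
  proof (rule action[of "forms None" ?a ?b ?b'], goal_cases)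
    case 9
    from 9(2-) show ?case by (rule 9(1))
  qed (rule closed cb aone amult bb' conj; assumption)+
  show ?thesis
  proof (rule normal_form[OF mult])
    fix q x assume q: "q \<in> Q" and x: "x \<in> forms None"
    show "\<alpha> q x = translate q x"
    proof (rule generated_translate[OF mult unit Q_def _ q x])
      fix h x assume h: "h \<in> \<iota> ` K \<union> {u}" and x: "x \<in> forms None"
      have "\<alpha> u x = \<alpha> (\<iota> (inv\<^bsub>G\<^esub> s)) (\<alpha> t x)"
        using mult[of "\<iota> (inv\<^bsub>G\<^esub> s)" t x] s t_closed x by (simp add: u_def)
      also have "\<dots> = ?a (inv\<^bsub>G\<^esub> s) (?b x)"
        using t(1)[OF x] base[OF iS closed[OF s tr[OF u_Q x]]] by simp
      also have "\<dots> = translate u x"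
        using amult[OF iS s tr[OF u_Q x]] aone[OF tr[OF u_Q x]] s by simp
      finally have "\<alpha> u x = translate u x" .
      moreover have "\<alpha> (\<iota> k) x = translate (\<iota> k) x" if "k \<in> K" for k
        using base[OF K_mem[OF that] x] aK[OF that x] by simp
      ultimately show "\<alpha> h x = translate h x" using h by blast
    qed
  next
    fix i j :: unit and a x assume a: "a \<in> A ()" and x: "x \<in> forms None"
    then obtain g where g: "g \<in> carrier G" "a = \<iota> g" by (auto simp: A_def)
    show "\<alpha> (\<one>\<^bsub>P\<^esub> \<otimes>\<^bsub>P\<^esub> a \<otimes>\<^bsub>P\<^esub> inv\<^bsub>P\<^esub> \<one>\<^bsub>P\<^esub>) x = excursion i a j x"
      using base[OF g(1) x] g by simp
  qed
qed

sublocale gluing_normal P Q "\<lambda>_ :: unit. ()" "\<lambda>_. ()" A E "\<lambda>_. \<one>\<^bsub>P\<^esub>"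
  by unfold_locales (rule normal_forms)

theorem dehn:
  assumes "K \<notin> \<H>"
    and \<Delta>: "rel_dehn_function P (image \<iota> ` \<H> \<union> {Q}) \<Delta>"
    and \<Delta>0: "rel_dehn_function G (\<H> \<union> {K}) \<Delta>0"
  shows "\<Delta>0 \<preceq> \<Delta> \<and> \<Delta> \<preceq> superadd_closure \<Delta>0"
proof (rule gluing_one_vertex[OF gluing_normal_axioms[unfolded A_def E_def] h.group_hom_axioms inj])
  let ?X = "\<iota> ` carrier G \<union> range (\<lambda>_ :: unit. \<one>\<^bsub>P\<^esub>) \<union> Q"
  have X: "?X \<subseteq> carrier P" using Q_closed by auto
  \<comment> \<open>The gluing provides \<open>u\<close> in \<open>Q\<close> instead of
    \<open>t\<close>; the stable letter is recovered as s u.\<close>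
  have "\<iota> s \<otimes>\<^bsub>P\<^esub> u \<in> generate P ?X"
    by (rule generate.eng; rule generate.incl) (use s u_Q in auto)
  moreover have "\<iota> s \<otimes>\<^bsub>P\<^esub> u = t" using s t_closed by (simp add: u_def P.mult_inv_cancel)
  ultimately have "\<iota> ` carrier G \<union> {t} \<subseteq> generate P ?X" by (auto intro!: generate.incl)
  then have "generate P (\<iota> ` carrier G \<union> {t}) \<subseteq> generate P ?X"
    by (rule P.generate_subgroup_incl[OF _ P.generate_is_subgroup[OF X]])
  then show "carrier P \<subseteq> generate P ?X" using generated by blast
  show "rel_dehn_function G (\<H> \<union> range (\<lambda>_ :: unit. K)) \<Delta>0" using \<Delta>0 by simp
qed (use assms in \<open>auto simp: inj_on_def\<close>)

end

section \<open>The three cases in terms of the original data\<close>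

lemma amalg_dehn:
  fixes G1 :: "'a monoid" and G2 :: "'b monoid" and C :: "'c monoid" and \<delta>1 \<delta>2
  defines "P \<equiv> amalg G1 G2 C \<delta>1 \<delta>2"
    and "\<iota>1 \<equiv> amalg_inl G1 G2 C \<delta>1 \<delta>2" and "\<iota>2 \<equiv> amalg_inr G1 G2 C \<delta>1 \<delta>2"
  assumes "K1 \<notin> \<H>1" "K2 \<notin> \<H>2" "group C"
    and \<delta>: "\<delta>1 \<in> mon C (G1\<lparr>carrier := K1\<rparr>)" "\<delta>2 \<in> mon C (G2\<lparr>carrier := K2\<rparr>)"
    and \<Delta>: "rel_dehn_function P (image \<iota>1 ` \<H>1 \<union> image \<iota>2 ` \<H>2 \<union> {generate P (\<iota>1 ` K1 \<union> \<iota>2 ` K2)}) \<Delta>"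
    and \<Delta>1: "rel_dehn_function G1 (\<H>1 \<union> {K1}) \<Delta>1" and \<Delta>2: "rel_dehn_function G2 (\<H>2 \<union> {K2}) \<Delta>2"
  shows "(\<lambda>n. max (\<Delta>1 n) (\<Delta>2 n)) \<preceq> \<Delta> \<and>
    \<Delta> \<preceq> (\<lambda>n. max (superadd_closure \<Delta>1 n) (superadd_closure \<Delta>2 n))"
proof -
  have "group G1" "group G2" using \<Delta>1 \<Delta>2 by (auto simp: rel_dehn_function_def group_pair_def)
  then interpret M: amalg_setting G1 G2 C \<delta>1 \<delta>2 K1 K2
    using \<open>group C\<close> \<delta> rel_dehn_function_pair[OF \<Delta>1] rel_dehn_function_pair[OF \<Delta>2]
    by (simp add: amalg_setting_def amalg_setting_axioms_def)
  show ?thesis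
    by (rule M.dehn[OF assms(4,5) _ \<Delta>1 \<Delta>2])
      (use \<Delta> in \<open>simp only: M.P_def M.\<iota>1_def M.\<iota>2_def M.Q_def P_def \<iota>1_def \<iota>2_def\<close>)
qed

lemma hom_image_subgroup:
  fixes G :: "'a monoid"
  assumes "group G" "subgroup C G" "\<And>x y. x \<in> C \<Longrightarrow> y \<in> C \<Longrightarrow> \<phi> (x \<otimes>\<^bsub>G\<^esub> y) = \<phi> x \<otimes>\<^bsub>G\<^esub> \<phi> y"
    and "\<phi> ` C \<subseteq> carrier G"
  shows "subgroup (\<phi> ` C) G"
proof -
  interpret group G by fact
  interpret group_hom "G\<lparr>carrier := C\<rparr>" G \<phi>
    by (intro group_hom.intro group_hom_axioms.intro subgroup.subgroup_is_group is_group)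
      (use assms in \<open>auto simp: hom_def\<close>)
  show ?thesis using img_is_subgroup by simp
qed

lemma hnn_two_dehn:
  fixes G :: "'d monoid" and C \<phi>
  defines "P \<equiv> hnn G C \<phi>" and "\<iota> \<equiv> hnn_base G C \<phi>" and "t \<equiv> hnn_stable G C \<phi>"
  assumes "K \<notin> \<H>" "L \<notin> \<H>" "K \<noteq> L"
    and C: "subgroup C (G\<lparr>carrier := K\<rparr>)" and \<phi>: "\<phi> \<in> mon (G\<lparr>carrier := C\<rparr>) (G\<lparr>carrier := L\<rparr>)"
    and \<Delta>: "rel_dehn_function P (image \<iota> ` \<H> \<union> {generate P (conj_set P (\<iota> ` K) t \<union> \<iota> ` L)}) \<Delta>"
    and \<Delta>0: "rel_dehn_function G (\<H> \<union> {K, L}) \<Delta>0"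
  shows "\<Delta>0 \<preceq> \<Delta> \<and> \<Delta> \<preceq> superadd_closure \<Delta>0"
proof -
  have G: "group G" using \<Delta>0 by (auto simp: rel_dehn_function_def group_pair_def)
  have K: "subgroup K G" and L: "subgroup L G" using rel_dehn_function_pair[OF \<Delta>0] by auto
  have CG: "subgroup C G" by (rule group.subgroup_carrier_update[OF G K C])
  have \<phi>L: "\<phi> ` C \<subseteq> L" and inj: "inj_on \<phi> C"
    and mult: "\<And>x y. x \<in> C \<Longrightarrow> y \<in> C \<Longrightarrow> \<phi> (x \<otimes>\<^bsub>G\<^esub> y) = \<phi> x \<otimes>\<^bsub>G\<^esub> \<phi> y"
    using \<phi> by (auto simp: mon_def hom_def)
  interpret M: hnn_two G C \<phi> K L
  proof (intro hnn_two.intro hnn_setting.intro hnn_setting_axioms.intro hnn_two_axioms.intro G CG inj mult K L \<phi>L)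
    show "subgroup (\<phi> ` C) G" by (rule hom_image_subgroup[OF G CG mult]) (use \<phi>L subgroup.subset[OF L] in auto)
    show "C \<subseteq> K" using subgroup.subset[OF C] by simp
  qed
  show ?thesis
    by (rule M.dehn[OF assms(4-6) _ \<Delta>0])
      (use \<Delta> in \<open>simp only: M.P_def M.\<iota>_def M.t_def M.Q_def P_def \<iota>_def t_def\<close>)
qed

lemma hnn_one_dehn:
  fixes G :: "'e monoid" and C \<phi>
  defines "P \<equiv> hnn G C \<phi>" and "\<iota> \<equiv> hnn_base G C \<phi>" and "t \<equiv> hnn_stable G C \<phi>"
  assumes "K \<notin> \<H>"
    and C: "subgroup C (G\<lparr>carrier := K\<rparr>)" and s: "s \<in> carrier G"
    and \<phi>: "\<phi> \<in> mon (G\<lparr>carrier := C\<rparr>) (G\<lparr>carrier := conj_set G K s\<rparr>)"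
    and \<Delta>: "rel_dehn_function P (image \<iota> ` \<H> \<union> {generate P (\<iota> ` K \<union> {inv\<^bsub>P\<^esub> (\<iota> s) \<otimes>\<^bsub>P\<^esub> t})}) \<Delta>"
    and \<Delta>0: "rel_dehn_function G (\<H> \<union> {K}) \<Delta>0"
  shows "\<Delta>0 \<preceq> \<Delta> \<and> \<Delta> \<preceq> superadd_closure \<Delta>0"
proof -
  have G: "group G" using \<Delta>0 by (auto simp: rel_dehn_function_def group_pair_def)
  have K: "subgroup K G" using rel_dehn_function_pair[OF \<Delta>0] by auto
  have CG: "subgroup C G" by (rule group.subgroup_carrier_update[OF G K C])
  have \<phi>K: "\<phi> ` C \<subseteq> conj_set G K s" and inj: "inj_on \<phi> C"
    and mult: "\<And>x y. x \<in> C \<Longrightarrow> y \<in> C \<Longrightarrow> \<phi> (x \<otimes>\<^bsub>G\<^esub> y) = \<phi> x \<otimes>\<^bsub>G\<^esub> \<phi> y"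
    using \<phi> by (auto simp: mon_def hom_def)
  have "conj_set G K s \<subseteq> carrier G" by (rule subgroup.subset[OF subgroup_conj_set[OF G K s]])
  then interpret M: hnn_one G C \<phi> K s
    using subgroup.subset[OF C] \<phi>K
    by (intro hnn_one.intro hnn_setting.intro hnn_setting_axioms.intro hnn_one_axioms.intro G CG inj mult K s
        hom_image_subgroup) auto
  show ?thesis
    by (rule M.dehn[OF assms(4) _ \<Delta>0])
      (use \<Delta> in \<open>simp only: M.P_def M.\<iota>_def M.t_def M.u_def M.Q_def P_def \<iota>_def t_def\<close>)
qed

theorem theorem1p6:
  shows
    "(\<forall>(G1 :: 'a monoid) (G2 :: 'b monoid) (C :: 'c monoid) \<H>1 \<H>2 K1 K2 \<delta>1 \<delta>2 \<Delta> \<Delta>1 \<Delta>2.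
        let P = amalg G1 G2 C \<delta>1 \<delta>2;
            \<iota>1 = amalg_inl G1 G2 C \<delta>1 \<delta>2;
            \<iota>2 = amalg_inr G1 G2 C \<delta>1 \<delta>2;
            \<H> = image \<iota>1 ` \<H>1 \<union> image \<iota>2 ` \<H>2
        in K1 \<notin> \<H>1 \<and> K2 \<notin> \<H>2 \<and>
           class_D G1 (\<H>1 \<union> {K1}) \<and> class_D G2 (\<H>2 \<union> {K2}) \<and>
           group C \<and>
           \<delta>1 \<in> mon C (G1\<lparr>carrier := K1\<rparr>) \<and> \<delta>2 \<in> mon C (G2\<lparr>carrier := K2\<rparr>) \<and>
           rel_dehn_function P (\<H> \<union> {generate P (\<iota>1 ` K1 \<union> \<iota>2 ` K2)}) \<Delta> \<and>
           rel_dehn_function G1 (\<H>1 \<union> {K1}) \<Delta>1 \<and>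
           rel_dehn_function G2 (\<H>2 \<union> {K2}) \<Delta>2
           \<longrightarrow> (\<lambda>n. max (\<Delta>1 n) (\<Delta>2 n)) \<preceq> \<Delta> \<and>
               \<Delta> \<preceq> (\<lambda>n. max (superadd_closure \<Delta>1 n) (superadd_closure \<Delta>2 n)))
   \<and>
     (\<forall>(G :: 'd monoid) \<H> K L C \<phi> \<Delta> \<Delta>0.
        let P = hnn G C \<phi>;
            \<iota> = hnn_base G C \<phi>;
            t = hnn_stable G C \<phi>
        in K \<notin> \<H> \<and> L \<notin> \<H> \<and> K \<noteq> L \<and>
           class_D G (\<H> \<union> {K, L}) \<and>
           subgroup C (G\<lparr>carrier := K\<rparr>) \<and>
           \<phi> \<in> mon (G\<lparr>carrier := C\<rparr>) (G\<lparr>carrier := L\<rparr>) \<and>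
           rel_dehn_function P (image \<iota> ` \<H> \<union> {generate P (conj_set P (\<iota> ` K) t \<union> \<iota> ` L)}) \<Delta> \<and>
           rel_dehn_function G (\<H> \<union> {K, L}) \<Delta>0
           \<longrightarrow> \<Delta>0 \<preceq> \<Delta> \<and> \<Delta> \<preceq> superadd_closure \<Delta>0)
   \<and>
     (\<forall>(G :: 'e monoid) \<H> K C s \<phi> \<Delta> \<Delta>0.
        let P = hnn G C \<phi>;
            \<iota> = hnn_base G C \<phi>;
            t = hnn_stable G C \<phi>
        in K \<notin> \<H> \<and>
           class_D G (\<H> \<union> {K}) \<and>
           subgroup C (G\<lparr>carrier := K\<rparr>) \<and>
           s \<in> carrier G \<and>
           \<phi> \<in> mon (G\<lparr>carrier := C\<rparr>) (G\<lparr>carrier := conj_set G K s\<rparr>) \<and>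
           rel_dehn_function P
             (image \<iota> ` \<H> \<union> {generate P (\<iota> ` K \<union> {inv\<^bsub>P\<^esub> (\<iota> s) \<otimes>\<^bsub>P\<^esub> t})}) \<Delta> \<and>
           rel_dehn_function G (\<H> \<union> {K}) \<Delta>0
           \<longrightarrow> \<Delta>0 \<preceq> \<Delta> \<and> \<Delta> \<preceq> superadd_closure \<Delta>0)"
  unfolding Let_def
  by (intro conjI; intro allI impI; elim conjE; rule amalg_dehn hnn_two_dehn hnn_one_dehn; assumption)

end
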